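(* Let $I=[a,b]\subset\mathbb{R}$ be a closed bounded interval ($a<b$) and let $f\in\mathrm{BV}(I)$ be left-continuous. If $\varphi\in\Phi_{\mathrm c}(I)$ satisfies (VA1) and (Dec), then $$\overline{\mathrm V}^\varphi_I(f)=\int_I\varphi(x,|f'(x)|)\,dx+\int_I\varphi'_\infty\,d|D^sf|$$ (as an equality in $[0,\infty]$), where $\varphi'_\infty(x):=\lim_{t\to\infty}\frac{\varphi(x,t)}{t}\in[0,\infty]$.
   Context: $\Phi_{\mathrm c}(I)$ is the set of functions $\varphi:I\times[0,\infty)\to[0,\infty]$ such that: $x\mapsto\varphi(x,|g(x)|)$ is measurable for every measurable $g:I\to\mathbb{R}$; and for every $x\in I$ the function $t\mapsto\varphi(x,t)$ is non-decreasing, convex and left-continuous with $\varphi(x,0)=\lim_{t\to0^+}\varphi(x,t)=0$ and $\lim_{t\to\infty}\varphi(x,t)=\infty$. (VA1): for every $K>0$ there is a modulus of continuity $\omega$ (a non-decreasing function $\omega:[0,\infty)\to[0,\infty)$ with $\lim_{r\to0^+}\omega(r)=0$) such that for every ball $B=B_r$ of radius $r$ in $\mathbb{R}$ and all $x,y\in B\cap I$, $$\varphi\big(x,\tfrac{t}{1+\omega(r)}\big)\le\varphi(y,t)+\omega(r)\quad\text{whenever }\varphi(y,t)\in\big[0,\tfrac{K}{|B|}\big].$$ (Dec): there is $q>1$ such that $t\mapsto\varphi(x,t)/t^q$ is non-increasing on $(0,\infty)$ for every $x\in I$. For $A\subset I$ let $\varphi^+_A(t):=\sup_{x\in A}\varphi(x,t)$.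 A partition $(I_k)_{k=1}^n$ of $I$ is a finite family of non-degenerate closed intervals with disjoint interiors and union $I$; $|(I_k)|:=\max_k|I_k|$. For $I_k=[a_k,b_k]$, $\Delta_kf:=f(a_k)-f(b_k)$. Define $$\overline{\mathrm V}^\varphi_I(f):=\limsup_{|(I_k)|\to0}\sum_{k=1}^n\varphi^+_{I_k}\Big(\frac{|\Delta_kf|}{|I_k|}\Big)|I_k|,$$ i.e. the limit as $\delta\to0^+$ of the supremum of the sums over all partitions with $|(I_k)|<\delta$. For a left-continuous function $f:[a,b]\to\mathbb{R}$ of bounded variation, $Df$ denotes the finite signed Borel measure on $I$ with $f(x)=f(a)+Df([a,x))$ for every $x\in I$ and $Df(\{b\})=0$ (so a jump of $f$ immediately to the right of $a$ is an atom of $Df$ at $a$). Its Lebesgue decomposition with respect to Lebesgue measure is $Df=f'\,dx+D^sf$, with $D^sf$ the singular part and $|D^sf|$ its total variation measure. *)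

theory Defs
  imports "HOL-Analysis.Analysis"
begin

section \<open>Generalized Phi-functions\<close>

text \<open>A function on \<open>I \<times> [0,\<infinity>)\<close> is a total function of type \<open>real \<Rightarrow> real \<Rightarrow> ennreal\<close>; its values
  outside \<open>I \<times> [0,\<infinity>)\<close> are never constrained and never used.  Measurability is
  Lebesgue measurability on \<open>I\<close>.\<close>

definition Phi_c :: "real set \<Rightarrow> (real \<Rightarrow> real \<Rightarrow> ennreal) set" where
  "Phi_c I = {\<phi>.
     (\<forall>g \<in> borel_measurable (lebesgue_on I).
        (\<lambda>x. \<phi> x \<bar>g x :: real\<bar>) \<in> borel_measurable (lebesgue_on I)) \<and>
     (\<forall>x\<in>I.
        mono_on {0..} (\<phi> x) \<and>
        (\<forall>s\<ge>0. \<forall>t\<ge>0. \<forall>\<theta>\<in>{0..1}.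
           \<phi> x (\<theta> * s + (1 - \<theta>) * t) \<le> ennreal \<theta> * \<phi> x s + ennreal (1 - \<theta>) * \<phi> x t) \<and>
        (\<forall>t>0. (\<phi> x \<longlongrightarrow> \<phi> x t) (at_left t)) \<and>
        \<phi> x 0 = 0 \<and> (\<phi> x \<longlongrightarrow> 0) (at_right 0) \<and>
        (\<phi> x \<longlongrightarrow> \<infinity>) at_top)}"

definition modulus_of_continuity :: "(real \<Rightarrow> real) \<Rightarrow> bool" where
  "modulus_of_continuity \<omega> \<longleftrightarrow>
     (\<forall>r\<ge>0. 0 \<le> \<omega> r) \<and> mono_on {0..} \<omega> \<and> (\<omega> \<longlongrightarrow> 0) (at_right 0)"

definition VA1 :: "real set \<Rightarrow> (real \<Rightarrow> real \<Rightarrow> ennreal) \<Rightarrow> bool" where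
  "VA1 I \<phi> \<longleftrightarrow>
     (\<forall>K>0. \<exists>\<omega>. modulus_of_continuity \<omega> \<and>
        (\<forall>c. \<forall>r>0. \<forall>x \<in> ball c r \<inter> I. \<forall>y \<in> ball c r \<inter> I. \<forall>t\<ge>0.
           \<phi> y t \<le> ennreal (K / measure lborel (ball c r)) \<longrightarrow>
           \<phi> x (t / (1 + \<omega> r)) \<le> \<phi> y t + ennreal (\<omega> r)))"

definition Dec :: "real set \<Rightarrow> (real \<Rightarrow> real \<Rightarrow> ennreal) \<Rightarrow> bool" where
  "Dec I \<phi> \<longleftrightarrow>
     (\<exists>q>1. \<forall>x\<in>I. antimono_on {0<..} (\<lambda>t. \<phi> x t / ennreal (t powr q)))"

definition recession :: "(real \<Rightarrow> real \<Rightarrow> ennreal) \<Rightarrow> real \<Rightarrow> ennreal" where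
  "recession \<phi> x = Lim at_top (\<lambda>t. \<phi> x t / ennreal t)"

section \<open>Partitions and variation\<close>

text \<open>Nondegenerate closed intervals with disjoint interiors are pairwise distinct, so a finite
  family of them is the same thing as a finite set.\<close>

definition partitions :: "real set \<Rightarrow> real set set set" where
  "partitions I = {P. P division_of I \<and> (\<forall>J\<in>P. interior J \<noteq> {})}"

definition mesh :: "real set set \<Rightarrow> real" where
  "mesh P = Max (measure lborel ` P)"

definition incr :: "(real \<Rightarrow> real) \<Rightarrow> real set \<Rightarrow> real" where
  "incr f J = f (Inf J) - f (Sup J)"

definition BV :: "real set \<Rightarrow> (real \<Rightarrow> real) set" where
  "BV I = {f. \<exists>M. \<forall>P \<in> partitions I. (\<Sum>J\<in>P. \<bar>incr f J\<bar>) \<le> M}"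

definition phi_sup :: "(real \<Rightarrow> real \<Rightarrow> ennreal) \<Rightarrow> real set \<Rightarrow> real \<Rightarrow> ennreal" where
  "phi_sup \<phi> A t = (SUP x\<in>A. \<phi> x t)"

definition phi_variation_sum ::
    "(real \<Rightarrow> real \<Rightarrow> ennreal) \<Rightarrow> (real \<Rightarrow> real) \<Rightarrow> real set set \<Rightarrow> ennreal" where
  "phi_variation_sum \<phi> f P =
     (\<Sum>J\<in>P. phi_sup \<phi> J (\<bar>incr f J\<bar> / measure lborel J) * ennreal (measure lborel J))"

definition upper_phi_variation ::
    "(real \<Rightarrow> real \<Rightarrow> ennreal) \<Rightarrow> real set \<Rightarrow> (real \<Rightarrow> real) \<Rightarrow> ennreal" where
  "upper_phi_variation \<phi> I f =
     Lim (at_right 0) (\<lambda>\<delta>. SUP P \<in> {P \<in> partitions I. mesh P < \<delta>}. phi_variation_sum \<phi> f P)"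

text \<open>The limit always exists, by monotonicity in \<open>\<delta>\<close>.\<close>

lemma upper_phi_variation_tendsto:
  "((\<lambda>\<delta>. SUP P \<in> {P \<in> partitions I. mesh P < \<delta>}. phi_variation_sum \<phi> f P)
     \<longlongrightarrow> upper_phi_variation \<phi> I f) (at_right 0)" (is "(?S \<longlongrightarrow> _) _")
proof -
  have mono: "?S d \<le> ?S e" if "d \<le> e" for d e
    using that by (intro SUP_subset_mono) auto
  have "(?S \<longlongrightarrow> (INF d\<in>{0<..}. ?S d)) (at_right 0)"
  proof (rule order_tendstoI)
    fix u assume u: "u < (INF d\<in>{0<..}. ?S d)"
    have "u < ?S d" if "0 < d" for d
      by (rule less_le_trans[OF u INF_lower]) (use that in simp)
    then show "\<forall>\<^sub>F d in at_right 0. u < ?S d"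
      by (intro eventually_at_rightI[of 0 1]) simp_all
  next
    fix u assume "(INF d\<in>{0<..}. ?S d) < u"
    then obtain d where d: "0 < d" "?S d < u"
      unfolding INF_less_iff by blast
    have "?S e < u" if "e < d" for e
      by (rule le_less_trans[OF mono d(2)]) (use that in simp)
    then show "\<forall>\<^sub>F e in at_right 0. ?S e < u"
      using d(1) by (intro eventually_at_rightI[of 0 d]) simp_all
  qed
  from tendsto_Lim[OF trivial_limit_at_right_real this] this show ?thesis
    by (simp only: upper_phi_variation_def)
qed

section \<open>Signed measures and the derivative measure\<close>

text \<open>A finite signed measure is a real set function on \<open>sets M\<close>; its values on
  other sets are irrelevant.\<close>

definition signed_measure :: "'a measure \<Rightarrow> ('a set \<Rightarrow> real) \<Rightarrow> bool" where
  "signed_measure M \<nu> \<longleftrightarrow>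
     \<nu> {} = 0 \<and>
     (\<forall>A :: nat \<Rightarrow> 'a set. range A \<subseteq> sets M \<longrightarrow> disjoint_family A \<longrightarrow>
        (\<lambda>i. \<nu> (A i)) sums \<nu> (\<Union>i. A i))"

definition total_variation_measure :: "'a measure \<Rightarrow> ('a set \<Rightarrow> real) \<Rightarrow> 'a measure" where
  "total_variation_measure M \<nu> =
     measure_of (space M) (sets M)
       (\<lambda>A. SUP P \<in> {P. finite P \<and> P \<subseteq> sets M \<and> disjoint P \<and> \<Union>P = A}.
              (\<Sum>B\<in>P. ennreal \<bar>\<nu> B\<bar>))"

definition derivative_measure :: "real \<Rightarrow> real \<Rightarrow> (real \<Rightarrow> real) \<Rightarrow> real set \<Rightarrow> real" where
  "derivative_measure a b f =
     (SOME \<nu>. signed_measure (restrict_space borel {a..b}) \<nu> \<and>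
              (\<forall>x\<in>{a..b}. f x = f a + \<nu> {a..<x}) \<and> \<nu> {b} = 0)"

text \<open>\<open>\<nu> = g dx + \<sigma>\<close> on the Borel subsets of \<open>I\<close>, with \<open>\<sigma>\<close> concentrated on a Lebesgue null set.
  The pair is unique, \<open>\<sigma>\<close> on Borel sets and \<open>g\<close> almost everywhere.\<close>

definition lebesgue_decomposition ::
    "real set \<Rightarrow> (real set \<Rightarrow> real) \<Rightarrow> (real \<Rightarrow> real) \<Rightarrow> (real set \<Rightarrow> real) \<Rightarrow> bool" where
  "lebesgue_decomposition I \<nu> g \<sigma> \<longleftrightarrow>
     integrable (lebesgue_on I) g \<and>
     signed_measure (restrict_space borel I) \<sigma> \<and>
     (\<exists>N \<in> sets (restrict_space borel I). emeasure lborel N = 0 \<and>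
        (\<forall>A \<in> sets (restrict_space borel I). A \<inter> N = {} \<longrightarrow> \<sigma> A = 0)) \<and>
     (\<forall>A \<in> sets (restrict_space borel I).
        \<nu> A = (LINT x:A|lebesgue_on I. g x) + \<sigma> A)"

definition ac_density :: "real \<Rightarrow> real \<Rightarrow> (real \<Rightarrow> real) \<Rightarrow> real \<Rightarrow> real" where
  "ac_density a b f =
     (SOME g. \<exists>\<sigma>. lebesgue_decomposition {a..b} (derivative_measure a b f) g \<sigma>)"

definition singular_part :: "real \<Rightarrow> real \<Rightarrow> (real \<Rightarrow> real) \<Rightarrow> real set \<Rightarrow> real" where
  "singular_part a b f =
     (SOME \<sigma>. \<exists>g. lebesgue_decomposition {a..b} (derivative_measure a b f) g \<sigma>)"

definition abs_singular_part :: "real \<Rightarrow> real \<Rightarrow> (real \<Rightarrow> real) \<Rightarrow> real measure" where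
  "abs_singular_part a b f =
     total_variation_measure (restrict_space borel {a..b}) (singular_part a b f)"

end

theory Submission
  imports Defs
begin

text \<open>Take a finite measure \<open>M\<close> on \<open>[a,b)\<close> that dominates both \<open>Df\<close> and Lebesgue measure, with
  densities \<open>u\<close> and \<open>v\<close>.  Both sides equal \<open>\<integral> \<Psi> dM\<close>, where \<open>\<Psi>(x) = v \<phi>(x, |u|/v)\<close> is the perspective
  of \<open>\<phi>(x, \<cdot>)\<close>, read as \<open>|u| \<phi>'\<^sub>\<infinity>(x)\<close> where \<open>v = 0\<close>.

  Lower bound: on uniform partitions the cell averages of \<open>u\<close> and \<open>v\<close> converge to \<open>u\<close> and \<open>v\<close> in \<open>L\<^sup>1(M)\<close>,
  hence almost everywhere along a subsequence, and Fatou's lemma applies because \<open>\<Psi>\<close> is lower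
  semicontinuous in \<open>(u, v)\<close>.

  Upper bound: on a cell \<open>J\<close> with slope \<open>s = |\<Delta>f|/|J|\<close>, apply Jensen's inequality to a supporting line of the
  convex function \<open>\<phi>(x, \<cdot>)\<close> at \<open>s\<close>, for fixed \<open>x\<close>.  Condition (VA1) compares \<open>\<phi>(x, t)\<close> with \<open>\<phi>(y, t)\<close> for
  \<open>t \<le> T = max 1 (s/\<epsilon>)\<close>, which (Dec) brings into its range; beyond \<open>T\<close> the line is dominated, up to a factor
  \<open>1 - \<epsilon>\<close>, by \<open>t \<phi>(x, T)/T\<close>, and \<open>\<phi>(y, t)/t\<close> is nondecreasing in \<open>t\<close>.\<close>

section \<open>Consequences of convexity, (VA1) and (Dec)\<close>

text \<open>The obstacle is that (VA1) controls \<phi> only where its value is at most K/|B|, while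
  |u|/v is unbounded on a cell and infinite on the singular part. Hence \<phi>(x, s) is never
  compared with \<phi>(y, |u|/v) itself: a line is, and both its values on [0, T] and its slope are
  controlled by what happens up to the finite T. The range of (VA1) is reached in three moves. As
  the integral of \<Psi> is finite, some point of the cell satisfies \<phi>(y, s) \<le> C/|J|; (VA1)
  with error 1 carries this to every point of the cell at s/2; (Dec) climbs from s/2 to
  s/\<epsilon>. Since (VA1) divides the argument by 1 + \<epsilon>, the line actually touches at
  s/(1 + \<epsilon>), and (Dec) leads back to s at the price of a factor (1 + \<epsilon>)^q. A
  dominating measure M puts density, Cantor part and atoms on one footing: the slope on a cell is a
  ratio of two M-integrals. But M charges Lebesgue null sets, so Borel measurability of \<phi> is
  required; it comes from (VA1), which makes \<phi> lower semicontinuous in x.\<close>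

locale dec_phi =
  fixes I :: "real set" and \<phi> :: "real \<Rightarrow> real \<Rightarrow> ennreal" and q :: real
  assumes Phi: "\<phi> \<in> Phi_c I"
    and VA1: "VA1 I \<phi>"
    and q_gt_1: "1 < q"
    and antimono: "\<And>x. x \<in> I \<Longrightarrow> antimono_on {0<..} (\<lambda>t. \<phi> x t / ennreal (t powr q))"
begin

lemma phi_0: "x \<in> I \<Longrightarrow> \<phi> x 0 = 0"
  using Phi by (simp add: Phi_c_def)

lemma phi_mono:
  assumes "x \<in> I" "0 \<le> s" "s \<le> t"
  shows "\<phi> x s \<le> \<phi> x t"
proof -
  have "mono_on {0..} (\<phi> x)" using Phi assms(1) by (simp add: Phi_c_def)
  then show ?thesis using assms by (auto simp: mono_on_def)
qed

lemma phi_convex: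
  assumes "x \<in> I" "0 \<le> s" "0 \<le> t" "0 \<le> \<theta>" "\<theta> \<le> 1"
  shows "\<phi> x (\<theta> * s + (1 - \<theta>) * t) \<le> ennreal \<theta> * \<phi> x s + ennreal (1 - \<theta>) * \<phi> x t"
  using Phi assms by (simp add: Phi_c_def)

lemma phi_left_cont: "x \<in> I \<Longrightarrow> 0 < t \<Longrightarrow> (\<phi> x \<longlongrightarrow> \<phi> x t) (at_left t)"
  using Phi by (simp add: Phi_c_def)

lemma phi_dec_ennreal:
  assumes "x \<in> I" "0 < s" "s \<le> t"
  shows "\<phi> x t \<le> ennreal ((t / s) powr q) * \<phi> x s"
proof -
  have "\<phi> x t / ennreal (t powr q) \<le> \<phi> x s / ennreal (s powr q)"
    using monotone_onD[OF antimono[OF assms(1)], of s t] assms by simp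
  then have "ennreal (t powr q) * (\<phi> x t / ennreal (t powr q))
      \<le> ennreal (t powr q) * (\<phi> x s / ennreal (s powr q))"
    by (rule mult_left_mono) simp
  also have "ennreal (t powr q) * (\<phi> x t / ennreal (t powr q)) = \<phi> x t"
    using assms
    by (simp add: ennreal_times_divide mult.commute[of "ennreal _"] mult_divide_eq_ennreal)
  also have "ennreal (t powr q) * (\<phi> x s / ennreal (s powr q)) = ennreal ((t / s) powr q) * \<phi> x s"
    using assms
    by (simp add: powr_divide divide_ennreal[symmetric] ennreal_times_divide divide_ennreal_def ac_simps)
  finally show ?thesis .
qed

text \<open>\<open>\<phi> x\<close> tends to 0 at 0, so it is finite at some small s > 0; on the way
  from s to t, (Dec) costs only a finite factor.\<close>

lemma phi_finite:
  assumes "x \<in> I" "0 \<le> t"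
  shows "\<phi> x t < top"
proof (cases "t = 0")
  case False
  have "(\<phi> x \<longlongrightarrow> 0) (at_right 0)" using Phi assms(1) by (simp add: Phi_c_def)
  then have "\<forall>\<^sub>F s in at_right 0. \<phi> x s < 1" by (rule order_tendstoD) simp
  then obtain d where d: "0 < d" "\<And>s. 0 < s \<Longrightarrow> s < d \<Longrightarrow> \<phi> x s < 1"
    by (auto simp: eventually_at_right_field)
  define s where "s = min (d / 2) t"
  have s: "0 < s" "s \<le> t" "\<phi> x s < 1" using d False assms by (auto simp: s_def)
  have "\<phi> x t \<le> ennreal ((t / s) powr q) * \<phi> x s" using phi_dec_ennreal s assms by simp
  also have "\<dots> < top" using s(3) by (simp add: ennreal_mult_less_top less_trans)
  finally show ?thesis .
qed (simp add: phi_0 assms)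

text \<open>Finiteness allows a real-valued version, for which supporting lines, differences and
  signed integrals make sense.\<close>

definition F :: "real \<Rightarrow> real \<Rightarrow> real" where "F x t = enn2real (\<phi> x t)"

lemma phi_F: "x \<in> I \<Longrightarrow> 0 \<le> t \<Longrightarrow> \<phi> x t = ennreal (F x t)"
  by (simp add: F_def phi_finite)

lemma F_nonneg [simp]: "0 \<le> F x t"
  by (simp add: F_def)

lemma F_0: "x \<in> I \<Longrightarrow> F x 0 = 0"
  by (simp add: F_def phi_0)

lemma F_mono: "x \<in> I \<Longrightarrow> 0 \<le> s \<Longrightarrow> s \<le> t \<Longrightarrow> F x s \<le> F x t"
  using phi_mono[of x s t] by (simp add: phi_F)

lemma F_convex: "x \<in> I \<Longrightarrow> convex_on {0..} (F x)"
proof (rule convex_onI)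
  fix t s u :: real
  assume "x \<in> I" "0 < t" "t < 1" "s \<in> {0..}" "u \<in> {0..}"
  then show "F x ((1 - t) *\<^sub>R s + t *\<^sub>R u) \<le> (1 - t) * F x s + t * F x u"
    using phi_convex[of x s u "1 - t"]
    by (simp add: phi_F flip: ennreal_mult ennreal_plus)
qed simp

lemma F_dec:
  assumes "x \<in> I" "0 < s" "s \<le> t"
  shows "F x t \<le> (t / s) powr q * F x s"
  using phi_dec_ennreal[OF assms] assms by (simp add: phi_F flip: ennreal_mult)

text \<open>Chords from the origin steepen, by convexity and \<open>F x 0 = 0\<close>. This is the
  lower counterpart of \<open>F_dec\<close>, and it persists in the limit defining the recession
  function.\<close>

lemma F_star:
  assumes "x \<in> I" "0 < s" "s \<le> t"
  shows "F x s / s \<le> F x t / t"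
proof -
  have "F x ((1 - s / t) *\<^sub>R 0 + (s / t) *\<^sub>R t) \<le> (1 - s / t) * F x 0 + (s / t) * F x t"
    using assms by (intro convex_onD[OF F_convex]) auto
  then show ?thesis using assms by (simp add: F_0 field_simps)
qed

lemma F_continuous:
  assumes "x \<in> I" "0 < t"
  shows "isCont (F x) t"
proof -
  have "continuous_on {0<..} (F x)"
    by (rule convex_on_continuous) (auto intro!: convex_on_subset[OF F_convex] assms)
  then show ?thesis using assms by (simp add: continuous_on_eq_continuous_at)
qed

text \<open>Testing the line at s/2 against monotonicity gives m \<ge> 0; testing it at 0 gives the
  nonpositive intercept. Both signs matter later: the intercept is dropped for large t, and m
  multiplies an inequality.\<close>

lemma F_supporting_line:
  assumes "x \<in> I" "0 < s"
  obtains m where "0 \<le> m" "F x s - m * s \<le> 0"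
    "\<And>t. 0 \<le> t \<Longrightarrow> F x s + m * (t - s) \<le> F x t"
proof -
  have "s \<in> interior {0..}" using assms by simp
  then obtain m where m: "\<And>t. 0 \<le> t \<Longrightarrow> F x s + m * (t - s) \<le> F x t"
    using convex_le_Inf_differential[OF F_convex[OF assms(1)], of s] by fastforce
  have "F x s + m * (s / 2 - s) \<le> F x s"
    using m[of "s / 2"] F_mono[of x "s / 2" s] assms by linarith
  then have "0 \<le> m" using assms by (simp add: field_simps zero_le_mult_iff mult_le_0_iff)
  with that m m[of 0] assms show ?thesis by (simp add: F_0)
qed

text \<open>By \<open>F_star\<close> the quotient is nondecreasing, so the limit is a supremum.
  Natural numbers suffice for it, and a countable supremum yields measurability.\<close>

lemma recession_tendsto:
  assumes "x \<in> I"
  shows "((\<lambda>t. \<phi> x t / ennreal t) \<longlongrightarrow> recession \<phi> x) at_top"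
    and "recession \<phi> x = (SUP n\<in>{0<..}. ennreal (F x (real n) / real n))"
    and "0 < t \<Longrightarrow> ennreal (F x t / t) \<le> recession \<phi> x"
proof -
  let ?S = "SUP n\<in>{0<..}. ennreal (F x (real n) / real n)"
  have eq: "\<phi> x t / ennreal t = ennreal (F x t / t)" if "0 < t" for t
    using that assms by (simp add: phi_F divide_ennreal)
  have up: "ennreal (F x t / t) \<le> ?S" if "0 < t" for t
  proof -
    obtain n where "t < real n" using reals_Archimedean2 by blast
    then have "F x t / t \<le> F x (real n) / real n" using F_star[OF assms, of t] that by simp
    then show ?thesis using that \<open>t < real n\<close> by (intro SUP_upper2[of n]) (auto intro: ennreal_leI)
  qed
  have lim: "((\<lambda>t. \<phi> x t / ennreal t) \<longlongrightarrow> ?S) at_top"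
  proof (rule order_tendstoI)
    fix c assume "c < ?S"
    then obtain n where n: "0 < n" "c < ennreal (F x (real n) / real n)"
      by (auto simp: less_SUP_iff)
    have "c < \<phi> x t / ennreal t" if "real n \<le> t" for t
      using n(2) F_star[OF assms, of "real n" t] n(1) that
      by (subst eq) (auto intro: less_le_trans ennreal_leI)
    then show "\<forall>\<^sub>F t in at_top. c < \<phi> x t / ennreal t"
      by (auto simp: eventually_at_top_linorder)
  next
    fix c assume "?S < c"
    then have "\<phi> x t / ennreal t < c" if "1 \<le> t" for t
      using up[of t] that by (subst eq) (auto intro: le_less_trans)
    then show "\<forall>\<^sub>F t in at_top. \<phi> x t / ennreal t < c"
      by (auto simp: eventually_at_top_linorder)
  qed
  show R: "recession \<phi> x = ?S"
    unfolding recession_def by (rule tendsto_Lim[OF _ lim]) simp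
  show "((\<lambda>t. \<phi> x t / ennreal t) \<longlongrightarrow> recession \<phi> x) at_top" using lim R by simp
  show "ennreal (F x t / t) \<le> recession \<phi> x" if "0 < t" using up[OF that] R by simp
qed

text \<open>One fixed error e replaces the modulus, and a pair x, y replaces the ball. The open ball
  of radius r about the midpoint contains both points, since |x - y|/2 < r.\<close>

lemma F_VA1:
  assumes "0 < K" "0 < e"
  obtains d where "0 < d"
    "\<And>x y r t. \<lbrakk>x \<in> I; y \<in> I; 0 < r; r < d; \<bar>x - y\<bar> \<le> r; 0 \<le> t; F y t \<le> K / r\<rbrakk>
      \<Longrightarrow> F x (t / (1 + e)) \<le> F y t + e"
proof -
  \<comment> \<open>The ball has measure 2 r, so the constant 2 K in (VA1) produces the threshold K
    / r.\<close>
  obtain \<omega> where mod: "modulus_of_continuity \<omega>"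
    and \<omega>: "\<And>c r x y t. \<lbrakk>0 < r; x \<in> ball c r \<inter> I; y \<in> ball c r \<inter> I; 0 \<le> t;
      \<phi> y t \<le> ennreal (2 * K / measure lborel (ball c r))\<rbrakk>
      \<Longrightarrow> \<phi> x (t / (1 + \<omega> r)) \<le> \<phi> y t + ennreal (\<omega> r)"
    using VA1 assms(1) unfolding VA1_def by (metis mult_pos_pos zero_less_numeral)
  have "(\<omega> \<longlongrightarrow> 0) (at_right 0)" using mod by (simp add: modulus_of_continuity_def)
  then have "\<forall>\<^sub>F r in at_right 0. \<omega> r < e" by (rule order_tendstoD) (rule assms(2))
  then obtain d where d: "0 < d" "\<And>r. 0 < r \<Longrightarrow> r < d \<Longrightarrow> \<omega> r < e"
    by (auto simp: eventually_at_right_field)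
  show ?thesis
  proof (rule that[OF d(1)])
    fix x y r t
    assume *: "x \<in> I" "y \<in> I" "0 < r" "r < d" "\<bar>x - y\<bar> \<le> r" "0 \<le> t" "F y t \<le> K / r"
    have w: "0 \<le> \<omega> r" "\<omega> r \<le> e"
      using mod d(2)[of r] * by (auto simp: modulus_of_continuity_def)
    have m: "measure lborel (ball ((x + y) / 2) r) = 2 * r"
      using * by (simp add: ball_eq_greaterThanLessThan)
    have "\<phi> x (t / (1 + \<omega> r)) \<le> \<phi> y t + ennreal (\<omega> r)"
    proof (rule \<omega>)
      show "x \<in> ball ((x + y) / 2) r \<inter> I" "y \<in> ball ((x + y) / 2) r \<inter> I"
        using * by (auto simp: dist_real_def)
      show "\<phi> y t \<le> ennreal (2 * K / measure lborel (ball ((x + y) / 2) r))"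
        using * unfolding m by (simp add: phi_F ennreal_leI)
    qed (use * in auto)
    then have "F x (t / (1 + \<omega> r)) \<le> F y t + \<omega> r"
      using * w by (simp add: phi_F flip: ennreal_plus)
    moreover have "F x (t / (1 + e)) \<le> F x (t / (1 + \<omega> r))"
      using * w by (intro F_mono divide_left_mono) auto
    ultimately show "F x (t / (1 + e)) \<le> F y t + e" using w by linarith
  qed
qed

text \<open>Lower semicontinuity in x. Continuity in t leaves room: c + e < F x s for some s < t
  with s \<le> t / (1 + e). If F y t \<le> c held for some y near x, (VA1) would give F x s \<le> c
  + e.\<close>

lemma F_superlevel_open:
  assumes "0 \<le> t"
  shows "openin (top_of_set I) {x\<in>I. c < F x t}"
proof (subst openin_contains_ball, intro conjI ballI)
  fix x assume "x \<in> {x\<in>I. c < F x t}"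
  then have x: "x \<in> I" "c < F x t" by auto
  show "\<exists>e>0. ball x e \<inter> I \<subseteq> {x\<in>I. c < F x t}"
  proof (cases "c < 0")
    case True
    then show ?thesis by (intro exI[of _ 1]) (auto intro: less_le_trans)
  next
    case False
    then have t: "0 < t" using x F_0[of x] assms by (cases "t = 0") auto
    have "\<forall>\<^sub>F s in at t. c < F x s"
      using F_continuous[OF x(1) t] x(2) unfolding isCont_def by (rule order_tendstoD)
    then obtain d where d: "0 < d" "\<And>s. dist s t < d \<Longrightarrow> s \<noteq> t \<Longrightarrow> c < F x s"
      by (auto simp: eventually_at)
    define s where "s = max (t / 2) (t - d / 2)"
    have s: "0 < s" "s < t" "c < F x s"
      using t d(1) d(2)[of s] by (auto simp: s_def dist_real_def max_def)
    define e where "e = min (t / s - 1) ((F x s - c) / 2)"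
    have e: "0 < e" "c + e < F x s" "s \<le> t / (1 + e)"
    proof -
      show e0: "0 < e" using s by (simp add: e_def)
      show "c + e < F x s" using s by (auto simp: e_def min_def field_simps)
      have "1 + e \<le> t / s" by (simp add: e_def)
      then show "s \<le> t / (1 + e)" using e0 s by (simp add: field_simps)
    qed
    have "0 < c + 1" using False by simp
    then obtain d' where d': "0 < d'"
      "\<And>x y r t. \<lbrakk>x \<in> I; y \<in> I; 0 < r; r < d'; \<bar>x - y\<bar> \<le> r; 0 \<le> t; F y t \<le> (c + 1) / r\<rbrakk>
      \<Longrightarrow> F x (t / (1 + e)) \<le> F y t + e"
      using F_VA1[of "c + 1" e] e(1) by metis
    have "c < F y t" if y: "y \<in> ball x (min 1 d' / 2) \<inter> I" for y
    proof (rule ccontr)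
      assume "\<not> c < F y t"
      \<comment> \<open>The radius is below 1, so the value c lies within the range of
        (VA1).\<close>
      moreover have "c \<le> (c + 1) / (min 1 d' / 2)"
      proof -
        have "c * (min 1 d' / 2) \<le> c * 1" using False d'(1) by (intro mult_left_mono) auto
        then show ?thesis using d'(1) by (simp add: field_simps)
      qed
      ultimately have "F x (t / (1 + e)) \<le> F y t + e"
        using y d'(1) t x(1) by (intro d'(2)[of x y "min 1 d' / 2"]) (auto simp: dist_real_def)
      moreover have "F x s \<le> F x (t / (1 + e))"
        using e s x by (intro F_mono) auto
      ultimately show False using e(2) \<open>\<not> c < F y t\<close> by linarith
    qed
    then show ?thesis using d'(1) by (intro exI[of _ "min 1 d' / 2"]) auto
  qed
qed auto

text \<open>(VA1) with error 1 gives F x 1 \<le> F z 2 + 1 for x near z, and a finite subcover makes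
  the bound uniform. It serves the case T = 1 of the cut-off in \<open>cell_bound\<close>.\<close>

lemma F_bounded:
  assumes "compact I"
  obtains M where "0 \<le> M" "\<And>x. x \<in> I \<Longrightarrow> F x 1 \<le> M"
proof -
  have "\<exists>d>0. \<forall>x\<in>I \<inter> ball z d. F x 1 \<le> F z 2 + 1" if z: "z \<in> I" for z
  proof -
    obtain d where d: "0 < d"
      "\<And>x y r t. \<lbrakk>x \<in> I; y \<in> I; 0 < r; r < d; \<bar>x - y\<bar> \<le> r; 0 \<le> t; F y t \<le> (F z 2 + 1) / r\<rbrakk>
      \<Longrightarrow> F x (t / (1 + 1)) \<le> F y t + 1"
      using F_VA1[of "F z 2 + 1" 1] F_nonneg[of z 2] by (metis add_nonneg_pos zero_less_one)
    define r where "r = min d 1 / 2"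
    have r: "0 < r" "r < d" "r \<le> 1" using d(1) by (auto simp: r_def)
    have "F z 2 * r \<le> F z 2 * 1" using r by (intro mult_left_mono) auto
    then have "F z 2 \<le> (F z 2 + 1) / r" using r by (simp add: field_simps)
    then have "F x 1 \<le> F z 2 + 1" if "x \<in> I \<inter> ball z r" for x
      using d(2)[of x z r 2] that r z by (auto simp: dist_real_def)
    then show ?thesis using r by blast
  qed
  then obtain d where d: "\<And>z. z \<in> I \<Longrightarrow> 0 < d z"
    "\<And>z x. z \<in> I \<Longrightarrow> x \<in> I \<inter> ball z (d z) \<Longrightarrow> F x 1 \<le> F z 2 + 1" by metis
  have "I \<subseteq> (\<Union>z\<in>I. ball z (d z))" using d(1) by force
  then obtain C where C: "C \<subseteq> I" "finite C" "I \<subseteq> (\<Union>z\<in>C. ball z (d z))"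
    using compactE_image[OF assms, of I "\<lambda>z. ball z (d z)"] by auto
  show ?thesis
  proof (rule that)
    show "0 \<le> (\<Sum>z\<in>C. F z 2 + 1)" by (intro sum_nonneg) (simp add: add_nonneg_nonneg)
    fix x assume "x \<in> I"
    then obtain z where z: "z \<in> C" "x \<in> ball z (d z)" using C by auto
    have "F x 1 \<le> F z 2 + 1" using d(2)[of z x] z C \<open>x \<in> I\<close> by auto
    also have "\<dots> \<le> (\<Sum>z\<in>C. F z 2 + 1)"
      using z C by (intro member_le_sum) (auto simp: add_nonneg_nonneg)
    finally show "F x 1 \<le> (\<Sum>z\<in>C. F z 2 + 1)" .
  qed
qed

section \<open>Borel measurability of compositions and of the recession function\<close>

lemma phi_borel_const:
  assumes [measurable]: "I \<in> sets borel" and "0 \<le> t"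
  shows "(\<lambda>x. indicator I x * \<phi> x t) \<in> borel_measurable borel"
proof -
  have "(\<lambda>x. F x t) \<in> borel_measurable (restrict_space borel I)"
  proof (rule borel_measurableI_greater)
    fix c
    obtain U where U: "open U" "{x\<in>I. c < F x t} = I \<inter> U"
      using F_superlevel_open[OF assms(2), of c] by (auto simp: openin_open)
    have "{x \<in> space (restrict_space borel I). c < F x t} = I \<inter> U"
      using U by (simp add: space_restrict_space)
    then show "{x \<in> space (restrict_space borel I). c < F x t} \<in> sets (restrict_space borel I)"
      using U(1) by (simp add: sets_restrict_space)
  qed
  then have "(\<lambda>x. indicator I x *\<^sub>R F x t) \<in> borel_measurable borel"
    by (subst (asm) borel_measurable_restrict_space_iff) auto
  then have "(\<lambda>x. ennreal (indicator I x *\<^sub>R F x t)) \<in> borel_measurable borel"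
    by (intro measurable_compose[OF _ measurable_ennreal])
  moreover have "ennreal (indicator I x *\<^sub>R F x t) = indicator I x * \<phi> x t" for x
    using assms by (simp add: phi_F split: split_indicator)
  ultimately show ?thesis by (simp only:)
qed

text \<open>Left continuity and monotonicity reduce t to the rationals below it. The index set does
  not depend on t, so composing with a Borel function gives a countable supremum of functions that
  are measurable for each fixed p.\<close>

lemma phi_SUP_rat:
  assumes "x \<in> I" "0 \<le> t"
  shows "\<phi> x t = (SUP p\<in>{p\<in>\<rat>. 0 \<le> p}. if p < t then \<phi> x p else 0)"
proof (rule antisym)
  show "(SUP p\<in>{p\<in>\<rat>. 0 \<le> p}. if p < t then \<phi> x p else 0) \<le> \<phi> x t"
    using assms by (intro SUP_least) (auto intro: phi_mono)
  show "\<phi> x t \<le> (SUP p\<in>{p\<in>\<rat>. 0 \<le> p}. if p < t then \<phi> x p else 0)"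
  proof (cases "t = 0")
    case False
    then have t: "0 < t" using assms by simp
    show ?thesis
    proof (rule le_SUP_iff[THEN iffD2, rule_format])
      fix y assume "y < \<phi> x t"
      then have "\<forall>\<^sub>F s in at_left t. y < \<phi> x s"
        using phi_left_cont[OF assms(1) t] by (rule order_tendstoD[rotated])
      then obtain s where s: "s < t" "\<And>u. s < u \<Longrightarrow> u < t \<Longrightarrow> y < \<phi> x u"
        by (auto simp: eventually_at_left_field)
      obtain p where p: "p \<in> \<rat>" "max s 0 < p" "p < t"
        using Rats_dense_in_real[of "max s 0" t] s t by auto
      then show "\<exists>p\<in>{p\<in>\<rat>. 0 \<le> p}. y < (if p < t then \<phi> x p else 0)"
        using s by (intro bexI[of _ p]) auto
    qed
  qed (simp add: phi_0 assms)
qed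

text \<open>Membership in \<open>Phi_c\<close> yields Lebesgue measurability only, while the
  singular part of Df lives on a Lebesgue null set; the Borel version rests on
  \<open>F_superlevel_open\<close>.\<close>

lemma phi_borel:
  assumes "I \<in> sets borel" "h \<in> borel_measurable borel" "\<And>x. 0 \<le> h x"
  shows "(\<lambda>x. indicator I x * \<phi> x (h x)) \<in> borel_measurable borel"
proof -
  have "indicator I x * \<phi> x (h x)
      = (SUP p\<in>{p\<in>\<rat>. 0 \<le> p}. if p < h x then indicator I x * \<phi> x p else 0)" for x
  proof (cases "x \<in> I")
    case False
    then have "(SUP p\<in>{p\<in>\<rat>. 0 \<le> p}. if p < h x then indicator I x * \<phi> x p else 0) \<le> 0"
      by (intro SUP_least) auto
    with False show ?thesis by simp
  qed (simp add: phi_SUP_rat[of x "h x"] assms)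
  moreover have "(\<lambda>x. SUP p\<in>{p\<in>\<rat>. 0 \<le> p}. if p < h x then indicator I x * \<phi> x p else 0)
      \<in> borel_measurable borel"
  proof (rule borel_measurable_SUP)
    show "countable {p::real\<in>\<rat>. 0 \<le> p}"
      by (rule countable_subset[OF _ countable_rat]) auto
    fix p :: real assume "p \<in> {p\<in>\<rat>. 0 \<le> p}"
    then show "(\<lambda>x. if p < h x then indicator I x * \<phi> x p else 0) \<in> borel_measurable borel"
      using assms by (intro measurable_If phi_borel_const) auto
  qed
  ultimately show ?thesis by simp
qed

lemma recession_borel:
  assumes "I \<in> sets borel"
  shows "(\<lambda>x. indicator I x * recession \<phi> x) \<in> borel_measurable borel"
proof -
  have "(\<lambda>x. SUP n\<in>{0<..}. indicator I x * \<phi> x (real n) / ennreal (real n)) \<in> borel_measurable borel"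
    by (intro borel_measurable_SUP borel_measurable_divide_ennreal phi_borel_const assms) auto
  moreover have "(SUP n\<in>{0<..}. indicator I x * \<phi> x (real n) / ennreal (real n))
      = indicator I x * recession \<phi> x" for x
    by (cases "x \<in> I")
       (auto simp: recession_tendsto(2) phi_F divide_ennreal SUP_constant intro!: SUP_cong)
  ultimately show ?thesis by simp
qed

end

section \<open>The upper bound on a single cell\<close>

text \<open>Here g may change sign: \<open>ennreal\<close> sends negative values to 0, which can
  only raise the integral. The minorants of \<Psi> used below are of this kind.\<close>

lemma ennreal_integral_le_nn_integral:
  fixes g :: "'a \<Rightarrow> real"
  assumes "integrable M g"
  shows "ennreal (\<integral>x. g x \<partial>M) \<le> (\<integral>\<^sup>+x. ennreal (g x) \<partial>M)"
proof -
  have "(\<integral>x. g x \<partial>M) \<le> enn2real (\<integral>\<^sup>+x. ennreal (g x) \<partial>M)"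
    using real_lebesgue_integral_def[OF assms] by simp
  then have "ennreal (\<integral>x. g x \<partial>M) \<le> ennreal (enn2real (\<integral>\<^sup>+x. ennreal (g x) \<partial>M))"
    by (rule ennreal_leI)
  also have "\<dots> \<le> (\<integral>\<^sup>+x. ennreal (g x) \<partial>M)" by (simp add: ennreal_enn2real_if)
  finally show ?thesis .
qed

context dec_phi
begin

text \<open>The line A + m t supports F x at s / (1 + e), which fits the shrunken argument in H. On
  [0, T] the comparison with F y is H itself. For the slope, s \<le> e T makes the step from s / (1
  + e) to T / (1 + e) at least (1 - e) T / (1 + e), while F x grows over it by at most F y T + e.
  The last conclusion is the limit of large t and serves the points with v = 0.\<close>

lemma convex_comparison:
  assumes x: "x \<in> I" and e: "0 < e" "e < 1" and s: "0 < s"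
    and T: "s / e \<le> T" "1 \<le> T"
    and H: "\<And>y t. y \<in> J \<Longrightarrow> 0 \<le> t \<Longrightarrow> t \<le> T \<Longrightarrow> F x (t / (1 + e)) \<le> F y t + e"
    and J: "J \<subseteq> I"
  obtains A m where "0 \<le> m" "F x (s / (1 + e)) = A + m * (s / (1 + e))"
    "\<And>y t. y \<in> J \<Longrightarrow> 0 \<le> t \<Longrightarrow> (1 - e) * (A + m * (t / (1 + e))) \<le> F y t + e + e * t"
    "\<And>y. y \<in> J \<Longrightarrow> (1 - e) * (m / (1 + e)) \<le> F y T / T + e"
proof -
  define s0 T0 where "s0 = s / (1 + e)" and "T0 = T / (1 + e)"
  have pos: "0 < s0" "0 < T0" "s0 \<le> e * T0" "T0 * (1 + e) = T" "0 < T"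
    using e s T divide_right_mono[of s "e * T" "1 + e"]
    by (auto simp: s0_def T0_def pos_divide_le_eq mult.commute)
  obtain m where m: "0 \<le> m" "F x s0 - m * s0 \<le> 0"
    "\<And>t. 0 \<le> t \<Longrightarrow> F x s0 + m * (t - s0) \<le> F x t"
    using F_supporting_line[OF x pos(1)] by blast
  define A where "A = F x s0 - m * s0"
  have line: "A + m * t \<le> F x t" if "0 \<le> t" for t
    using m(3)[OF that] by (simp add: A_def algebra_simps)
  have slope: "(1 - e) * (m / (1 + e)) \<le> (F y T + e) / T" if "y \<in> J" for y
  proof -
    have "m * (T0 - s0) \<le> F x T0"
      using m(3)[of T0] pos F_nonneg[of x s0] by linarith
    also have "F x T0 \<le> F y T + e"
      using H[OF that, of T] pos T by (simp add: T0_def)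
    finally have "m * (T0 - s0) \<le> F y T + e" .
    moreover have "m * ((1 - e) * T0) \<le> m * (T0 - s0)"
      using m(1) pos(3) by (intro mult_left_mono) (simp_all add: algebra_simps)
    ultimately have "m * ((1 - e) * T0) \<le> F y T + e" by linarith
    moreover have "m * ((1 - e) * T0) = (1 - e) * (m / (1 + e)) * T"
      using e by (simp add: T0_def)
    ultimately show ?thesis using pos by (simp add: pos_le_divide_eq)
  qed
  show ?thesis
  proof (rule that[OF m(1), of A])
    show "F x (s / (1 + e)) = A + m * (s / (1 + e))"
      by (simp add: A_def s0_def)
    fix y assume y: "y \<in> J"
    \<comment> \<open>This is the purpose of T \<ge> 1: the additive error of H stays below e after
      division by T.\<close>
    have "e / T \<le> e" using T(2) e(1) by (simp add: field_simps)
    then show "(1 - e) * (m / (1 + e)) \<le> F y T / T + e"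
      using slope[OF y] by (simp add: add_divide_distrib)
    fix t :: real assume t: "0 \<le> t"
    show "(1 - e) * (A + m * (t / (1 + e))) \<le> F y t + e + e * t"
    proof (cases "t \<le> T")
      case True
      let ?L = "A + m * (t / (1 + e))"
      have "?L \<le> F y t + e"
        using line[of "t / (1 + e)"] H[OF y t True] t e by (simp add: order_trans[where y = "F x (t / (1 + e))"])
      then have "(1 - e) * ?L \<le> (1 - e) * (F y t + e)"
        using e by (intro mult_left_mono) auto
      also have "\<dots> \<le> 1 * (F y t + e)"
        using e by (intro mult_right_mono) (auto simp: add_nonneg_nonneg)
      finally have "(1 - e) * ?L \<le> F y t + e" by simp
      then show ?thesis by (rule order_trans) (use e t in simp)
    next
      case False
      \<comment> \<open>The intercept A is nonpositive; dropping it leaves a multiple of t, to be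
        compared with t F y T / T by the slope bound.\<close>
      have "(1 - e) * (A + m * (t / (1 + e))) \<le> (1 - e) * (m * (t / (1 + e)))"
        using e m(2) by (intro mult_left_mono) (auto simp: A_def)
      also have "\<dots> = t * ((1 - e) * (m / (1 + e)))"
        by (simp add: mult.commute mult.left_commute)
      also have "\<dots> \<le> t * ((F y T + e) / T)"
        using slope[OF y] t by (intro mult_left_mono) auto
      also have "\<dots> = t * (F y T / T) + t * (e / T)"
        by (simp add: add_divide_distrib distrib_left)
      finally have 1: "(1 - e) * (A + m * (t / (1 + e))) \<le> t * (F y T / T) + t * (e / T)" .
      have "F y T / T \<le> F y t / t"
        using F_star[of y T t] False y J pos by auto
      then have "t * (F y T / T) \<le> t * (F y t / t)" using t by (rule mult_left_mono)
      also have "t * (F y t / t) = F y t" using False pos by simp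
      finally have 2: "t * (F y T / T) \<le> F y t" .
      have 3: "t * (e / T) \<le> e * t"
        using mult_left_mono[OF \<open>e / T \<le> e\<close> t] by (simp add: mult.commute)
      show ?thesis
        by (rule order_trans[OF 1]) (use 2 3 e in linarith)
    qed
  qed
qed

end

text \<open>\<open>u\<close> and \<open>v\<close> are the densities of \<open>Df\<close> and of Lebesgue measure with respect to a common finite
  measure \<open>M\<close>; the singular part of \<open>Df\<close> lives on \<open>{v = 0}\<close>.\<close>

locale derivative_densities =
  fixes a b :: real and f :: "real \<Rightarrow> real" and M :: "real measure" and u v :: "real \<Rightarrow> real"
  assumes a_less_b: "a < b"
    and finite_M: "finite_measure M"
    and sets_M [measurable_cong, simp]: "sets M = sets borel"
    and M_null: "AE x in M. x \<in> {a..<b}"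
    and u_int [simp]: "integrable M u"
    and v_int [simp]: "integrable M v"
    and v_nonneg [simp]: "\<And>x. 0 \<le> v x"
    and density_v: "density M (\<lambda>x. ennreal (v x)) = density lborel (indicator {a..<b})"
    and increment: "\<And>c d. a \<le> c \<Longrightarrow> c \<le> d \<Longrightarrow> d \<le> b \<Longrightarrow> f d - f c = (LINT x:{c..<d}|M. u x)"
begin

lemma space_M [simp]: "space M = UNIV"
  using sets_eq_imp_space_eq[OF sets_M] by simp

lemma uv_borel [measurable]: "u \<in> borel_measurable borel" "v \<in> borel_measurable borel"
  using borel_measurable_integrable[OF u_int] borel_measurable_integrable[OF v_int]
  by (simp_all cong: measurable_cong_sets)

lemma set_integrable_M [simp]:
  fixes w :: "real \<Rightarrow> real"
  assumes "integrable M w" "A \<in> sets borel"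
  shows "set_integrable M A w"
  using assms unfolding set_integrable_def by (intro integrable_mult_indicator) auto

lemma length_eq:
  assumes "a \<le> c" "c \<le> d" "d \<le> b"
  shows "(LINT x:{c..<d}|M. v x) = d - c"
proof -
  have "ennreal (LINT x:{c..<d}|M. v x) = (\<integral>\<^sup>+x. ennreal (indicator {c..<d} x *\<^sub>R v x) \<partial>M)"
    unfolding set_lebesgue_integral_def
    by (intro nn_integral_eq_integral[symmetric] set_integrable_M[unfolded set_integrable_def]) auto
  also have "\<dots> = emeasure (density M (\<lambda>x. ennreal (v x))) {c..<d}"
    by (subst emeasure_density) (auto intro!: nn_integral_cong split: split_indicator)
  also have "\<dots> = (\<integral>\<^sup>+x. indicator {a..<b} x * indicator {c..<d} x \<partial>lborel)"
    unfolding density_v by (subst emeasure_density) auto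
  also have "\<dots> = (\<integral>\<^sup>+x. indicator {c..<d} x \<partial>lborel)"
    using assms by (intro nn_integral_cong) (auto split: split_indicator)
  also have "\<dots> = ennreal (d - c)" using assms by simp
  finally show ?thesis using assms
    by (subst (asm) ennreal_inj) (auto simp: set_lebesgue_integral_def intro!: integral_nonneg)
qed

end

section \<open>The perspective integrand and its estimates on one cell\<close>

locale phi_densities = dec_phi "{a..b}" \<phi> q + derivative_densities a b f M u v
  for a b :: real and \<phi> :: "real \<Rightarrow> real \<Rightarrow> ennreal" and q :: real
    and f :: "real \<Rightarrow> real" and M :: "real measure" and u v :: "real \<Rightarrow> real"
begin

definition \<Psi> :: "real \<Rightarrow> ennreal" where
  "\<Psi> x = (if 0 < v x then ennreal (v x) * \<phi> x (\<bar>u x\<bar> / v x) else ennreal \<bar>u x\<bar> * recession \<phi> x)"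

lemma \<Psi>_borel: "(\<lambda>x. indicator {a..b} x * \<Psi> x) \<in> borel_measurable borel"
proof -
  have [measurable]: "(\<lambda>x. indicator {a..b} x * \<phi> x (\<bar>u x\<bar> / v x)) \<in> borel_measurable borel"
    by (rule phi_borel) auto
  have [measurable]: "(\<lambda>x. indicator {a..b} x * recession \<phi> x) \<in> borel_measurable borel"
    by (rule recession_borel) auto
  have "(\<lambda>x. if 0 < v x then ennreal (v x) * (indicator {a..b} x * \<phi> x (\<bar>u x\<bar> / v x))
      else ennreal \<bar>u x\<bar> * (indicator {a..b} x * recession \<phi> x)) \<in> borel_measurable borel" (is "?g \<in> _")
    by measurable
  moreover have "?g = (\<lambda>x. indicator {a..b} x * \<Psi> x)"
    by (auto simp: \<Psi>_def fun_eq_iff split: split_indicator)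
  ultimately show ?thesis by simp
qed

lemma \<Psi>_cell_borel [measurable]:
  assumes "a \<le> c" "d \<le> b"
  shows "(\<lambda>x. \<Psi> x * indicator {c..<d} x) \<in> borel_measurable borel"
proof -
  have "(\<lambda>x. indicator {a..b} x * \<Psi> x * indicator {c..<d} x) \<in> borel_measurable borel" (is "?g \<in> _")
    using \<Psi>_borel by measurable
  moreover have "?g = (\<lambda>x. \<Psi> x * indicator {c..<d} x)"
    using assms by (auto simp: fun_eq_iff split: split_indicator)
  ultimately show ?thesis by simp
qed

definition total :: ennreal where "total = (\<integral>\<^sup>+x. \<Psi> x * indicator {a..<b} x \<partial>M)"

text \<open>The line (k/s)(t - s) lies below F y: it is negative for t < s, and for t \<ge> s it is
  at most t F y s / s, hence at most F y t by \<open>F_star\<close>. The left-hand side is its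
  perspective; where v y = 0, the slope k/s is below the recession value.\<close>

lemma \<Psi>_ge:
  assumes y: "y \<in> {a..b}" and "0 < s" "0 \<le> k" "k \<le> F y s"
  shows "ennreal (k / s * (\<bar>u y\<bar> - s * v y)) \<le> \<Psi> y"
proof (cases "0 < v y")
  case True
  have "k / s * (\<bar>u y\<bar> - s * v y) \<le> v y * F y (\<bar>u y\<bar> / v y)"
  proof (cases "s \<le> \<bar>u y\<bar> / v y")
    case le: True
    then have "k / s \<le> F y (\<bar>u y\<bar> / v y) / (\<bar>u y\<bar> / v y)"
      using F_star[OF y, of s "\<bar>u y\<bar> / v y"] assms divide_right_mono[of k "F y s" s] by linarith
    then have "k / s * \<bar>u y\<bar> \<le> F y (\<bar>u y\<bar> / v y) / (\<bar>u y\<bar> / v y) * \<bar>u y\<bar>"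
      by (rule mult_right_mono) simp
    also have "\<dots> = v y * F y (\<bar>u y\<bar> / v y)"
      using le assms True by (cases "u y = 0") auto
    finally have "k / s * \<bar>u y\<bar> \<le> v y * F y (\<bar>u y\<bar> / v y)" .
    moreover have "k / s * (\<bar>u y\<bar> - s * v y) \<le> k / s * \<bar>u y\<bar>"
      using assms by (intro mult_left_mono) auto
    ultimately show ?thesis by linarith
  next
    case False
    then have "k / s * (\<bar>u y\<bar> - s * v y) \<le> 0"
      using True assms by (intro mult_nonneg_nonpos) (auto simp: field_simps)
    also have "0 \<le> v y * F y (\<bar>u y\<bar> / v y)" by simp
    finally show ?thesis .
  qed
  then have "ennreal (k / s * (\<bar>u y\<bar> - s * v y)) \<le> ennreal (v y * F y (\<bar>u y\<bar> / v y))"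
    by (rule ennreal_leI)
  then show ?thesis using True y by (simp add: \<Psi>_def phi_F ennreal_mult)
next
  case False
  then have [simp]: "v y = 0" using v_nonneg[of y] by linarith
  have "k / s * \<bar>u y\<bar> \<le> \<bar>u y\<bar> * (F y s / s)"
    using assms by (subst mult.commute) (intro mult_left_mono divide_right_mono, auto)
  then have "ennreal (k / s * \<bar>u y\<bar>) \<le> ennreal (\<bar>u y\<bar> * (F y s / s))" by (rule ennreal_leI)
  also have "\<dots> = ennreal \<bar>u y\<bar> * ennreal (F y s / s)" using assms by (intro ennreal_mult) auto
  also have "\<dots> \<le> ennreal \<bar>u y\<bar> * recession \<phi> y"
    using recession_tendsto(3)[OF y] assms by (intro mult_left_mono) auto
  finally show ?thesis by (simp add: \<Psi>_def)
qed

lemma increment_abs_le: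
  assumes "a \<le> c" "c \<le> d" "d \<le> b"
  shows "\<bar>f c - f d\<bar> \<le> (LINT x:{c..<d}|M. \<bar>u x\<bar>)"
proof -
  have "\<bar>f c - f d\<bar> = \<bar>LINT x:{c..<d}|M. u x\<bar>"
    using increment[OF assms] by linarith
  also have "\<dots> \<le> (LINT x:{c..<d}|M. \<bar>u x\<bar>)"
    using set_integral_norm_bound[of M "{c..<d}" u] by simp
  finally show ?thesis .
qed

text \<open>Otherwise F y s is large on the whole cell, and by (Dec) so is F y (s/2). Integrating
  \<open>\<Psi>_ge\<close> at level s/2 then gives total \<ge> C / 2^q > R. Level s would not do:
  the integral of |u| - s v over the cell is only known to be nonnegative, whereas at level s/2 it
  is at least (s/2)(d - c).\<close>

lemma cell_point_bound:
  assumes cd: "a \<le> c" "c < d" "d \<le> b" and s: "s = \<bar>f c - f d\<bar> / (d - c)" "0 < s"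
    and R: "total = ennreal R" "0 \<le> R" and C: "2 powr q * R < C"
  shows "\<exists>y\<in>{c..d}. F y s \<le> C / (d - c)"
proof (rule ccontr)
  assume "\<not> ?thesis"
  then have big: "C / (d - c) < F y s" if "y \<in> {c..d}" for y
    using that by (auto simp: not_le)
  define k where "k = C / (d - c) / 2 powr q"
  have C0: "0 < C" using C R by (smt (verit) mult_nonneg_nonneg powr_ge_zero)
  then have k0: "0 < k" using cd by (simp add: k_def)
  have k: "k \<le> F y (s / 2)" if "y \<in> {c..d}" for y
  proof -
    have "F y s \<le> (s / (s / 2)) powr q * F y (s / 2)"
      using that cd s(2) by (intro F_dec) auto
    also have "s / (s / 2) = 2" using s(2) by simp
    finally show ?thesis using big[OF that]
      unfolding k_def by (subst pos_divide_le_eq) (auto simp: mult.commute)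
  qed
  have int: "set_integrable M {c..<d} (\<lambda>y. k / (s / 2) * (\<bar>u y\<bar> - s / 2 * v y))"
    by (intro set_integrable_M) auto
  have "k * (d - c) = k / (s / 2) * (s * (d - c) - s / 2 * (d - c))"
    using s(2) by (simp add: field_simps)
  also have "\<dots> \<le> k / (s / 2) * ((LINT x:{c..<d}|M. \<bar>u x\<bar>) - s / 2 * (d - c))"
    using increment_abs_le[of c d] cd s k0 by (intro mult_left_mono) auto
  also have "\<dots> = k / (s / 2) * ((LINT x:{c..<d}|M. \<bar>u x\<bar>) - s / 2 * (LINT x:{c..<d}|M. v x))"
    using length_eq[of c d] cd by simp
  also have "\<dots> = (LINT y:{c..<d}|M. k / (s / 2) * (\<bar>u y\<bar> - s / 2 * v y))"
    by (subst set_integral_mult_right, subst set_integral_diff(2), simp_all)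
  finally have "ennreal (k * (d - c)) \<le> ennreal (LINT y:{c..<d}|M. k / (s / 2) * (\<bar>u y\<bar> - s / 2 * v y))"
    by (rule ennreal_leI)
  also have "\<dots> \<le> (\<integral>\<^sup>+y. ennreal (indicator {c..<d} y *\<^sub>R (k / (s / 2) * (\<bar>u y\<bar> - s / 2 * v y))) \<partial>M)"
    unfolding set_lebesgue_integral_def
    by (rule ennreal_integral_le_nn_integral) (rule int[unfolded set_integrable_def])
  also have "\<dots> \<le> total"
    unfolding total_def
  proof (rule nn_integral_mono)
    fix y
    show "ennreal (indicator {c..<d} y *\<^sub>R (k / (s / 2) * (\<bar>u y\<bar> - s / 2 * v y)))
        \<le> \<Psi> y * indicator {a..<b} y"
      using \<Psi>_ge[of y "s / 2" k] k[of y] k0 s(2) cd by (auto split: split_indicator)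
  qed
  finally have "k * (d - c) \<le> R" using R k0 cd by simp
  moreover have "k * (d - c) = C / 2 powr q" using cd by (simp add: k_def)
  ultimately have "C / 2 powr q \<le> R" by simp
  then have "C \<le> R * 2 powr q" by (subst (asm) pos_divide_le_eq) auto
  with C show False by (simp add: mult.commute)
qed

text \<open>The constant collects two losses: 1 - e from \<open>convex_comparison\<close>, and (1 +
  e)^q for the return from s / (1 + e) to s. The terms e v + e |u| are the perspective of the error
  e + e t.\<close>

lemma cell_bound:
  assumes fin: "total < top" and e: "0 < e" "e < 1"
  obtains \<delta> where "0 < \<delta>"
    "\<And>c d x. \<lbrakk>a \<le> c; c < d; d \<le> b; d - c < \<delta>; x \<in> {c..d}\<rbrakk> \<Longrightarrow>
      \<phi> x (\<bar>f c - f d\<bar> / (d - c)) * ennreal (d - c)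
      \<le> ennreal ((1 + e) powr q / (1 - e)) *
        (\<integral>\<^sup>+y. (\<Psi> y + ennreal (e * v y + e * \<bar>u y\<bar>)) * indicator {c..<d} y \<partial>M)"
proof -
  define R where "R = enn2real total"
  have R: "total = ennreal R" "0 \<le> R" using fin by (simp_all add: R_def)
  obtain B where B: "0 \<le> B" "\<And>x. x \<in> {a..b} \<Longrightarrow> F x 1 \<le> B" using F_bounded[OF compact_Icc] by blast
  \<comment> \<open>C1 exceeds 2^q R, as \<open>cell_point_bound\<close> demands. C2 absorbs the
    error 1 of (VA1), because 1 \<le> (b - a)/(d - c). C3 contains the (Dec) factor from s/2 to s/e
    and a bound for F y 1.\<close>
  define C1 C2 C3 where "C1 = 2 powr q * R + 1" and "C2 = C1 + (b - a)"
    and "C3 = (2 / e) powr q * C2 + B * (b - a)"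
  have C: "0 < C1" "0 < C2" "0 < C3"
  proof -
    show "0 < C1" using R by (auto simp: C1_def intro!: add_nonneg_pos)
    then show "0 < C2" using a_less_b by (simp add: C2_def)
    then show "0 < C3" using a_less_b B e
      by (auto simp: C3_def intro!: add_pos_nonneg)
  qed
  obtain \<delta>1 where \<delta>1: "0 < \<delta>1"
    "\<And>x y r t. \<lbrakk>x \<in> {a..b}; y \<in> {a..b}; 0 < r; r < \<delta>1; \<bar>x - y\<bar> \<le> r; 0 \<le> t; F y t \<le> C1 / r\<rbrakk>
      \<Longrightarrow> F x (t / (1 + 1)) \<le> F y t + 1"
    using F_VA1[OF C(1) zero_less_one] by blast
  obtain \<delta>2 where \<delta>2: "0 < \<delta>2"
    "\<And>x y r t. \<lbrakk>x \<in> {a..b}; y \<in> {a..b}; 0 < r; r < \<delta>2; \<bar>x - y\<bar> \<le> r; 0 \<le> t; F y t \<le> C3 / r\<rbrakk>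
      \<Longrightarrow> F x (t / (1 + e)) \<le> F y t + e"
    using F_VA1[OF C(3) e(1)] by blast
  show ?thesis
  proof (rule that[of "min \<delta>1 \<delta>2"])
    show "0 < min \<delta>1 \<delta>2" using \<delta>1 \<delta>2 by simp
    fix c d x assume cd: "a \<le> c" "c < d" "d \<le> b" "d - c < min \<delta>1 \<delta>2" and x: "x \<in> {c..d}"
    define s where "s = \<bar>f c - f d\<bar> / (d - c)"
    have xI: "x \<in> {a..b}" using x cd by auto
    show "\<phi> x (\<bar>f c - f d\<bar> / (d - c)) * ennreal (d - c)
      \<le> ennreal ((1 + e) powr q / (1 - e)) *
        (\<integral>\<^sup>+y. (\<Psi> y + ennreal (e * v y + e * \<bar>u y\<bar>)) * indicator {c..<d} y \<partial>M)"
    proof (cases "s = 0")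
      case True
      show ?thesis unfolding s_def[symmetric] unfolding True using phi_0[OF xI] by simp
    next
      case False
      then have s: "0 < s" using cd by (simp add: s_def)
      obtain y0 where y0: "y0 \<in> {c..d}" "F y0 s \<le> C1 / (d - c)"
        using cell_point_bound[OF cd(1-3) s_def s R, of C1] by (auto simp: C1_def)
      \<comment> \<open>(VA1) with error 1 spreads the bound from y0 over the cell and halves the
        argument.\<close>
      have half: "F y (s / 2) \<le> C2 / (d - c)" if y: "y \<in> {c..d}" for y
      proof -
        have "F y (s / (1 + 1)) \<le> F y0 s + 1"
          using y y0 cd s by (intro \<delta>1(2)[of y y0 "d - c"]) auto
        also have "\<dots> \<le> C1 / (d - c) + (b - a) / (d - c)"
          using y0 cd by (intro add_mono) auto
        finally show ?thesis by (simp add: C2_def add_divide_distrib)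
      qed
      define T where "T = max 1 (s / e)"
      have FT: "F y t \<le> C3 / (d - c)" if y: "y \<in> {c..d}" and t: "0 \<le> t" "t \<le> T" for y t
      proof -
        have yI: "y \<in> {a..b}" using y cd by auto
        have "F y (s / e) \<le> (s / e / (s / 2)) powr q * F y (s / 2)"
          using s e by (intro F_dec[OF yI]) (auto simp: field_simps)
        also have "s / e / (s / 2) = 2 / e" using s by simp
        also have "(2 / e) powr q * F y (s / 2) \<le> (2 / e) powr q * (C2 / (d - c))"
          using half[OF y] by (intro mult_left_mono) auto
        finally have 1: "F y (s / e) \<le> (2 / e) powr q * C2 / (d - c)" by simp
        have "B * (d - c) \<le> B * (b - a)" using B cd by (intro mult_left_mono) auto
        then have "B \<le> B * (b - a) / (d - c)" using cd by (simp add: field_simps)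
        then have 2: "F y 1 \<le> B * (b - a) / (d - c)" using B(2)[OF yI] by linarith
        have "F y t \<le> F y T" using t yI by (intro F_mono) auto
        also have "\<dots> \<le> F y 1 + F y (s / e)" by (auto simp: T_def max_def)
        also have "\<dots> \<le> C3 / (d - c)" using 1 2 by (simp add: C3_def add_divide_distrib)
        finally show ?thesis .
      qed
      have H: "F x (t / (1 + e)) \<le> F y t + e" if "y \<in> {c..d}" "0 \<le> t" "t \<le> T" for y t
        using FT[OF that] that x cd by (intro \<delta>2(2)[of x y "d - c"]) auto
      have TT: "s / e \<le> T" "1 \<le> T" by (auto simp: T_def)
      have sub: "{c..d} \<subseteq> {a..b}" using cd by auto
      obtain A m where m: "0 \<le> m" "F x (s / (1 + e)) = A + m * (s / (1 + e))"
        and line: "\<And>y t. y \<in> {c..d} \<Longrightarrow> 0 \<le> t \<Longrightarrow> (1 - e) * (A + m * (t / (1 + e))) \<le> F y t + e + e * t"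
        and slope: "\<And>y. y \<in> {c..d} \<Longrightarrow> (1 - e) * (m / (1 + e)) \<le> F y T / T + e"
        by (rule convex_comparison[OF xI e s TT _ sub], rule H, assumption+, rule that)
      \<comment> \<open>The perspective of the line is linear in v and |u|, so its integral involves
        only d - c and the integral of |u|. The latter is at least |f c - f d|, and m \<ge> 0 gives
        this the right direction: this is Jensen's inequality.\<close>
      let ?g = "\<lambda>y. (1 - e) * (A * v y + m / (1 + e) * \<bar>u y\<bar>)"
      have ptw: "ennreal (?g y) \<le> \<Psi> y + ennreal (e * v y + e * \<bar>u y\<bar>)" if y: "y \<in> {c..d}" for y
      proof (cases "0 < v y")
        case True
        have yI: "y \<in> {a..b}" using y sub by auto
        have "v y * ((1 - e) * (A + m * (\<bar>u y\<bar> / v y / (1 + e))))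
            \<le> v y * (F y (\<bar>u y\<bar> / v y) + e + e * (\<bar>u y\<bar> / v y))"
          using line[OF y, of "\<bar>u y\<bar> / v y"] True by (intro mult_left_mono) auto
        also have "\<dots> = v y * F y (\<bar>u y\<bar> / v y) + (e * v y + e * \<bar>u y\<bar>)"
          using True by (simp add: field_simps)
        finally have le: "v y * ((1 - e) * (A + m * (\<bar>u y\<bar> / v y / (1 + e))))
            \<le> v y * F y (\<bar>u y\<bar> / v y) + (e * v y + e * \<bar>u y\<bar>)" .
        have "v y * ((1 - e) * (A + m * (X / (1 + e))))
            = (1 - e) * (A * v y + m / (1 + e) * (v y * X))" for X
          by (simp add: algebra_simps)
        from this[of "\<bar>u y\<bar> / v y"]
        have eq: "v y * ((1 - e) * (A + m * (\<bar>u y\<bar> / v y / (1 + e)))) = ?g y"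
          using True by simp
        from le[unfolded eq] have "ennreal (?g y) \<le> ennreal (v y * F y (\<bar>u y\<bar> / v y) + (e * v y + e * \<bar>u y\<bar>))"
          by (rule ennreal_leI)
        also have "\<dots> = \<Psi> y + ennreal (e * v y + e * \<bar>u y\<bar>)"
          using True e yI by (simp add: \<Psi>_def phi_F ennreal_mult)
        finally show ?thesis .
      next
        case False
        then have v0: "v y = 0" using v_nonneg[of y] by linarith
        have yI: "y \<in> {a..b}" using y sub by auto
        have "?g y = \<bar>u y\<bar> * ((1 - e) * (m / (1 + e)))" by (simp add: v0)
        also have "\<dots> \<le> \<bar>u y\<bar> * (F y T / T + e)"
          using slope[OF y] by (intro mult_left_mono) auto
        finally have "ennreal (?g y) \<le> ennreal (\<bar>u y\<bar> * (F y T / T + e))" by (rule ennreal_leI)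
        also have "\<dots> = ennreal \<bar>u y\<bar> * ennreal (F y T / T) + ennreal (e * \<bar>u y\<bar>)"
        proof -
          have "\<bar>u y\<bar> * (F y T / T + e) = \<bar>u y\<bar> * (F y T / T) + e * \<bar>u y\<bar>"
            by (simp add: distrib_left mult.commute)
          moreover have "ennreal (\<bar>u y\<bar> * (F y T / T)) = ennreal \<bar>u y\<bar> * ennreal (F y T / T)"
            using TT by (intro ennreal_mult) auto
          ultimately show ?thesis
            using TT e by (simp only:) (subst ennreal_plus, auto)
        qed
        also have "\<dots> \<le> ennreal \<bar>u y\<bar> * recession \<phi> y + ennreal (e * \<bar>u y\<bar>)"
          using recession_tendsto(3)[OF yI, of T] TT by (intro add_mono mult_left_mono) auto
        finally show ?thesis by (simp add: \<Psi>_def v0)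
      qed
      have int: "set_integrable M {c..<d} ?g" by (intro set_integrable_M) auto
      have "(1 - e) * (F x (s / (1 + e)) * (d - c))
          = (1 - e) * (A * (d - c) + m / (1 + e) * (s * (d - c)))"
        unfolding m(2) by (simp add: distrib_right mult.assoc)
      also have "s * (d - c) = \<bar>f c - f d\<bar>" using cd by (simp add: s_def)
      also have "(1 - e) * (A * (d - c) + m / (1 + e) * \<bar>f c - f d\<bar>)
          \<le> (1 - e) * (A * (d - c) + m / (1 + e) * (LINT x:{c..<d}|M. \<bar>u x\<bar>))"
        using increment_abs_le[of c d] cd m e by (intro mult_left_mono add_left_mono) auto
      also have "\<dots> = (1 - e) * (A * (LINT x:{c..<d}|M. v x) + m / (1 + e) * (LINT x:{c..<d}|M. \<bar>u x\<bar>))"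
        using length_eq[of c d] cd by simp
      also have "\<dots> = (LINT y:{c..<d}|M. ?g y)"
        by (subst set_integral_mult_right, subst set_integral_add(2), simp_all)
      finally have "ennreal ((1 - e) * (F x (s / (1 + e)) * (d - c))) \<le> ennreal (LINT y:{c..<d}|M. ?g y)"
        by (rule ennreal_leI)
      also have "\<dots> \<le> (\<integral>\<^sup>+y. ennreal (indicator {c..<d} y *\<^sub>R ?g y) \<partial>M)"
        unfolding set_lebesgue_integral_def
        by (rule ennreal_integral_le_nn_integral) (rule int[unfolded set_integrable_def])
      also have "\<dots> \<le> (\<integral>\<^sup>+y. (\<Psi> y + ennreal (e * v y + e * \<bar>u y\<bar>)) * indicator {c..<d} y \<partial>M)"
        using ptw by (intro nn_integral_mono) (auto split: split_indicator)
      finally have main: "ennreal ((1 - e) * (F x (s / (1 + e)) * (d - c))) \<le> \<dots>" .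
      have "F x s \<le> (s / (s / (1 + e))) powr q * F x (s / (1 + e))"
        using s e by (intro F_dec[OF xI]) (auto simp: field_simps)
      also have "s / (s / (1 + e)) = 1 + e" using s by simp
      finally have "F x s * (d - c) \<le> (1 + e) powr q * F x (s / (1 + e)) * (d - c)"
        using cd by (intro mult_right_mono) auto
      also have "\<dots> = (1 + e) powr q / (1 - e) * ((1 - e) * (F x (s / (1 + e)) * (d - c)))"
        using e by simp
      finally have "ennreal (F x s * (d - c))
          \<le> ennreal ((1 + e) powr q / (1 - e)) * ennreal ((1 - e) * (F x (s / (1 + e)) * (d - c)))"
        using e cd by (subst ennreal_mult[symmetric]) (auto intro!: ennreal_leI)
      also have "\<dots> \<le> ennreal ((1 + e) powr q / (1 - e)) *
          (\<integral>\<^sup>+y. (\<Psi> y + ennreal (e * v y + e * \<bar>u y\<bar>)) * indicator {c..<d} y \<partial>M)"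
        using main by (rule mult_left_mono) simp
      finally show ?thesis using xI s cd by (simp add: phi_F ennreal_mult s_def[symmetric])
    qed
  qed
qed

end

section \<open>The upper bound\<close>

lemma partition_cell:
  assumes "P \<in> partitions {a..b::real}" "J \<in> P"
  obtains c d where "J = {c..d}" "a \<le> c" "c < d" "d \<le> b"
    "Inf J = c" "Sup J = d" "measure lborel J = d - c"
proof -
  have P: "P division_of {a..b}" "interior J \<noteq> {}" using assms by (auto simp: partitions_def)
  obtain c d where J: "J = {c..d}" using division_ofD(4)[OF P(1) assms(2)] by auto
  have "c < d" using P(2) J by (simp add: interior_atLeastAtMost_real)
  moreover have "J \<subseteq> {a..b}" using division_ofD(2)[OF P(1) assms(2)] .
  ultimately show ?thesis using that[of c d] J by simp
qed

lemma partition_finite: "P \<in> partitions I \<Longrightarrow> finite P"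
  by (auto simp: partitions_def dest: division_ofD(1))

lemma partition_disjoint:
  assumes "P \<in> partitions {a..b::real}"
  shows "disjoint_family_on (\<lambda>J. {Inf J..<Sup J}) P"
proof (unfold disjoint_family_on_def, intro ballI impI)
  fix J K assume JK: "J \<in> P" "K \<in> P" "J \<noteq> K"
  have dis: "interior J \<inter> interior K = {}"
    using assms JK division_ofD(5)[of P "{a..b}" J K] by (simp add: partitions_def)
  obtain c d where J: "J = {c..d}" "c < d" "Inf J = c" "Sup J = d"
    using partition_cell[OF assms JK(1)] by metis
  obtain c' d' where K: "K = {c'..d'}" "c' < d'" "Inf K = c'" "Sup K = d'"
    using partition_cell[OF assms JK(2)] by metis
  show "{Inf J..<Sup J} \<inter> {Inf K..<Sup K} = {}"
  proof (rule ccontr)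
    assume "\<not> ?thesis"
    then have "max c c' < min d d'" using J K by auto
    then have "(max c c' + min d d') / 2 \<in> {c<..<d} \<inter> {c'<..<d'}" by auto
    then show False using dis J K by (auto simp: interior_atLeastAtMost_real)
  qed
qed

text \<open>Half-open cells count an atom at a common endpoint once; they are disjoint and contained
  in \<open>{a..<b}\<close>.\<close>

lemma partition_sum_nn_integral_le:
  fixes g :: "real \<Rightarrow> ennreal"
  assumes P: "P \<in> partitions {a..b}"
    and g: "\<And>c d. a \<le> c \<Longrightarrow> d \<le> b \<Longrightarrow> (\<lambda>x. g x * indicator {c..<d} x) \<in> borel_measurable M"
  shows "(\<Sum>J\<in>P. \<integral>\<^sup>+x. g x * indicator {Inf J..<Sup J} x \<partial>M) \<le> (\<integral>\<^sup>+x. g x * indicator {a..<b} x \<partial>M)"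
proof -
  have "(\<Sum>J\<in>P. \<integral>\<^sup>+x. g x * indicator {Inf J..<Sup J} x \<partial>M)
      = (\<integral>\<^sup>+x. (\<Sum>J\<in>P. g x * indicator {Inf J..<Sup J} x) \<partial>M)"
  proof (rule nn_integral_sum[symmetric])
    fix J assume "J \<in> P"
    obtain c d where "a \<le> c" "d \<le> b" "Inf J = c" "Sup J = d"
      using partition_cell[OF P \<open>J \<in> P\<close>] by metis
    with g[of c d] show "(\<lambda>x. g x * indicator {Inf J..<Sup J} x) \<in> borel_measurable M" by simp
  qed
  also have "\<dots> \<le> (\<integral>\<^sup>+x. g x * indicator {a..<b} x \<partial>M)"
  proof (rule nn_integral_mono)
    fix x
    have "(\<Union>J\<in>P. {Inf J..<Sup J}) \<subseteq> {a..<b}"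
    proof
      fix y assume "y \<in> (\<Union>J\<in>P. {Inf J..<Sup J})"
      then obtain J where "J \<in> P" "y \<in> {Inf J..<Sup J}" by auto
      obtain c d where "a \<le> c" "d \<le> b" "Inf J = c" "Sup J = d"
        using partition_cell[OF P \<open>J \<in> P\<close>] by metis
      with \<open>y \<in> {Inf J..<Sup J}\<close> show "y \<in> {a..<b}" by auto
    qed
    then have "(\<Sum>J\<in>P. indicator {Inf J..<Sup J} x) \<le> (indicator {a..<b} x :: ennreal)"
      by (subst indicator_UN_disjoint[OF partition_finite[OF P] partition_disjoint[OF P], symmetric])
         (auto simp: indicator_def subset_iff)
    then have "g x * (\<Sum>J\<in>P. indicator {Inf J..<Sup J} x) \<le> g x * indicator {a..<b} x"
      by (rule mult_left_mono) simp
    then show "(\<Sum>J\<in>P. g x * indicator {Inf J..<Sup J} x) \<le> g x * indicator {a..<b} x"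
      by (simp add: sum_distrib_left)
  qed
  finally show ?thesis .
qed

context phi_densities
begin

text \<open>The bound of \<open>cell_bound\<close> is uniform over short cells, and its errors add
  up to e times an integral over the whole interval, however many cells there are.\<close>

lemma partition_sum_upper:
  assumes fin: "total < top" and e: "0 < e" "e < 1"
  obtains \<delta> where "0 < \<delta>" "\<And>P. \<lbrakk>P \<in> partitions {a..b}; mesh P < \<delta>\<rbrakk> \<Longrightarrow>
      phi_variation_sum \<phi> f P
      \<le> ennreal ((1 + e) powr q / (1 - e)) * (total + ennreal (e * (\<integral>x. v x + \<bar>u x\<bar> \<partial>M)))"
proof -
  obtain \<delta> where \<delta>: "0 < \<delta>"
    "\<And>c d x. \<lbrakk>a \<le> c; c < d; d \<le> b; d - c < \<delta>; x \<in> {c..d}\<rbrakk> \<Longrightarrow>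
      \<phi> x (\<bar>f c - f d\<bar> / (d - c)) * ennreal (d - c)
      \<le> ennreal ((1 + e) powr q / (1 - e)) *
        (\<integral>\<^sup>+y. (\<Psi> y + ennreal (e * v y + e * \<bar>u y\<bar>)) * indicator {c..<d} y \<partial>M)"
    by (rule cell_bound[OF fin e], rule that)
  let ?C = "ennreal ((1 + e) powr q / (1 - e))"
  let ?g = "\<lambda>y. \<Psi> y + ennreal (e * v y + e * \<bar>u y\<bar>)"
  have meas: "(\<lambda>x. ?g x * indicator {c..<d} x) \<in> borel_measurable M" if [simp]: "a \<le> c" "d \<le> b" for c d
    by (simp add: distrib_right)
  show ?thesis
  proof (rule that[OF \<delta>(1)])
    fix P assume P: "P \<in> partitions {a..b}" and mesh: "mesh P < \<delta>"
    have "phi_variation_sum \<phi> f P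
        \<le> (\<Sum>J\<in>P. ?C * (\<integral>\<^sup>+y. ?g y * indicator {Inf J..<Sup J} y \<partial>M))"
      unfolding phi_variation_sum_def
    proof (rule sum_mono)
      fix J assume J: "J \<in> P"
      obtain c d where cd: "J = {c..d}" "a \<le> c" "c < d" "d \<le> b"
        "Inf J = c" "Sup J = d" "measure lborel J = d - c" using partition_cell[OF P J] by metis
      have "measure lborel J \<le> mesh P"
        unfolding mesh_def using J partition_finite[OF P] by (intro Max_ge) auto
      then have len: "d - c < \<delta>" using mesh cd by simp
      have "phi_sup \<phi> J (\<bar>incr f J\<bar> / measure lborel J) * ennreal (measure lborel J)
          = (SUP x\<in>{c..d}. \<phi> x (\<bar>f c - f d\<bar> / (d - c)) * ennreal (d - c))"
        using cd by (simp add: phi_sup_def incr_def SUP_mult_right_ennreal)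
      also have "\<dots> \<le> ?C * (\<integral>\<^sup>+y. ?g y * indicator {c..<d} y \<partial>M)"
        using cd len by (intro SUP_least \<delta>(2)) auto
      finally show "phi_sup \<phi> J (\<bar>incr f J\<bar> / measure lborel J) * ennreal (measure lborel J)
          \<le> ?C * (\<integral>\<^sup>+y. ?g y * indicator {Inf J..<Sup J} y \<partial>M)" using cd by simp
    qed
    also have "\<dots> = ?C * (\<Sum>J\<in>P. \<integral>\<^sup>+y. ?g y * indicator {Inf J..<Sup J} y \<partial>M)"
      by (simp add: sum_distrib_left)
    also have "\<dots> \<le> ?C * (\<integral>\<^sup>+y. ?g y * indicator {a..<b} y \<partial>M)"
      by (intro mult_left_mono partition_sum_nn_integral_le[OF P] meas) auto
    also have "(\<integral>\<^sup>+y. ?g y * indicator {a..<b} y \<partial>M)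
        = total + (\<integral>\<^sup>+y. ennreal (e * v y + e * \<bar>u y\<bar>) * indicator {a..<b} y \<partial>M)"
      unfolding total_def by (simp add: distrib_right nn_integral_add)
    also have "(\<integral>\<^sup>+y. ennreal (e * v y + e * \<bar>u y\<bar>) * indicator {a..<b} y \<partial>M)
        \<le> (\<integral>\<^sup>+y. ennreal (e * (v y + \<bar>u y\<bar>)) \<partial>M)"
      by (intro nn_integral_mono) (auto split: split_indicator simp: distrib_left)
    also have "\<dots> = ennreal (\<integral>y. e * (v y + \<bar>u y\<bar>) \<partial>M)"
      using e by (intro nn_integral_eq_integral) (auto simp: add_nonneg_nonneg)
    also have "(\<integral>y. e * (v y + \<bar>u y\<bar>) \<partial>M) = e * (\<integral>x. v x + \<bar>u x\<bar> \<partial>M)" by simp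
    finally show "phi_variation_sum \<phi> f P \<le> ?C * (total + ennreal (e * (\<integral>x. v x + \<bar>u x\<bar> \<partial>M)))"
      by (simp add: mult_left_mono add_left_mono)
  qed
qed

lemma upper_phi_variation_le: "upper_phi_variation \<phi> {a..b} f \<le> total"
proof (cases "total < top")
  case True
  let ?S = "\<lambda>\<delta>. SUP P \<in> {P \<in> partitions {a..b}. mesh P < \<delta>}. phi_variation_sum \<phi> f P"
  let ?B = "\<lambda>e. ennreal ((1 + e) powr q / (1 - e)) * (total + ennreal (e * (\<integral>x. v x + \<bar>u x\<bar> \<partial>M)))"
  have le: "upper_phi_variation \<phi> {a..b} f \<le> ?B e" if e: "0 < e" "e < 1" for e
  proof -
    obtain \<delta> where \<delta>: "0 < \<delta>" "\<And>P. \<lbrakk>P \<in> partitions {a..b}; mesh P < \<delta>\<rbrakk> \<Longrightarrow> phi_variation_sum \<phi> f P \<le> ?B e"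
      by (rule partition_sum_upper[OF True e], rule that)
    have "?S d \<le> ?B e" if "d < \<delta>" for d using \<delta>(2) that by (intro SUP_least) auto
    then have "\<forall>\<^sub>F d in at_right 0. ?S d \<le> ?B e"
      using \<delta>(1) by (intro eventually_at_rightI[of 0 \<delta>]) auto
    then show ?thesis by (rule tendsto_upperbound[OF upper_phi_variation_tendsto]) simp
  qed
  have "((\<lambda>e. ennreal ((1 + e) powr q / (1 - e))) \<longlongrightarrow> ennreal ((1 + 0) powr q / (1 - 0))) (at_right 0)"
    by (intro tendsto_intros) auto
  moreover have "((\<lambda>e. total + ennreal (e * (\<integral>x. v x + \<bar>u x\<bar> \<partial>M)))
      \<longlongrightarrow> total + ennreal (0 * (\<integral>x. v x + \<bar>u x\<bar> \<partial>M))) (at_right 0)"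
    by (intro tendsto_intros)
  ultimately have "(?B \<longlongrightarrow> ennreal ((1 + 0) powr q / (1 - 0)) * (total + ennreal (0 * (\<integral>x. v x + \<bar>u x\<bar> \<partial>M))))
      (at_right 0)"
    using True by (intro tendsto_mult_ennreal) auto
  then have "(?B \<longlongrightarrow> total) (at_right 0)" by simp
  moreover have "\<forall>\<^sub>F e in at_right 0. upper_phi_variation \<phi> {a..b} f \<le> ?B e"
    by (rule eventually_at_rightI[of 0 1], rule le) simp_all
  ultimately show ?thesis by (rule tendsto_lowerbound) simp
qed (simp add: less_top[symmetric])

end

section \<open>Convergence of cell averages\<close>

lemma UN_lessThan_mono_Ico:
  fixes g :: "nat \<Rightarrow> real"
  assumes "mono g"
  shows "(\<Union>k<n. {g k..<g (Suc k)}) = {g 0..<g n}"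
proof (induction n)
  case (Suc n)
  have "{g 0..<g n} \<union> {g n..<g (Suc n)} = {g 0..<g (Suc n)}"
    using monoD[OF assms, of 0 n] monoD[OF assms, of n "Suc n"] by (intro ivl_disj_un) auto
  with Suc show ?case by (simp add: lessThan_Suc Un_commute)
qed simp

lemma disjoint_family_mono_Ico:
  fixes g :: "nat \<Rightarrow> real"
  assumes "mono g"
  shows "disjoint_family (\<lambda>k. {g k..<g (Suc k)})"
proof (unfold disjoint_family_on_def, intro ballI impI)
  fix j k :: nat assume "j \<noteq> k"
  then have "Suc j \<le> k \<or> Suc k \<le> j" by auto
  then have "g (Suc j) \<le> g k \<or> g (Suc k) \<le> g j" using monoD[OF assms] by blast
  then show "{g j..<g (Suc j)} \<inter> {g k..<g (Suc k)} = {}" by auto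
qed

context derivative_densities
begin

text \<open>With \<open>Suc N\<close> cells, every N gives a partition, including N = 0.\<close>

definition grid :: "nat \<Rightarrow> nat \<Rightarrow> real" where
  "grid N k = a + real k * ((b - a) / real (Suc N))"

abbreviation cell :: "nat \<Rightarrow> nat \<Rightarrow> real set" where
  "cell N k \<equiv> {grid N k..<grid N (Suc k)}"

lemma grid_0 [simp]: "grid N 0 = a"
  by (simp add: grid_def)

lemma grid_last [simp]: "grid N (Suc N) = b"
  unfolding grid_def by (subst nonzero_mult_div_cancel_left[symmetric, of "real (Suc N)" "b - a"]) auto

lemma grid_step: "grid N (Suc k) = grid N k + (b - a) / real (Suc N)"
  unfolding grid_def of_nat_Suc[of k] by (simp only: distrib_right mult_1 ac_simps)

lemma grid_less: "grid N k < grid N (Suc k)"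
  using a_less_b by (simp add: grid_step)

lemma grid_mono: "mono (grid N)"
  by (rule monoI) (use a_less_b in \<open>auto simp: grid_def intro!: divide_right_mono mult_right_mono\<close>)

lemma grid_bounds:
  assumes "k \<le> Suc N" shows "a \<le> grid N k" "grid N k \<le> b"
  using monoD[OF grid_mono, of 0 k N] monoD[OF grid_mono, of k "Suc N" N] assms by auto

lemma UN_cell: "(\<Union>k\<le>N. cell N k) = {a..<b}"
  using UN_lessThan_mono_Ico[OF grid_mono, of N "Suc N"] by (simp add: lessThan_Suc_atMost)

lemma cell_disjoint: "x \<in> cell N j \<Longrightarrow> x \<in> cell N k \<Longrightarrow> j = k"
  using disjoint_family_mono_Ico[OF grid_mono, of N] unfolding disjoint_family_on_def by blast

lemma sum_cell_indicator:
  "(\<Sum>k\<le>N. indicator (cell N k) x) = (indicator {a..<b} x :: 'c::{comm_semiring_1})"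
  unfolding UN_cell[of N, symmetric]
  using disjoint_family_on_mono[OF subset_UNIV disjoint_family_mono_Ico[OF grid_mono, of N]]
  by (rule indicator_UN_disjoint[symmetric, rotated]) simp

lemma cell_length:
  assumes "k \<le> N"
  shows "(LINT x:cell N k|M. v x) = grid N (Suc k) - grid N k"
  using assms grid_less[of N k] by (intro length_eq grid_bounds) auto

lemma finite_emeasure [simp]: "emeasure M A < top"
  using finite_measure.emeasure_finite[OF finite_M, of A] by (simp add: less_top)

text \<open>M dominates Lebesgue measure: a cell of M-measure 0 would have length 0.\<close>

lemma cell_measure_pos:
  assumes "k \<le> N"
  shows "0 < measure M (cell N k)"
proof (rule ccontr)
  assume "\<not> ?thesis"
  then have "measure M (cell N k) = 0" by (simp add: not_less measure_le_0_iff)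
  then have "emeasure M (cell N k) = 0"
    by (simp add: finite_measure.emeasure_eq_measure[OF finite_M])
  then have "AE x in M. x \<notin> cell N k" by (subst AE_iff_measurable) auto
  then have "(LINT x:cell N k|M. v x) = 0"
    unfolding set_lebesgue_integral_def by (intro integral_eq_zero_AE) auto
  then show False using cell_length[OF assms] grid_less[of N k] by simp
qed

text \<open>On \<open>{a..<b}\<close> this is the conditional expectation of w under M given the
  cells of the N-th grid. Successive grids are not nested, so there is no martingale; convergence is
  obtained in L^1(M) by approximation.\<close>

definition avg :: "nat \<Rightarrow> (real \<Rightarrow> real) \<Rightarrow> real \<Rightarrow> real" where
  "avg N w x = (\<Sum>k\<le>N. indicator (cell N k) x * ((LINT y:cell N k|M. w y) / measure M (cell N k)))"

lemma avg_eq: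
  assumes "k \<le> N" "x \<in> cell N k"
  shows "avg N w x = (LINT y:cell N k|M. w y) / measure M (cell N k)"
proof -
  have "x \<in> cell N j \<longleftrightarrow> j = k" for j
    using cell_disjoint assms(2) by blast
  then have "indicator (cell N j) x = (if j = k then 1 else (0::real))" for j
    by (simp only: indicator_def of_bool_def)
  then have "avg N w x = (\<Sum>j\<le>N. if j = k then (LINT y:cell N k|M. w y) / measure M (cell N k) else 0)"
    unfolding avg_def by (intro sum.cong refl) (simp only: split: if_split, simp)
  then show ?thesis using assms(1) by (simp)
qed

lemma cell_exists:
  assumes "x \<in> {a..<b}"
  obtains k where "k \<le> N" "x \<in> cell N k"
  using assms UN_cell[of N] by blast

lemma avg_integrable [simp]: "integrable M (avg N w)"
  unfolding avg_def by (intro Bochner_Integration.integrable_sum integrable_mult_left integrable_real_indicator) auto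

lemma avg_borel [measurable]: "avg N w \<in> borel_measurable borel"
  unfolding avg_def by measurable

lemma avg_diff:
  assumes "integrable M w" "integrable M w'"
  shows "avg N (\<lambda>x. w x - w' x) x = avg N w x - avg N w' x"
  unfolding avg_def
  by (simp add: set_integral_diff assms diff_divide_distrib right_diff_distrib sum_subtractf
     )

lemma avg_add:
  assumes "integrable M w" "integrable M w'"
  shows "avg N (\<lambda>x. w x + w' x) x = avg N w x + avg N w' x"
  unfolding avg_def
  by (simp add: set_integral_add assms add_divide_distrib distrib_left sum.distrib
     )

lemma avg_mult:
  shows "avg N (\<lambda>x. c * w x) x = c * avg N w x"
  unfolding avg_def
  by (simp add: sum_distrib_left mult.left_commute)

text \<open>The triangle inequality on each cell, after which averaging |w| restores its integral
  over the cell.\<close>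

lemma avg_contraction:
  assumes w: "integrable M w"
  shows "(\<integral>x. \<bar>avg N w x\<bar> \<partial>M) \<le> (\<integral>x. \<bar>w x\<bar> \<partial>M)"
proof -
  have "(\<integral>x. \<bar>avg N w x\<bar> \<partial>M)
      \<le> (\<integral>x. (\<Sum>k\<le>N. indicator (cell N k) x * ((LINT y:cell N k|M. \<bar>w y\<bar>) / measure M (cell N k))) \<partial>M)"
  proof (rule integral_mono)
    fix x
    have "\<bar>avg N w x\<bar> \<le> (\<Sum>k\<le>N. \<bar>indicator (cell N k) x * ((LINT y:cell N k|M. w y) / measure M (cell N k))\<bar>)"
      unfolding avg_def by (rule sum_abs)
    also have "\<dots> \<le> (\<Sum>k\<le>N. indicator (cell N k) x * ((LINT y:cell N k|M. \<bar>w y\<bar>) / measure M (cell N k)))"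
    proof (rule sum_mono)
      fix k
      have "\<bar>LINT y:cell N k|M. w y\<bar> \<le> (LINT y:cell N k|M. \<bar>w y\<bar>)"
        using set_integral_norm_bound[of M "cell N k" w] w by simp
      then show "\<bar>indicator (cell N k) x * ((LINT y:cell N k|M. w y) / measure M (cell N k))\<bar>
          \<le> indicator (cell N k) x * ((LINT y:cell N k|M. \<bar>w y\<bar>) / measure M (cell N k))"
        by (auto simp: divide_right_mono split: split_indicator)
    qed
    finally show "\<bar>avg N w x\<bar> \<le> \<dots>" .
  qed (auto intro!: Bochner_Integration.integrable_sum integrable_mult_left integrable_real_indicator)
  also have "\<dots> = (\<Sum>k\<le>N. LINT y:cell N k|M. \<bar>w y\<bar>)"
  proof -
    have "(\<integral>x. indicator (cell N k) x * ((LINT y:cell N k|M. \<bar>w y\<bar>) / measure M (cell N k)) \<partial>M)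
        = (LINT y:cell N k|M. \<bar>w y\<bar>)" if "k \<le> N" for k
      using cell_measure_pos[OF that] by simp
    then show ?thesis
      by (subst Bochner_Integration.integral_sum)
        (auto intro!: integrable_mult_left integrable_real_indicator sum.cong)
  qed
  also have "\<dots> = (\<integral>x. (\<Sum>k\<le>N. indicator (cell N k) x * \<bar>w x\<bar>) \<partial>M)"
    unfolding set_lebesgue_integral_def
    using w by (subst Bochner_Integration.integral_sum)
      (auto intro!: integrable_real_mult_indicator simp: mult.commute[of "indicator _ _"])
  also have "\<dots> = (\<integral>x. indicator {a..<b} x * \<bar>w x\<bar> \<partial>M)"
    by (simp only: sum_distrib_right[symmetric] sum_cell_indicator)
  also have "\<dots> \<le> (\<integral>x. \<bar>w x\<bar> \<partial>M)"
    using w by (intro integral_mono)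
      (auto intro!: integrable_real_mult_indicator simp: mult.commute[of "indicator _ _"] split: split_indicator)
  finally show ?thesis .
qed

text \<open>Split avg w - w into avg (w - w'), avg w' - w' and w' - w; the first is controlled by
  the contraction. The constant 2 is the same for all N, so the functions with convergent averages
  form a closed set in L^1(M).\<close>

lemma avg_error:
  assumes [simp]: "integrable M w" "integrable M w'"
  shows "(\<integral>x. \<bar>avg N w x - w x\<bar> \<partial>M)
    \<le> (\<integral>x. \<bar>avg N w' x - w' x\<bar> \<partial>M) + 2 * (\<integral>x. \<bar>w x - w' x\<bar> \<partial>M)"
proof -
  have "(\<integral>x. \<bar>avg N w x - w x\<bar> \<partial>M)
      \<le> (\<integral>x. \<bar>avg N (\<lambda>x. w x - w' x) x\<bar> + (\<bar>avg N w' x - w' x\<bar> + \<bar>w x - w' x\<bar>) \<partial>M)"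
    by (intro integral_mono) (auto simp: avg_diff)
  also have "\<dots> = (\<integral>x. \<bar>avg N (\<lambda>x. w x - w' x) x\<bar> \<partial>M)
      + ((\<integral>x. \<bar>avg N w' x - w' x\<bar> \<partial>M) + (\<integral>x. \<bar>w x - w' x\<bar> \<partial>M))"
    by simp
  also have "\<dots> \<le> (\<integral>x. \<bar>w x - w' x\<bar> \<partial>M)
      + ((\<integral>x. \<bar>avg N w' x - w' x\<bar> \<partial>M) + (\<integral>x. \<bar>w x - w' x\<bar> \<partial>M))"
    using avg_contraction[of "\<lambda>x. w x - w' x" N] by simp
  finally show ?thesis by simp
qed

definition avg_converges :: "(real \<Rightarrow> real) \<Rightarrow> bool" where
  "avg_converges w \<longleftrightarrow> (\<lambda>N. \<integral>x. \<bar>avg N w x - w x\<bar> \<partial>M) \<longlonglongrightarrow> 0"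

lemma avg_converges_limit:
  assumes w: "integrable M w"
    and s: "\<And>i. integrable M (s i)" "\<And>i. avg_converges (s i)"
    and lim: "(\<lambda>i. \<integral>x. \<bar>w x - s i x\<bar> \<partial>M) \<longlonglongrightarrow> 0"
  shows "avg_converges w"
  unfolding avg_converges_def
proof (rule order_tendstoI)
  fix e :: real assume "0 < e"
  then have "\<forall>\<^sub>F i in sequentially. (\<integral>x. \<bar>w x - s i x\<bar> \<partial>M) < e / 4"
    using order_tendstoD(2)[OF lim, of "e / 4"] by simp
  then obtain i where i: "(\<integral>x. \<bar>w x - s i x\<bar> \<partial>M) < e / 4"
    by (auto simp: eventually_sequentially)
  have "\<forall>\<^sub>F N in sequentially. (\<integral>x. \<bar>avg N (s i) x - s i x\<bar> \<partial>M) < e / 2"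
    using order_tendstoD(2)[OF s(2)[of i, unfolded avg_converges_def], of "e / 2"] \<open>0 < e\<close> by simp
  then show "\<forall>\<^sub>F N in sequentially. (\<integral>x. \<bar>avg N w x - w x\<bar> \<partial>M) < e"
  proof eventually_elim
    case (elim N)
    then show ?case using avg_error[OF w s(1), of N i] i by linarith
  qed
next
  fix e :: real assume "e < 0"
  then show "\<forall>\<^sub>F N in sequentially. e < (\<integral>x. \<bar>avg N w x - w x\<bar> \<partial>M)"
    by (intro always_eventually allI) (rule less_le_trans[OF _ Bochner_Integration.integral_nonneg], auto)
qed

lemma avg_converges_add:
  assumes [simp]: "integrable M w" "integrable M w'" and "avg_converges w" "avg_converges w'"
  shows "avg_converges (\<lambda>x. w x + w' x)"
  unfolding avg_converges_def
proof (rule tendsto_sandwich[of "\<lambda>_. 0"])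
  show "(\<lambda>N. (\<integral>x. \<bar>avg N w x - w x\<bar> \<partial>M) + (\<integral>x. \<bar>avg N w' x - w' x\<bar> \<partial>M)) \<longlonglongrightarrow> 0"
    using tendsto_add[OF assms(3,4)[unfolded avg_converges_def]] by simp
  show "\<forall>\<^sub>F N in sequentially. (\<integral>x. \<bar>avg N (\<lambda>x. w x + w' x) x - (w x + w' x)\<bar> \<partial>M)
      \<le> (\<integral>x. \<bar>avg N w x - w x\<bar> \<partial>M) + (\<integral>x. \<bar>avg N w' x - w' x\<bar> \<partial>M)"
  proof (rule always_eventually, rule allI)
    fix N
    have "(\<integral>x. \<bar>avg N (\<lambda>x. w x + w' x) x - (w x + w' x)\<bar> \<partial>M)
        \<le> (\<integral>x. \<bar>avg N w x - w x\<bar> + \<bar>avg N w' x - w' x\<bar> \<partial>M)"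
      by (intro integral_mono) (auto simp: avg_add)
    then show "(\<integral>x. \<bar>avg N (\<lambda>x. w x + w' x) x - (w x + w' x)\<bar> \<partial>M)
        \<le> (\<integral>x. \<bar>avg N w x - w x\<bar> \<partial>M) + (\<integral>x. \<bar>avg N w' x - w' x\<bar> \<partial>M)" by simp
  qed
qed (auto intro!: always_eventually)

lemma avg_converges_mult:
  assumes "avg_converges w"
  shows "avg_converges (\<lambda>x. c * w x)"
proof -
  have "\<bar>avg N (\<lambda>x. c * w x) x - c * w x\<bar> = \<bar>c\<bar> * \<bar>avg N w x - w x\<bar>" for N x
    by (simp add: avg_mult right_diff_distrib[symmetric] abs_mult)
  then show ?thesis using tendsto_mult_left[OF assms[unfolded avg_converges_def], of "\<bar>c\<bar>"]
    by (simp add: avg_converges_def)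
qed

lemma avg_grid_indicator:
  assumes "j \<le> Suc N"
  shows "AE x in M. avg N (indicator {..<grid N j}) x = indicator {..<grid N j} x"
  using M_null
proof eventually_elim
  case (elim x)
  obtain k where k: "k \<le> N" "x \<in> cell N k" using cell_exists[OF elim] .
  have "(LINT y:cell N k|M. indicator {..<grid N j} y :: real)
      = (LINT y:cell N k|M. if k < j then 1 else 0)"
    unfolding set_lebesgue_integral_def
  proof (intro Bochner_Integration.integral_cong refl)
    fix y
    show "indicator (cell N k) y *\<^sub>R indicator {..<grid N j} y
        = indicator (cell N k) y *\<^sub>R (if k < j then 1 else 0 :: real)"
      using monoD[OF grid_mono[of N], of "Suc k" j] monoD[OF grid_mono[of N], of j k]
      by (cases "k < j") (auto split: split_indicator)
  qed
  also have "\<dots> = (if k < j then measure M (cell N k) else 0)"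
    unfolding set_lebesgue_integral_def by simp
  finally have "avg N (indicator {..<grid N j}) x = (if k < j then 1 else 0)"
    using cell_measure_pos[OF k(1)] by (simp add: avg_eq[OF k])
  also have "\<dots> = indicator {..<grid N j} x"
    using k monoD[OF grid_mono[of N], of "Suc k" j] monoD[OF grid_mono[of N], of j k]
    by (cases "k < j") (auto split: split_indicator)
  finally show ?case .
qed

text \<open>Replacing d by the grid point below it changes the indicator on a part of
  \<open>{d - h..<d}\<close>, where h is the cell length. Rounding down keeps d itself out, so an
  atom of M at d does no harm: these intervals shrink to the empty set.\<close>

lemma avg_converges_lessThan: "avg_converges (indicator {..<d})"
  unfolding avg_converges_def
proof (rule tendsto_sandwich[of "\<lambda>_. 0"])
  let ?A = "\<lambda>N. {d - (b - a) / real (Suc N)..<d}"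
  show "\<forall>\<^sub>F N in sequentially. (\<integral>x. \<bar>avg N (indicator {..<d}) x - indicator {..<d} x\<bar> \<partial>M)
      \<le> 2 * measure M (?A N)"
  proof (rule always_eventually, rule allI)
    fix N
    obtain j where j: "j \<le> Suc N"
      "AE x in M. \<bar>indicator {..<d} x - indicator {..<grid N j} x\<bar> \<le> (indicator (?A N) x :: real)"
    proof (cases "d \<in> {a..<b}")
      case True
      then obtain k where k: "k \<le> N" "d \<in> cell N k" by (rule cell_exists)
      then have "{grid N k..<d} \<subseteq> ?A N" "grid N k \<le> d" by (auto simp: grid_step)
      then show ?thesis using k(1) by (intro that[of k]) (auto split: split_indicator)
    next
      case False
      \<comment> \<open>Up to an M-null set the half-line is then empty or everything, like that of
        the first or the last grid point.\<close>
      then have "d < a \<or> b \<le> d" by auto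
      then show ?thesis
      proof
        assume "d < a"
        then show ?thesis using M_null by (intro that[of 0]) (auto split: split_indicator)
      next
        assume "b \<le> d"
        then show ?thesis using M_null by (intro that[of "Suc N"]) (auto split: split_indicator)
      qed
    qed
    have [simp]: "integrable M (indicator {..<c} :: real \<Rightarrow> real)" for c
      by (intro integrable_real_indicator) auto
    have "(\<integral>x. \<bar>avg N (indicator {..<d}) x - indicator {..<d} x\<bar> \<partial>M)
        \<le> (\<integral>x. \<bar>avg N (indicator {..<grid N j}) x - indicator {..<grid N j} x\<bar> \<partial>M)
          + 2 * (\<integral>x. \<bar>indicator {..<d} x - indicator {..<grid N j} x\<bar> \<partial>M)"
      by (rule avg_error) auto
    also have "(\<integral>x. \<bar>avg N (indicator {..<grid N j}) x - indicator {..<grid N j} x\<bar> \<partial>M) = (0::real)"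
      using avg_grid_indicator[OF j(1)] by (intro integral_eq_zero_AE) auto
    also have "(\<integral>x. \<bar>indicator {..<d} x - indicator {..<grid N j} x :: real\<bar> \<partial>M)
        \<le> (\<integral>x. indicator (?A N) x \<partial>M)"
      using j(2) by (intro integral_mono_AE) auto
    finally show "(\<integral>x. \<bar>avg N (indicator {..<d}) x - indicator {..<d} x\<bar> \<partial>M)
      \<le> 2 * measure M (?A N)" by simp
  qed
  have "(\<Inter>N. ?A N) = {}"
  proof (rule ccontr)
    assume "(\<Inter>N. ?A N) \<noteq> {}"
    then obtain x where "x \<in> (\<Inter>N. ?A N)" by blast
    then have x: "\<And>N. d - (b - a) / real (Suc N) \<le> x" "x < d"
      by (auto simp del: of_nat_Suc)
    obtain N where "(b - a) / (d - x) < real N" using reals_Archimedean2 by blast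
    then have "(b - a) / real (Suc N) < d - x" using x a_less_b by (simp add: field_simps)
    then show False using x(1)[of N] by simp
  qed
  moreover have "decseq ?A"
  proof (rule decseq_SucI)
    fix N
    have "(b - a) / real (Suc (Suc N)) \<le> (b - a) / real (Suc N)"
      using a_less_b by (intro divide_left_mono) auto
    then show "?A (Suc N) \<subseteq> ?A N" by auto
  qed
  ultimately have "(\<lambda>N. measure M (?A N)) \<longlonglongrightarrow> 0"
    using finite_measure.finite_Lim_measure_decseq[OF finite_M, of ?A]
    by (simp add: image_subset_iff)
  from tendsto_mult_left[OF this, of 2] show "(\<lambda>N. 2 * measure M (?A N)) \<longlonglongrightarrow> 0" by simp
qed (auto intro!: always_eventually)

lemma integrable_indicator_M [simp]:
  "A \<in> sets borel \<Longrightarrow> integrable M (indicator A :: real \<Rightarrow> real)"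
  by (intro integrable_real_indicator) auto

lemma avg_converges_one: "avg_converges (\<lambda>x. 1)"
proof -
  have "avg N (\<lambda>x. 1) x = 1" if "x \<in> {a..<b}" for N x
  proof -
    obtain k where k: "k \<le> N" "x \<in> cell N k" using cell_exists[OF \<open>x \<in> {a..<b}\<close>] .
    then show ?thesis using cell_measure_pos[OF k(1)] by (simp add: avg_eq set_lebesgue_integral_def)
  qed
  then have "(\<integral>x. \<bar>avg N (\<lambda>x. 1) x - 1\<bar> \<partial>M) = 0" for N
    using M_null by (intro integral_eq_zero_AE) auto
  then show ?thesis by (simp add: avg_converges_def)
qed

text \<open>A Dynkin argument: half-lines form an intersection-stable generator, and a countable
  disjoint union is the L^1(M) limit of its finite subunions because M is finite.\<close>

lemma avg_converges_indicator:
  assumes "A \<in> sets borel"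
  shows "avg_converges (indicator A)"
proof -
  have borel: "sets (borel :: real measure) = sigma_sets UNIV (range lessThan)"
    unfolding borel_eq_lessThan by (simp add: eucl_lessThan)
  have "Int_stable (range (lessThan :: real \<Rightarrow> real set))"
  proof (rule Int_stableI_image)
    fix i j :: real
    have "{..<i} \<inter> {..<j} = {..<min i j}" by auto
    then show "\<exists>k\<in>UNIV. {..<i} \<inter> {..<j} = {..<k}" by blast
  qed
  moreover have "range lessThan \<subseteq> Pow (UNIV :: real set)" by simp
  moreover have "A \<in> sigma_sets UNIV (range lessThan)" using assms borel by simp
  ultimately show ?thesis
  proof (induction rule: sigma_sets_induct_disjoint)
    case (basic A)
    then show ?case by (auto simp: avg_converges_lessThan)
  next
    case empty
    show ?case using avg_converges_mult[OF avg_converges_one, of 0] by simp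
  next
    case (compl A)
    then have [simp]: "A \<in> sets borel" using borel by simp
    have "avg_converges (\<lambda>x. 1 + (-1) * indicator A x)"
      using compl by (intro avg_converges_add avg_converges_mult avg_converges_one)
        (auto intro: finite_measure.integrable_const[OF finite_M])
    then show ?case by (simp add: indicator_compl Compl_eq_Diff_UNIV[symmetric] fun_eq_iff[symmetric])
  next
    case (union A)
    then have A [simp]: "A i \<in> sets borel" for i using borel by auto
    show ?case
    proof (rule avg_converges_limit)
      show "avg_converges (\<lambda>x. \<Sum>i<n. indicator (A i) x)" for n
      proof (induction n)
        case 0
        show ?case using avg_converges_mult[OF avg_converges_one, of 0] by simp
      next
        case (Suc n)
        then show ?case using union by (simp add: avg_converges_add)
      qed
      have eq: "(\<Sum>i<n. indicator (A i) x) = (indicator (\<Union>i<n. A i) x :: real)" for n x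
        using union by (intro indicator_UN_disjoint[symmetric]) (auto simp: disjoint_family_on_def)
      have [measurable]: "A i \<in> sets M" for i by simp
      have "(\<lambda>n. \<integral>x. \<bar>indicator (\<Union>i. A i) x - indicator (\<Union>i<n. A i) x\<bar> \<partial>M) \<longlonglongrightarrow> (\<integral>x. (0::real) \<partial>M)"
      proof (rule integral_dominated_convergence[where w="\<lambda>_. 1"])
        show "AE x in M. (\<lambda>n. \<bar>indicator (\<Union>i. A i) x - indicator (\<Union>i<n. A i) x\<bar>) \<longlonglongrightarrow> (0::real)"
        proof (rule AE_I2)
          fix x
          have "(\<lambda>n. \<bar>indicator (\<Union>i. A i) x - indicator (\<Union>i<n. A i) x\<bar>)
              \<longlonglongrightarrow> \<bar>indicator (\<Union>i. A i) x - (indicator (\<Union>i. A i) x :: real)\<bar>"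
            by (intro tendsto_intros LIMSEQ_indicator_UN)
          then show "(\<lambda>n. \<bar>indicator (\<Union>i. A i) x - indicator (\<Union>i<n. A i) x\<bar>) \<longlonglongrightarrow> (0::real)" by simp
        qed
        show "AE x in M. norm \<bar>indicator (\<Union>i. A i) x - indicator (\<Union>i<n. A i) x :: real\<bar> \<le> 1" for n
          by (rule AE_I2) (auto split: split_indicator)
        show "(\<lambda>x. \<bar>indicator (\<Union>i. A i) x - indicator (\<Union>i<n. A i) x :: real\<bar>)
            \<in> borel_measurable M" for n
          by measurable
      qed (auto intro: finite_measure.integrable_const[OF finite_M])
      then show "(\<lambda>n. \<integral>x. \<bar>indicator (\<Union>i. A i) x - (\<Sum>i<n. indicator (A i) x :: real)\<bar> \<partial>M) \<longlonglongrightarrow> 0"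
        unfolding eq by simp
      show "integrable M (indicator (\<Union>i. A i) :: real \<Rightarrow> real)"
        by (intro integrable_indicator_M sets.countable_UN) auto
    qed auto
  qed
qed

lemma avg_converges_integrable:
  assumes "integrable M w"
  shows "avg_converges w"
  using assms
proof (induction rule: integrable_induct)
  case (base A c)
  then show ?case
    using avg_converges_mult[OF avg_converges_indicator, of A c] by (simp add: mult.commute)
next
  case (add w w')
  then show ?case by (intro avg_converges_add)
next
  case (lim w s)
  show ?case
  proof (rule avg_converges_limit[of w s])
    show "integrable M w" "\<And>i. integrable M (s i)" "\<And>i. avg_converges (s i)" by fact+
    have "(\<lambda>i. \<integral>x. \<bar>w x - s i x\<bar> \<partial>M) \<longlonglongrightarrow> (\<integral>x. (0::real) \<partial>M)"
    \<comment> \<open>The approximants in \<open>integrable_induct\<close> satisfy |s i x| \<le> 2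
      |w x|, hence the factor 3.\<close>
    proof (rule integral_dominated_convergence[where w="\<lambda>x. 3 * \<bar>w x\<bar>"])
      have [measurable]: "w \<in> borel_measurable M" "s i \<in> borel_measurable M" for i
        using \<open>integrable M w\<close> \<open>\<And>i. integrable M (s i)\<close> by auto
      show "(\<lambda>x. \<bar>w x - s i x\<bar>) \<in> borel_measurable M" for i by measurable
      show "AE x in M. (\<lambda>i. \<bar>w x - s i x\<bar>) \<longlonglongrightarrow> 0"
      proof (rule AE_I2)
        fix x
        have "(\<lambda>i. \<bar>w x - s i x\<bar>) \<longlonglongrightarrow> \<bar>w x - w x\<bar>"
          using lim by (intro tendsto_intros) simp_all
        then show "(\<lambda>i. \<bar>w x - s i x\<bar>) \<longlonglongrightarrow> 0" by simp
      qed
      show "AE x in M. norm \<bar>w x - s i x\<bar> \<le> 3 * \<bar>w x\<bar>" for i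
      proof (rule AE_I2)
        fix x
        have "\<bar>s i x\<bar> \<le> 2 * \<bar>w x\<bar>" using lim by simp
        then show "norm \<bar>w x - s i x\<bar> \<le> 3 * \<bar>w x\<bar>" by simp
      qed
    qed (use \<open>integrable M w\<close> in auto)
    then show "(\<lambda>i. \<integral>x. \<bar>w x - s i x\<bar> \<partial>M) \<longlonglongrightarrow> 0" by simp
  qed
qed

text \<open>The errors for u and v are added before a subsequence is extracted, so that one
  subsequence serves both.\<close>

lemma avg_AE_subsequence:
  obtains r where "strict_mono r"
    "AE x in M. (\<lambda>n. avg (r n) u x) \<longlonglongrightarrow> u x \<and> (\<lambda>n. avg (r n) v x) \<longlonglongrightarrow> v x"
proof -
  let ?D = "\<lambda>N x. \<bar>avg N u x - u x\<bar> + \<bar>avg N v x - v x\<bar>"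
  have "(\<lambda>N. \<integral>x. norm (?D N x) \<partial>M) \<longlonglongrightarrow> 0"
    using tendsto_add[OF avg_converges_integrable[OF u_int, unfolded avg_converges_def]
      avg_converges_integrable[OF v_int, unfolded avg_converges_def]] by simp
  then obtain r where r: "strict_mono r" "AE x in M. (\<lambda>n. ?D (r n) x) \<longlonglongrightarrow> 0"
    using tendsto_L1_AE_subseq[of M ?D] by auto
  have "AE x in M. (\<lambda>n. avg (r n) u x) \<longlonglongrightarrow> u x \<and> (\<lambda>n. avg (r n) v x) \<longlonglongrightarrow> v x"
    using r(2)
  proof eventually_elim
    case (elim x)
    have "(\<lambda>n. \<bar>avg (r n) u x - u x\<bar>) \<longlonglongrightarrow> 0" "(\<lambda>n. \<bar>avg (r n) v x - v x\<bar>) \<longlonglongrightarrow> 0"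
      by (rule tendsto_sandwich[OF _ _ tendsto_const elim]; simp)+
    then show ?case by (simp add: tendsto_rabs_zero_iff LIM_zero_iff)
  qed
  with r(1) show ?thesis by (rule that)
qed

end

section \<open>The lower bound\<close>

context derivative_densities
begin

definition uniform_partition :: "nat \<Rightarrow> real set set" where
  "uniform_partition N = (\<lambda>k. {grid N k..grid N (Suc k)}) ` {..N}"

lemma uniform_partition: "uniform_partition N \<in> partitions {a..b}"
  unfolding partitions_def
proof (intro CollectI conjI ballI division_ofI)
  show "finite (uniform_partition N)" by (simp add: uniform_partition_def)
  fix J assume "J \<in> uniform_partition N"
  then obtain k where k: "k \<le> N" "J = {grid N k..grid N (Suc k)}"
    by (auto simp: uniform_partition_def)
  show "J \<subseteq> {a..b}"
    using k(1) grid_bounds[of k N] grid_bounds[of "Suc k" N] unfolding k(2) by auto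
  show "J \<noteq> {}" using grid_less[of N k] k by auto
  show "\<exists>c d. J = cbox c d" using k by auto
  show "interior J \<noteq> {}" using grid_less[of N k] k by (simp add: interior_atLeastAtMost_real)
  fix K assume "K \<in> uniform_partition N" "J \<noteq> K"
  then obtain j where j: "j \<le> N" "K = {grid N j..grid N (Suc j)}"
    by (auto simp: uniform_partition_def)
  with \<open>J \<noteq> K\<close> k have "j \<noteq> k" by auto
  then have "x \<notin> interior J \<inter> interior K" for x
    using cell_disjoint[of x N j k] j k by (auto simp: interior_atLeastAtMost_real)
  then show "interior J \<inter> interior K = {}" by blast
next
  have "x \<in> \<Union> (uniform_partition N)" if x: "x \<in> {a..b}" for x
  proof (cases "x = b")
    case True
    then have "x \<in> {grid N N..grid N (Suc N)}" using grid_less[of N N] by simp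
    then show ?thesis unfolding uniform_partition_def by blast
  next
    case False
    then obtain k where "k \<le> N" "x \<in> cell N k" using cell_exists[of x N] x by auto
    then have "x \<in> {grid N k..grid N (Suc k)}" "k \<in> {..N}" by auto
    then show ?thesis unfolding uniform_partition_def by blast
  qed
  moreover have "\<Union> (uniform_partition N) \<subseteq> {a..b}"
  proof
    fix x assume "x \<in> \<Union> (uniform_partition N)"
    then obtain k where "k \<le> N" "x \<in> {grid N k..grid N (Suc k)}"
      by (auto simp: uniform_partition_def)
    then show "x \<in> {a..b}"
      using grid_bounds[of k N] grid_bounds[of "Suc k" N] by auto
  qed
  ultimately show "\<Union> (uniform_partition N) = {a..b}" by auto
qed

lemma mesh_uniform_partition: "mesh (uniform_partition N) = (b - a) / real (Suc N)"
proof -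
  have "measure lborel ` uniform_partition N = {(b - a) / real (Suc N)}"
  proof -
    have "measure lborel {grid N k..grid N (Suc k)} = (b - a) / real (Suc N)" for k
      using grid_less[of N k] grid_step[of N k] by simp
    then show ?thesis unfolding uniform_partition_def image_image by auto
  qed
  then show ?thesis by (simp add: mesh_def)
qed

lemma avg_pos: "x \<in> {a..<b} \<Longrightarrow> 0 < avg N v x"
proof -
  assume "x \<in> {a..<b}"
  then obtain k where k: "k \<le> N" "x \<in> cell N k" by (rule cell_exists)
  then show ?thesis
    using cell_measure_pos[OF k(1)] cell_length[OF k(1)] grid_less[of N k] by (simp add: avg_eq[OF k])
qed

end

context phi_densities
begin

text \<open>On a cell both averages carry the denominator M(cell), so their ratio is the slope
  |\<Delta>f|/|J| and the average of v is |J|/M(cell). The integrand is thus at most the summand of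
  J divided by M(cell), which integrates to that summand.\<close>

lemma nn_integral_avg_le_variation_sum:
  "(\<integral>\<^sup>+x. indicator {a..<b} x * (\<phi> x (\<bar>avg N u x\<bar> / avg N v x) * ennreal (avg N v x)) \<partial>M)
    \<le> phi_variation_sum \<phi> f (uniform_partition N)"
proof -
  let ?g = "\<lambda>x. \<phi> x (\<bar>avg N u x\<bar> / avg N v x) * ennreal (avg N v x)"
  let ?J = "\<lambda>k. {grid N k..grid N (Suc k)}"
  let ?t = "\<lambda>k. phi_sup \<phi> (?J k) (\<bar>incr f (?J k)\<bar> / measure lborel (?J k)) * ennreal (measure lborel (?J k))"
  have "(\<integral>\<^sup>+x. indicator {a..<b} x * ?g x \<partial>M)
      \<le> (\<integral>\<^sup>+x. (\<Sum>k\<le>N. ?t k / emeasure M (cell N k) * indicator (cell N k) x) \<partial>M)"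
  proof (rule nn_integral_mono)
    fix x
    show "indicator {a..<b} x * ?g x \<le> (\<Sum>k\<le>N. ?t k / emeasure M (cell N k) * indicator (cell N k) x)"
    proof (cases "x \<in> {a..<b}")
      case True
      then obtain k where k: "k \<le> N" "x \<in> cell N k" by (rule cell_exists)
      define \<mu> where "\<mu> = measure M (cell N k)"
      have \<mu>: "0 < \<mu>" using cell_measure_pos[OF k(1)] by (simp add: \<mu>_def)
      have em: "emeasure M (cell N k) = ennreal \<mu>"
        by (simp add: \<mu>_def finite_measure.emeasure_eq_measure[OF finite_M])
      define l where "l = grid N (Suc k) - grid N k"
      have l: "0 < l" using grid_less[of N k] by (simp add: l_def)
      have len: "measure lborel (?J k) = l" using l by (simp add: l_def)
      have inc: "\<bar>incr f (?J k)\<bar> = \<bar>LINT y:cell N k|M. u y\<bar>"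
        using increment[of "grid N k" "grid N (Suc k)"] k(1) grid_less[of N k] grid_bounds[of k N]
          grid_bounds[of "Suc k" N] by (simp add: incr_def abs_minus_commute)
      have av: "avg N v x = l / \<mu>" using avg_eq[OF k, of v] cell_length[OF k(1)] by (simp add: \<mu>_def l_def)
      have "avg N u x = (LINT y:cell N k|M. u y) / \<mu>" using avg_eq[OF k, of u] by (simp add: \<mu>_def)
      then have ratio: "\<bar>avg N u x\<bar> / avg N v x = \<bar>incr f (?J k)\<bar> / l"
        using \<mu> l by (simp add: av inc)
      have "x \<in> ?J k" using k(2) by auto
      then have "\<phi> x (\<bar>incr f (?J k)\<bar> / l) \<le> phi_sup \<phi> (?J k) (\<bar>incr f (?J k)\<bar> / l)"
        unfolding phi_sup_def by (rule SUP_upper)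
      then have "?g x \<le> phi_sup \<phi> (?J k) (\<bar>incr f (?J k)\<bar> / l) * ennreal (avg N v x)"
        unfolding ratio by (rule mult_right_mono) simp
      also have "\<dots> = ?t k / emeasure M (cell N k) * indicator (cell N k) x"
        using k(2) l \<mu> unfolding len em av
        by (simp add: divide_ennreal[symmetric] ennreal_times_divide)
      also have "\<dots> \<le> (\<Sum>k\<le>N. ?t k / emeasure M (cell N k) * indicator (cell N k) x)"
        using k(1) by (intro member_le_sum) auto
      finally show ?thesis using True by simp
    qed simp
  qed
  also have "\<dots> = (\<Sum>k\<le>N. ?t k / emeasure M (cell N k) * emeasure M (cell N k))"
    by (subst nn_integral_sum) (auto simp: nn_integral_cmult_indicator)
  also have "\<dots> = (\<Sum>k\<le>N. ?t k)"
  proof (rule sum.cong)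
    fix k assume "k \<in> {..N}"
    then have "0 < measure M (cell N k)" by (intro cell_measure_pos) simp
    then have "emeasure M (cell N k) \<noteq> 0" "emeasure M (cell N k) \<noteq> top"
      by (auto simp: finite_measure.emeasure_eq_measure[OF finite_M])
    then show "?t k / emeasure M (cell N k) * emeasure M (cell N k) = ?t k"
      by (simp add: ennreal_divide_times mult_divide_eq_ennreal)
  qed simp
  also have "\<dots> = phi_variation_sum \<phi> f (uniform_partition N)"
  proof -
    have "inj_on ?J {..N}"
    proof (rule inj_onI)
      fix j k assume "?J j = ?J k"
      then have "grid N j = grid N k" "grid N (Suc j) = grid N (Suc k)"
        using grid_less[of N j] grid_less[of N k] by (auto simp: Icc_eq_Icc)
      then have "grid N j \<in> cell N j" "grid N j \<in> cell N k"
        using grid_less[of N j] grid_less[of N k] by auto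
      then show "j = k" by (rule cell_disjoint)
    qed
    then show ?thesis unfolding phi_variation_sum_def uniform_partition_def
      by (subst sum.reindex) (simp_all add: comp_def)
  qed
  finally show ?thesis .
qed

text \<open>For u x \<noteq> 0 the sequence converges to \<Psi> x. For u x = 0 it need not, since a
  product of the form 0 times infinity can arise, but then \<Psi> x = 0.\<close>

lemma \<Psi>_le_liminf:
  assumes x: "x \<in> {a..b}" and X: "X \<longlonglongrightarrow> u x" and Y: "Y \<longlonglongrightarrow> v x" "\<And>n. 0 < Y n"
  shows "\<Psi> x \<le> liminf (\<lambda>n. \<phi> x (\<bar>X n\<bar> / Y n) * ennreal (Y n))"
proof (cases "u x = 0")
  case True
  then show ?thesis using x by (simp add: \<Psi>_def phi_0)
next
  case u: False
  have "(\<lambda>n. \<phi> x (\<bar>X n\<bar> / Y n) * ennreal (Y n)) \<longlonglongrightarrow> \<Psi> x"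
  proof (cases "0 < v x")
    case True
    have "(\<lambda>n. \<bar>X n\<bar> / Y n) \<longlonglongrightarrow> \<bar>u x\<bar> / v x"
      using X Y True by (intro tendsto_intros) auto
    then have "(\<lambda>n. F x (\<bar>X n\<bar> / Y n)) \<longlonglongrightarrow> F x (\<bar>u x\<bar> / v x)"
      using True u by (intro isCont_tendsto_compose[OF F_continuous[OF x]]) auto
    then have "(\<lambda>n. ennreal (F x (\<bar>X n\<bar> / Y n) * Y n)) \<longlonglongrightarrow> ennreal (F x (\<bar>u x\<bar> / v x) * v x)"
      using Y by (intro tendsto_intros)
    moreover have "ennreal (F x (\<bar>X n\<bar> / Y n) * Y n) = \<phi> x (\<bar>X n\<bar> / Y n) * ennreal (Y n)" for n
      using Y(2)[of n] x by (simp add: phi_F ennreal_mult)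
    moreover have "ennreal (F x (\<bar>u x\<bar> / v x) * v x) = \<Psi> x"
      using True x by (simp add: \<Psi>_def phi_F ennreal_mult mult.commute)
    ultimately show ?thesis by simp
  next
    case False
    then have v: "v x = 0" using v_nonneg[of x] by linarith
    \<comment> \<open>With t = |X|/Y the expression equals |X| \<phi>(x, t)/t, and t tends to
      infinity.\<close>
    have "filterlim (\<lambda>n. \<bar>X n\<bar> / Y n) at_top sequentially"
      using X Y u unfolding v by (intro LIM_at_top_divide[of _ "\<bar>u x\<bar>"] tendsto_intros always_eventually) auto
    then have "(\<lambda>n. \<phi> x (\<bar>X n\<bar> / Y n) / ennreal (\<bar>X n\<bar> / Y n)) \<longlonglongrightarrow> recession \<phi> x"
      using recession_tendsto(1)[OF x] by (rule filterlim_compose[rotated])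
    moreover have "(\<lambda>n. ennreal \<bar>X n\<bar>) \<longlonglongrightarrow> ennreal \<bar>u x\<bar>"
      using X by (intro tendsto_intros)
    ultimately have "(\<lambda>n. ennreal \<bar>X n\<bar> * (\<phi> x (\<bar>X n\<bar> / Y n) / ennreal (\<bar>X n\<bar> / Y n)))
        \<longlonglongrightarrow> ennreal \<bar>u x\<bar> * recession \<phi> x"
      using u by (intro tendsto_mult_ennreal) auto
    moreover have "\<forall>\<^sub>F n in sequentially. X n \<noteq> 0"
      using X u by (rule tendsto_imp_eventually_ne)
    then have "\<forall>\<^sub>F n in sequentially. ennreal \<bar>X n\<bar> * (\<phi> x (\<bar>X n\<bar> / Y n) / ennreal (\<bar>X n\<bar> / Y n))
        = \<phi> x (\<bar>X n\<bar> / Y n) * ennreal (Y n)"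
    proof eventually_elim
      case (elim n)
      have "\<phi> x (\<bar>X n\<bar> / Y n) = ennreal (F x (\<bar>X n\<bar> / Y n))"
        using x Y(2)[of n] by (intro phi_F) auto
      then show ?case
        using elim Y(2)[of n] by (simp add: divide_ennreal ennreal_mult[symmetric])
    qed
    ultimately have "(\<lambda>n. \<phi> x (\<bar>X n\<bar> / Y n) * ennreal (Y n)) \<longlonglongrightarrow> ennreal \<bar>u x\<bar> * recession \<phi> x"
      by (rule Lim_transform_eventually)
    then show ?thesis by (simp add: \<Psi>_def v)
  qed
  then have "liminf (\<lambda>n. \<phi> x (\<bar>X n\<bar> / Y n) * ennreal (Y n)) = \<Psi> x"
    by (intro lim_imp_Liminf) simp_all
  then show ?thesis by simp
qed

lemma total_le_upper_phi_variation: "total \<le> upper_phi_variation \<phi> {a..b} f"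
proof -
  obtain r where r: "strict_mono r"
    "AE x in M. (\<lambda>n. avg (r n) u x) \<longlonglongrightarrow> u x \<and> (\<lambda>n. avg (r n) v x) \<longlonglongrightarrow> v x"
    by (rule avg_AE_subsequence)
  let ?G = "\<lambda>N x. indicator {a..<b} x * (\<phi> x (\<bar>avg N u x\<bar> / avg N v x) * ennreal (avg N v x))"
  have meas: "?G N \<in> borel_measurable M" for N
  proof -
    \<comment> \<open>\<open>phi_borel\<close> asks for an argument that is nonnegative everywhere,
      hence the outer absolute value; on \<open>{a..<b}\<close> it changes nothing, by
      \<open>avg_pos\<close>.\<close>
    have "(\<lambda>x. indicator {a..b} x * \<phi> x (\<bar>\<bar>avg N u x\<bar> / avg N v x\<bar>)) \<in> borel_measurable borel"
      by (rule phi_borel) auto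
    then have "(\<lambda>x. indicator {a..<b} x * (indicator {a..b} x * \<phi> x (\<bar>\<bar>avg N u x\<bar> / avg N v x\<bar>)
        * ennreal (avg N v x))) \<in> borel_measurable borel" by measurable
    moreover have "indicator {a..<b} x * (indicator {a..b} x * \<phi> x (\<bar>\<bar>avg N u x\<bar> / avg N v x\<bar>)
        * ennreal (avg N v x)) = ?G N x" for x
      using avg_pos[of x N] by (auto split: split_indicator)
    ultimately show ?thesis by simp
  qed
  have "total \<le> (\<integral>\<^sup>+x. liminf (\<lambda>n. ?G (r n) x) \<partial>M)"
    unfolding total_def
  proof (rule nn_integral_mono_AE)
    show "AE x in M. \<Psi> x * indicator {a..<b} x \<le> liminf (\<lambda>n. ?G (r n) x)"
      using r(2)
    proof eventually_elim
      case (elim x)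
      show ?case
      proof (cases "x \<in> {a..<b}")
        case True
        then show ?thesis
          using \<Psi>_le_liminf[of x "\<lambda>n. avg (r n) u x" "\<lambda>n. avg (r n) v x"] elim avg_pos[OF True] by auto
      qed simp
    qed
  qed
  also have "\<dots> \<le> liminf (\<lambda>n. \<integral>\<^sup>+x. ?G (r n) x \<partial>M)"
    by (rule nn_integral_liminf) (rule meas)
  also have "\<dots> \<le> (SUP P \<in> {P \<in> partitions {a..b}. mesh P < \<delta>}. phi_variation_sum \<phi> f P)" (is "_ \<le> ?S \<delta>")
    if "0 < \<delta>" for \<delta>
  proof -
    obtain n0 where n0: "(b - a) / \<delta> < real n0" using reals_Archimedean2 by blast
    have "(\<integral>\<^sup>+x. ?G (r n) x \<partial>M) \<le> ?S \<delta>" if "n0 \<le> n" for n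
    proof -
      have "real n0 \<le> real (Suc (r n))" using seq_suble[OF r(1), of n] that by simp
      then have "(b - a) / \<delta> < real (Suc (r n))" using n0 by linarith
      then have "mesh (uniform_partition (r n)) < \<delta>"
        using \<open>0 < \<delta>\<close> by (simp add: mesh_uniform_partition field_simps)
      then have "phi_variation_sum \<phi> f (uniform_partition (r n)) \<le> ?S \<delta>"
        using uniform_partition by (intro SUP_upper) auto
      then show ?thesis using nn_integral_avg_le_variation_sum[of "r n"] by (rule order_trans[rotated])
    qed
    then have "liminf (\<lambda>n. \<integral>\<^sup>+x. ?G (r n) x \<partial>M) \<le> liminf (\<lambda>n. ?S \<delta>)"
      by (intro Liminf_mono) (auto simp: eventually_sequentially)
    then show ?thesis by (simp add: Liminf_const)
  qed
  finally have "\<forall>\<^sub>F \<delta> in at_right 0. total \<le> ?S \<delta>"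
    by (intro eventually_at_rightI[of 0 1]) auto
  then show ?thesis by (rule tendsto_lowerbound[OF upper_phi_variation_tendsto]) simp
qed

theorem upper_phi_variation_eq_total: "upper_phi_variation \<phi> {a..b} f = total"
  using upper_phi_variation_le total_le_upper_phi_variation by (rule antisym)

end

section \<open>Existence of the densities\<close>

lemma ex_finite_measure_add:
  assumes "finite_measure N1" "finite_measure N2" "sets N1 = sets borel" "sets N2 = sets borel"
  shows "\<exists>M. finite_measure M \<and> sets M = sets borel \<and>
    (\<forall>A\<in>sets borel. emeasure M A = emeasure N1 A + emeasure N2 (A :: real set))"
proof -
  let ?\<mu> = "\<lambda>A. emeasure N1 A + emeasure N2 A"
  define M where "M = measure_of UNIV (sets borel) ?\<mu>"
  have M: "sets M = sets borel"
    using sets.sigma_sets_eq[of "borel :: real measure"] by (simp add: M_def)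
  have em: "emeasure M A = ?\<mu> A" if "A \<in> sets borel" for A
  proof (rule emeasure_measure_of[OF M_def])
    show "countably_additive (sets M) ?\<mu>"
      unfolding M
    proof (rule countably_additiveI)
      fix A :: "nat \<Rightarrow> real set"
      assume A: "range A \<subseteq> sets borel" "disjoint_family A" "(\<Union>i. A i) \<in> sets borel"
      have "(\<Sum>i. ?\<mu> (A i)) = (\<Sum>i. emeasure N1 (A i)) + (\<Sum>i. emeasure N2 (A i))"
        by (rule suminf_add[symmetric]) auto
      also have "\<dots> = ?\<mu> (\<Union>i. A i)"
        using A assms by (simp add: suminf_emeasure)
      finally show "(\<Sum>i. ?\<mu> (A i)) = ?\<mu> (\<Union>i. A i)" .
    qed
    show "positive (sets M) ?\<mu>" by (simp add: positive_def)
    show "sets borel \<subseteq> Pow (UNIV :: real set)" by simp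
    show "A \<in> sets M" using that M by simp
  qed
  have "space M = UNIV" using sets_eq_imp_space_eq[OF M] by simp
  have "finite_measure M"
  proof (rule finite_measureI)
    show "emeasure M (space M) \<noteq> \<infinity>"
      using finite_measure.emeasure_finite[OF assms(1), of UNIV] finite_measure.emeasure_finite[OF assms(2), of UNIV]
      by (simp add: \<open>space M = UNIV\<close> em)
  qed
  then show ?thesis using M em by blast
qed

lemma ex_real_density:
  assumes "finite_measure M" "finite_measure N" "sets N = sets M"
    and le: "\<And>A. A \<in> sets M \<Longrightarrow> emeasure N A \<le> emeasure M A"
  shows "\<exists>d. integrable M d \<and> (\<forall>x. 0 \<le> d x) \<and> density M (\<lambda>x. ennreal (d x :: real)) = N"
proof -
  interpret M: finite_measure M by fact
  interpret N: finite_measure N by fact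
  have ac: "absolutely_continuous M N"
    unfolding absolutely_continuous_def
  proof
    fix A assume "A \<in> null_sets M"
    then show "A \<in> null_sets N" using le[of A] assms(3) by (auto simp: null_sets_def)
  qed
  obtain d where d: "d \<in> borel_measurable M" "AE x in M. RN_deriv M N x = ennreal (d x)" "\<And>x. 0 \<le> d x"
    using M.real_RN_deriv[OF assms(2) ac assms(3)] by metis
  have "density M (\<lambda>x. ennreal (d x)) = density M (RN_deriv M N)"
    using d by (intro density_cong) auto
  also have "\<dots> = N" using M.density_RN_deriv[OF ac assms(3)] .
  finally have dens: "density M (\<lambda>x. ennreal (d x)) = N" .
  have "(\<integral>\<^sup>+x. ennreal (d x) \<partial>M) = emeasure (density M (\<lambda>x. ennreal (d x))) (space M)"
    using d(1) by (simp add: emeasure_density)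
  also have "\<dots> < \<infinity>"
    unfolding dens using N.emeasure_finite[of "space M"] by (simp add: less_top[symmetric])
  finally have "integrable M d"
    using d by (intro integrableI_nonneg) auto
  with d dens show ?thesis by blast
qed

text \<open>\<open>interval_measure\<close> takes a right-continuous function and measures intervals
  open on the left. The reflection of x to -x exchanges the sides, so the measure is built for a
  reflected W and pushed forward.\<close>

lemma ex_left_continuous_measure:
  fixes W :: "real \<Rightarrow> real"
  assumes ab: "a < b" and mono: "mono_on {a..b} W"
    and left: "\<And>x. a < x \<Longrightarrow> x \<le> b \<Longrightarrow> (W \<longlongrightarrow> W x) (at_left x)"
  shows "\<exists>N. finite_measure N \<and> sets N = sets borel \<and> emeasure N (- {a..<b}) = 0 \<and>
    (\<forall>c d. a \<le> c \<longrightarrow> c \<le> d \<longrightarrow> d \<le> b \<longrightarrow> emeasure N {c..<d} = ennreal (W d - W c))"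
proof -
  \<comment> \<open>Extension by constants: a jump of W immediately after a becomes an atom at a,
    and no mass arises at b.\<close>
  define C where "C x = W (max a (min b x))" for x
  define G where "G y = - C (- y)" for y
  have C_mono: "C x \<le> C y" if "x \<le> y" for x y
    unfolding C_def using that ab by (intro mono_onD[OF mono]) auto
  then have G_mono: "G x \<le> G y" if "x \<le> y" for x y using that by (simp add: G_def)
  have C_left: "(C \<longlongrightarrow> C x) (at_left x)" for x
  proof -
    consider "x \<le> a" | "a < x" "x \<le> b" | "b < x" by linarith
    then show ?thesis
    proof cases
      case 1
      have "\<forall>\<^sub>F y in at_left x. C x = C y"
        using 1 ab by (intro eventually_at_leftI[of "x - 1"]) (auto simp: C_def)
      then show ?thesis by (rule tendsto_eventually[OF eventually_mono]) simp
    next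
      case 2
      have "\<forall>\<^sub>F y in at_left x. W y = C y"
        using 2 by (intro eventually_at_leftI[of a]) (auto simp: C_def)
      moreover have "(W \<longlongrightarrow> C x) (at_left x)" using left[OF 2] 2 by (simp add: C_def)
      ultimately show ?thesis by (rule Lim_transform_eventually[rotated])
    next
      case 3
      have "\<forall>\<^sub>F y in at_left x. C x = C y"
        using 3 ab by (intro eventually_at_leftI[of b]) (auto simp: C_def)
      then show ?thesis by (rule tendsto_eventually[OF eventually_mono]) simp
    qed
  qed
  have G_right: "continuous (at_right y) G" for y
  proof -
    have "((\<lambda>x. - C (- (- x))) \<longlongrightarrow> - C (- y)) (at_left (- y))"
      using tendsto_minus[OF C_left[of "- y"]] by simp
    then have "(G \<longlongrightarrow> G y) (at_right y)"
      unfolding at_right_minus[of y] filterlim_filtermap by (simp add: G_def)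
    then show ?thesis by (simp add: continuous_within)
  qed
  define N0 where "N0 = distr (interval_measure G) borel uminus"
  define N where "N = density N0 (indicator {a..<b})"
  have sets: "sets N0 = sets borel" "sets N = sets borel" by (simp_all add: N_def N0_def)
  have N0: "emeasure N0 {c..<d} = ennreal (W d - W c)" if "a \<le> c" "c \<le> d" "d \<le> b" for c d
  proof -
    have "emeasure N0 {c..<d} = emeasure (interval_measure G) (uminus -` {c..<d} \<inter> space (interval_measure G))"
      unfolding N0_def by (rule emeasure_distr) auto
    also have "uminus -` {c..<d} \<inter> space (interval_measure G) = {- d<..- c}" by auto
    also have "emeasure (interval_measure G) {- d<..- c} = ennreal (G (- c) - G (- d))"
      using that by (intro emeasure_interval_measure_Ioc G_mono G_right) auto
    also have "G (- c) - G (- d) = W d - W c" using that by (simp add: G_def C_def)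
    finally show ?thesis .
  qed
  have N: "emeasure N A = emeasure N0 ({a..<b} \<inter> A)" if "A \<in> sets borel" for A
    unfolding N_def using that sets by (simp add: emeasure_density nn_integral_indicator
      indicator_inter_arith[symmetric])
  have "space N = UNIV" using sets_eq_imp_space_eq[OF sets(2)] by simp
  have "finite_measure N"
    by (rule finite_measureI) (simp add: \<open>space N = UNIV\<close> N N0 ab less_imp_le)
  moreover have "emeasure N (- {a..<b}) = 0" by (simp add: N)
  moreover have "emeasure N {c..<d} = ennreal (W d - W c)" if "a \<le> c" "c \<le> d" "d \<le> b" for c d
  proof -
    have "{a..<b} \<inter> {c..<d} = {c..<d}" using that by auto
    then show ?thesis using N0[OF that] by (simp add: N)
  qed
  ultimately show ?thesis using sets(2) by blast
qed

text \<open>For x = a there are no partitions into nondegenerate intervals; the inserted 0 gives the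
  variation its value there.\<close>

definition variation_to :: "(real \<Rightarrow> real) \<Rightarrow> real \<Rightarrow> real \<Rightarrow> real" where
  "variation_to f a x = Sup (insert 0 ((\<lambda>P. \<Sum>J\<in>P. \<bar>incr f J\<bar>) ` partitions {a..x}))"

lemma partition_extend:
  fixes a x y :: real
  assumes "P \<in> partitions {a..x}" "a \<le> x" "x < y"
  shows "insert {x..y} P \<in> partitions {a..y}" "{x..y} \<notin> P" "finite P"
proof -
  have P: "P division_of {a..x}" "\<And>J. J \<in> P \<Longrightarrow> interior J \<noteq> {}"
    using assms(1) by (auto simp: partitions_def)
  have "{{x..y}} division_of {x..y}" using assms division_of_self[of x y] by simp
  then have "P \<union> {{x..y}} division_of {a..x} \<union> {x..y}"
    using P by (intro division_disjoint_union) (auto simp: interior_atLeastAtMost_real)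
  moreover have "{a..x} \<union> {x..y} = {a..y}" using assms by auto
  ultimately show "insert {x..y} P \<in> partitions {a..y}"
    using P assms by (auto simp: partitions_def interior_atLeastAtMost_real)
  show "finite P" using P by auto
  show "{x..y} \<notin> P"
  proof
    assume "{x..y} \<in> P"
    then have "{x..y} \<subseteq> {a..x}" using division_ofD(2)[OF P(1)] by blast
    then show False using assms by auto
  qed
qed

lemma partition_singleton: "a < x \<Longrightarrow> {{a..x}} \<in> partitions {a..x::real}"
  using division_of_self[of a x] by (simp add: partitions_def interior_atLeastAtMost_real)

lemma sum_partition_extend:
  fixes a x y :: real
  assumes "P \<in> partitions {a..x}" "a \<le> x" "x < y"
  shows "(\<Sum>J\<in>insert {x..y} P. \<bar>incr f J\<bar>) = (\<Sum>J\<in>P. \<bar>incr f J\<bar>) + \<bar>f y - f x\<bar>"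
  using partition_extend[OF assms] assms by (simp add: incr_def abs_minus_commute)

lemma variation_to_bdd:
  assumes "f \<in> BV {a..b}" "a \<le> x" "x \<le> b"
  shows "bdd_above (insert 0 ((\<lambda>P. \<Sum>J\<in>P. \<bar>incr f J\<bar>) ` partitions {a..x}))"
proof -
  obtain B where B: "\<And>P. P \<in> partitions {a..b} \<Longrightarrow> (\<Sum>J\<in>P. \<bar>incr f J\<bar>) \<le> B"
    using assms(1) by (auto simp: BV_def)
  have "(\<Sum>J\<in>P. \<bar>incr f J\<bar>) \<le> B" if P: "P \<in> partitions {a..x}" for P
  proof (cases "x = b")
    case False
    then have "x < b" using assms by simp
    then show ?thesis
      using B[OF partition_extend(1)[OF P assms(2) \<open>x < b\<close>]] sum_partition_extend[OF P assms(2) \<open>x < b\<close>, of f]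
      by linarith
  qed (use B that in simp)
  then show ?thesis by (auto intro!: bdd_aboveI2)
qed

lemma variation_to_nonneg:
  assumes "f \<in> BV {a..b}" "a \<le> x" "x \<le> b"
  shows "0 \<le> variation_to f a x"
  unfolding variation_to_def by (rule cSup_upper[OF _ variation_to_bdd[OF assms]]) simp

text \<open>Appending the interval from x to y to a partition of [a, x] adds |f y - f x| to its sum.
  At x = a the one-interval partition of [a, y] takes over.\<close>

lemma variation_to_step:
  assumes f: "f \<in> BV {a..b}" and xy: "a \<le> x" "x < y" "y \<le> b"
  shows "variation_to f a x + \<bar>f y - f x\<bar> \<le> variation_to f a y"
proof -
  have up: "(\<Sum>J\<in>P. \<bar>incr f J\<bar>) \<le> variation_to f a y" if "P \<in> partitions {a..y}" for P
    unfolding variation_to_def using that xy by (intro cSup_upper variation_to_bdd[OF f]) auto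
  have ext: "(\<Sum>J\<in>P. \<bar>incr f J\<bar>) \<le> variation_to f a y - \<bar>f y - f x\<bar>" if "P \<in> partitions {a..x}" for P
    using up[OF partition_extend(1)[OF that xy(1,2)]] sum_partition_extend[OF that xy(1,2), of f]
    by linarith
  have "0 \<le> variation_to f a y - \<bar>f y - f x\<bar>"
  proof (cases "x = a")
    case True
    then show ?thesis
      using up[OF partition_singleton[of a y]] xy by (simp add: incr_def abs_minus_commute)
  next
    case False
    then show ?thesis using ext[OF partition_singleton[of a x]] xy by simp
  qed
  then have "variation_to f a x \<le> variation_to f a y - \<bar>f y - f x\<bar>"
    unfolding variation_to_def[of f a x] using ext by (intro cSup_least) auto
  then show ?thesis by linarith
qed

text \<open>A Jordan decomposition f = p - (p - f). Here p is the left limit of the variation V,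
  hence left-continuous by construction; monotonicity passes from V - f to p - f because f is
  left-continuous.\<close>

lemma BV_left_continuous_decomposition:
  fixes f :: "real \<Rightarrow> real"
  assumes ab: "a < b" and f: "f \<in> BV {a..b}"
    and left: "\<And>x. a < x \<Longrightarrow> x \<le> b \<Longrightarrow> (f \<longlongrightarrow> f x) (at_left x)"
  shows "\<exists>p. mono_on {a..b} p \<and> mono_on {a..b} (\<lambda>x. p x - f x) \<and>
    (\<forall>x. a < x \<longrightarrow> x \<le> b \<longrightarrow> (p \<longlongrightarrow> p x) (at_left x))"
proof -
  \<comment> \<open>The extension by 0 gives V a left limit at a as well, so that p a = 0.\<close>
  define V where "V x = (if x \<le> a then 0 else variation_to f a x)" for x
  have V0: "0 \<le> V x" if "x \<le> b" for x using variation_to_nonneg[OF f] that by (simp add: V_def)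
  have V_step: "V x + \<bar>f y - f x\<bar> \<le> V y" if "a \<le> x" "x < y" "y \<le> b" for x y
    using variation_to_step[OF f that] variation_to_nonneg[OF f, of a] that ab by (auto simp: V_def split: if_splits)
  have V_mono: "V x \<le> V y" if "x \<le> y" "y \<le> b" for x y
    using V_step[of x y] V0[of y] that by (cases "x \<le> a"; cases "x = y") (auto simp: V_def)
  define p where "p x = Sup (V ` ({..<x} \<inter> {..b}))" for x
  have bdd: "bdd_above (V ` ({..<x} \<inter> {..b}))" for x
    by (rule bdd_aboveI2[of _ _ "V b"]) (auto intro: V_mono)
  have ne: "{..<x} \<inter> {..b} \<noteq> {}" for x :: real
  proof -
    have "min x b - 1 \<in> {..<x} \<inter> {..b}" by auto
    then show ?thesis by blast
  qed
  have p_mono: "p x \<le> p y" if "x \<le> y" for x y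
    unfolding p_def using that by (intro cSUP_subset_mono bdd ne) auto
  have lim: "at x within ({..<x} \<inter> {..b}) = at_left x" if "x \<le> b" for x
  proof -
    have "{..<x} \<inter> {..b} = {..<x}" using that by auto
    then show ?thesis by simp
  qed
  have V_lim: "(V \<longlongrightarrow> p x) (at_left x)" if "x \<le> b" for x
    using Lim_left_bound[of "{..b}" x V "V b"] V_mono lim[OF that] by (simp add: p_def)
  have p_left: "(p \<longlongrightarrow> p x) (at_left x)" if "x \<le> b" for x
  proof -
    have "(p \<longlongrightarrow> Sup (p ` ({..<x} \<inter> {..b}))) (at_left x)"
      using Lim_left_bound[of "{..b}" x p "p b"] p_mono lim[OF that] by simp
    moreover have "Sup (p ` ({..<x} \<inter> {..b})) = p x"
    proof (rule antisym)
      show "Sup (p ` ({..<x} \<inter> {..b})) \<le> p x" by (intro cSUP_least ne) (auto intro: p_mono)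
      have "V z \<le> Sup (p ` ({..<x} \<inter> {..b}))" if "z \<in> {..<x} \<inter> {..b}" for z
      proof -
        have "V z \<le> p ((z + x) / 2)"
          unfolding p_def using that by (intro cSUP_upper bdd) auto
        also have "\<dots> \<le> Sup (p ` ({..<x} \<inter> {..b}))"
        proof (rule cSUP_upper)
          show "bdd_above (p ` ({..<x} \<inter> {..b}))"
            by (rule bdd_aboveI2[of _ _ "p b"]) (auto intro: p_mono)
        qed (use that \<open>x \<le> b\<close> in auto)
        finally show ?thesis .
      qed
      then show "p x \<le> Sup (p ` ({..<x} \<inter> {..b}))"
        unfolding p_def[of x] by (intro cSUP_least ne)
    qed
    ultimately show ?thesis by simp
  qed
  have 1: "V z - f z \<le> p y - f y" if "a \<le> z" "z < y" "y \<le> b" for z y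
  proof (rule tendsto_lowerbound)
    show "((\<lambda>w. V w - f w) \<longlongrightarrow> p y - f y) (at_left y)"
      using that by (intro tendsto_diff V_lim left) auto
    have "V z - f z \<le> V w - f w" if "z < w" "w < y" for w
      using V_step[of z w] \<open>a \<le> z\<close> \<open>y \<le> b\<close> that by linarith
    then show "\<forall>\<^sub>F w in at_left y. V z - f z \<le> V w - f w"
      using that by (intro eventually_at_leftI[of z]) auto
  qed simp
  have p_a: "p a = 0"
  proof -
    have "V ` ({..<a} \<inter> {..b}) = (\<lambda>_. 0) ` ({..<a} \<inter> {..b})"
      by (rule image_cong) (auto simp: V_def)
    then show ?thesis unfolding p_def using ne[of a] by simp
  qed
  \<comment> \<open>No left limit of f is available at a; there p a = V a = 0, and fact 1 applies
    directly.\<close>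
  have 2: "p x - f x \<le> p y - f y" if "a \<le> x" "x < y" "y \<le> b" for x y
  proof (cases "x = a")
    case True
    then show ?thesis using 1[OF that] p_a by (simp add: V_def)
  next
    case False
    show ?thesis
    proof (rule tendsto_upperbound)
      show "((\<lambda>w. V w - f w) \<longlongrightarrow> p x - f x) (at_left x)"
        using that False by (intro tendsto_diff V_lim left) auto
      show "\<forall>\<^sub>F w in at_left x. V w - f w \<le> p y - f y"
        using that False by (intro eventually_at_leftI[of a] 1) auto
    qed simp
  qed
  have "mono_on {a..b} p" using p_mono by (auto simp: mono_on_def)
  moreover have "mono_on {a..b} (\<lambda>x. p x - f x)"
  proof (rule mono_onI)
    fix x y assume "x \<in> {a..b}" "y \<in> {a..b}" "x \<le> y"
    then show "p x - f x \<le> p y - f y" using 2[of x y] by (cases "x = y") auto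
  qed
  ultimately show ?thesis using p_left by blast
qed

text \<open>M is the sum of the measures N1 of p and N2 of p - f and of Lebesgue measure on
  \<open>{a..<b}\<close>. Each summand is below M and so has a density; u is the difference of the
  first two densities.\<close>

theorem ex_derivative_densities:
  fixes f :: "real \<Rightarrow> real"
  assumes ab: "a < b" and f: "f \<in> BV {a..b}"
    and left: "\<And>x. a < x \<Longrightarrow> x \<le> b \<Longrightarrow> (f \<longlongrightarrow> f x) (at_left x)"
  shows "\<exists>M u v. derivative_densities a b f M u v"
proof -
  obtain p where p: "mono_on {a..b} p" "mono_on {a..b} (\<lambda>x. p x - f x)"
    "\<And>x. a < x \<Longrightarrow> x \<le> b \<Longrightarrow> (p \<longlongrightarrow> p x) (at_left x)"
    using BV_left_continuous_decomposition[OF assms] by blast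
  have m: "((\<lambda>x. p x - f x) \<longlongrightarrow> p x - f x) (at_left x)" if "a < x" "x \<le> b" for x
    using that by (intro tendsto_diff p left)
  obtain N1 where N1: "finite_measure N1" "sets N1 = sets borel" "emeasure N1 (- {a..<b}) = 0"
    "\<And>c d. a \<le> c \<Longrightarrow> c \<le> d \<Longrightarrow> d \<le> b \<Longrightarrow> emeasure N1 {c..<d} = ennreal (p d - p c)"
    using ex_left_continuous_measure[OF ab p(1,3)] by blast
  obtain N2 where N2: "finite_measure N2" "sets N2 = sets borel" "emeasure N2 (- {a..<b}) = 0"
    "\<And>c d. a \<le> c \<Longrightarrow> c \<le> d \<Longrightarrow> d \<le> b \<Longrightarrow> emeasure N2 {c..<d} = ennreal ((p d - f d) - (p c - f c))"
    using ex_left_continuous_measure[OF ab p(2) m] by blast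
  define L where "L = density lborel (indicator {a..<b})"
  have L: "sets L = sets borel" "emeasure L (- {a..<b}) = 0"
    by (simp_all add: L_def emeasure_density nn_integral_indicator indicator_inter_arith[symmetric])
  have "space L = UNIV" using sets_eq_imp_space_eq[OF L(1)] by simp
  have Lfin: "finite_measure L"
  proof (rule finite_measureI)
    show "emeasure L (space L) \<noteq> \<infinity>"
      unfolding \<open>space L = UNIV\<close> using ab by (simp add: L_def emeasure_density)
  qed
  obtain N3 where N3: "finite_measure N3" "sets N3 = sets borel"
    "\<And>A. A \<in> sets borel \<Longrightarrow> emeasure N3 A = emeasure N1 A + emeasure N2 A"
    using ex_finite_measure_add[OF N1(1) N2(1) N1(2) N2(2)] by blast
  obtain M where M: "finite_measure M" "sets M = sets borel"
    "\<And>A. A \<in> sets borel \<Longrightarrow> emeasure M A = emeasure N3 A + emeasure L A"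
    using ex_finite_measure_add[OF N3(1) Lfin N3(2) L(1)] by blast
  obtain d1 where d1: "integrable M d1" "\<And>x. 0 \<le> d1 x" "density M (\<lambda>x. ennreal (d1 x)) = N1"
    using ex_real_density[OF M(1) N1(1)] N1(2) M N3 by (metis add.assoc le_iff_add)
  obtain d2 where d2: "integrable M d2" "\<And>x. 0 \<le> d2 x" "density M (\<lambda>x. ennreal (d2 x)) = N2"
    using ex_real_density[OF M(1) N2(1)] N2(2) M N3 by (metis add.assoc add.commute le_iff_add)
  obtain v where v: "integrable M v" "\<And>x. 0 \<le> v x" "density M (\<lambda>x. ennreal (v x)) = L"
    using ex_real_density[OF M(1) Lfin] L(1) M N3 by (metis add.commute le_iff_add)
  have LINT: "ennreal (LINT x:A|M. d x) = emeasure N A"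
    if "integrable M d" "\<And>x. 0 \<le> d x" "density M (\<lambda>x. ennreal (d x)) = N" "A \<in> sets borel" for d N A
  proof -
    have "emeasure N A = (\<integral>\<^sup>+x. ennreal (d x) * indicator A x \<partial>M)"
      using that M(2) unfolding that(3)[symmetric] by (intro emeasure_density) auto
    also have "\<dots> = (\<integral>\<^sup>+x. ennreal (indicator A x *\<^sub>R d x) \<partial>M)"
      by (intro nn_integral_cong) (auto split: split_indicator)
    also have "\<dots> = ennreal (LINT x:A|M. d x)"
      unfolding set_lebesgue_integral_def
      using that M(2) by (intro nn_integral_eq_integral integrable_mult_indicator) auto
    finally show ?thesis by simp
  qed
  have "derivative_densities a b f M (\<lambda>x. d1 x - d2 x) v"
  proof (rule derivative_densities.intro)
    show "integrable M (\<lambda>x. d1 x - d2 x)" using d1(1) d2(1) by simp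
    have "emeasure M (- {a..<b}) = 0" using M N3 N1 N2 L by simp
    then show "AE x in M. x \<in> {a..<b}"
      using M(2) sets_eq_imp_space_eq[OF M(2)] by (subst AE_iff_measurable[of "- {a..<b}"]) auto
    show "density M (\<lambda>x. ennreal (v x)) = density lborel (indicator {a..<b})"
      using v(3) by (simp add: L_def)
    fix c d assume cd: "a \<le> c" "c \<le> d" "d \<le> b"
    have nn: "0 \<le> (LINT x:{c..<d}|M. d1 x)" "0 \<le> (LINT x:{c..<d}|M. d2 x)"
      using d1(2) d2(2) by (auto simp: set_lebesgue_integral_def intro!: Bochner_Integration.integral_nonneg)
    have "p c \<le> p d" "p c - f c \<le> p d - f d"
      using mono_onD[OF p(1), of c d] mono_onD[OF p(2), of c d] cd by auto
    then have 1: "(LINT x:{c..<d}|M. d1 x) = p d - p c"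
      and 2: "(LINT x:{c..<d}|M. d2 x) = (p d - f d) - (p c - f c)"
      using LINT[OF d1, of "{c..<d}"] LINT[OF d2, of "{c..<d}"] N1(4)[OF cd] N2(4)[OF cd] nn by auto
    have "(LINT x:{c..<d}|M. d1 x - d2 x) = (LINT x:{c..<d}|M. d1 x) - (LINT x:{c..<d}|M. d2 x)"
      using d1(1) d2(1) M(2)
      by (intro set_integral_diff; unfold set_integrable_def; intro integrable_mult_indicator) auto
    then show "f d - f c = (LINT x:{c..<d}|M. d1 x - d2 x)" using 1 2 by simp
  qed (fact ab M(1,2) v(1,2))+
  then show ?thesis by blast
qed

section \<open>Identification of the absolutely continuous and singular parts\<close>

lemma signed_measure_sums:
  "signed_measure M \<nu> \<Longrightarrow> range A \<subseteq> sets M \<Longrightarrow> disjoint_family A \<Longrightarrow> (\<lambda>i::nat. \<nu> (A i)) sums \<nu> (\<Union>i. A i)"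
  by (simp add: signed_measure_def)

lemma signed_measure_Un:
  assumes \<nu>: "signed_measure M \<nu>" and "A \<in> sets M" "B \<in> sets M" "A \<inter> B = {}"
  shows "\<nu> (A \<union> B) = \<nu> A + \<nu> B"
proof -
  have "(\<lambda>n. \<nu> (binaryset A B n)) sums \<nu> (\<Union>n. binaryset A B n)"
    using assms by (intro signed_measure_sums[OF \<nu>])
      (auto simp: range_binaryset_eq disjoint_family_on_def binaryset_def)
  moreover have "(\<lambda>n. \<nu> (binaryset A B n)) sums (\<nu> A + \<nu> B)"
    using \<nu> by (intro binaryset_sums) (simp add: signed_measure_def)
  ultimately show ?thesis by (simp add: UN_binaryset_eq sums_unique2)
qed

lemma signed_measure_set_integral:
  fixes w :: "'a \<Rightarrow> real"
  assumes w: "integrable M w" and sub: "sets N \<subseteq> sets M"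
  shows "signed_measure N (\<lambda>A. LINT x:A|M. w x)"
  unfolding signed_measure_def
proof (intro conjI allI impI)
  show "(LINT x:{}|M. w x) = 0" by (simp add: set_lebesgue_integral_def)
  fix A :: "nat \<Rightarrow> 'a set" assume "range A \<subseteq> sets N" and disj: "disjoint_family A"
  then have A [measurable]: "\<And>i. A i \<in> sets M" using sub by auto
  have "(\<lambda>n. \<integral>x. indicator (\<Union>i<n. A i) x *\<^sub>R w x \<partial>M) \<longlonglongrightarrow> (\<integral>x. indicator (\<Union>i. A i) x *\<^sub>R w x \<partial>M)"
  proof (rule integral_dominated_convergence[where w="\<lambda>x. \<bar>w x\<bar>"])
    have [measurable]: "w \<in> borel_measurable M" using w by auto
    show "(\<lambda>x. indicator (\<Union>i. A i) x *\<^sub>R w x) \<in> borel_measurable M"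
      "(\<lambda>x. indicator (\<Union>i<n. A i) x *\<^sub>R w x) \<in> borel_measurable M" for n by measurable
    show "AE x in M. (\<lambda>n. indicator (\<Union>i<n. A i) x *\<^sub>R w x) \<longlonglongrightarrow> indicator (\<Union>i. A i) x *\<^sub>R w x"
      by (intro AE_I2 tendsto_scaleR LIMSEQ_indicator_UN tendsto_const)
    show "AE x in M. norm (indicator (\<Union>i<n. A i) x *\<^sub>R w x) \<le> \<bar>w x\<bar>" for n
      by (intro AE_I2) (auto split: split_indicator)
  qed (use w in auto)
  moreover have "(\<integral>x. indicator (\<Union>i<n. A i) x *\<^sub>R w x \<partial>M) = (\<Sum>i<n. LINT x:A i|M. w x)" for n
  proof -
    have "indicator (\<Union>i<n. A i) x *\<^sub>R w x = (\<Sum>i<n. indicator (A i) x *\<^sub>R w x)" for x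
    proof -
      have "indicator (\<Union>i<n. A i) x = (\<Sum>i<n. indicator (A i) x :: real)"
        using disj by (intro indicator_UN_disjoint) (auto simp: disjoint_family_on_def)
      then show ?thesis by (simp only: scaleR_sum_left)
    qed
    then show ?thesis unfolding set_lebesgue_integral_def
      using w A by (simp only:) (intro Bochner_Integration.integral_sum integrable_mult_indicator)
  qed
  ultimately show "(\<lambda>i. LINT x:A i|M. w x) sums (LINT x:(\<Union>i. A i)|M. w x)"
    unfolding sums_def set_lebesgue_integral_def[of M "\<Union>i. A i"] by simp
qed

text \<open>A Dynkin argument on the traces of half-lines. The sets \<open>{a..<x}\<close> with x
  \<le> b all miss b; the value on \<open>{b}\<close> supplies the whole interval, on which the
  complement step relies.\<close>

lemma signed_measure_unique_Icc:
  fixes a b :: real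
  assumes ab: "a < b" and \<nu>: "signed_measure (restrict_space borel {a..b}) \<nu>"
    and \<mu>: "signed_measure (restrict_space borel {a..b}) \<mu>"
    and eq: "\<And>x. x \<in> {a..b} \<Longrightarrow> \<nu> {a..<x} = \<mu> {a..<x}" "\<nu> {b} = \<mu> {b}"
    and A: "A \<in> sets borel"
  shows "\<nu> (A \<inter> {a..b}) = \<mu> (A \<inter> {a..b})"
proof -
  let ?B = "restrict_space borel {a..b} :: real measure"
  have sets: "A \<inter> {a..b} \<in> sets ?B" if "A \<in> sets borel" for A
    using that by (auto simp: sets_restrict_space)
  have mem: "A \<in> sets ?B" if "A \<in> sets borel" "A \<subseteq> {a..b}" for A
    using sets[OF that(1)] that(2) by (simp add: Int_absorb2)
  have I: "\<nu> {a..b} = \<mu> {a..b}"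
  proof -
    have I: "{a..b} = {a..<b} \<union> {b}" and d: "{a..<b} \<inter> {b} = {}" using ab by auto
    have m: "{a..<b} \<in> sets ?B" "{b} \<in> sets ?B" using ab by (auto intro!: mem)
    show ?thesis
      unfolding I signed_measure_Un[OF \<nu> m d] signed_measure_Un[OF \<mu> m d]
      using eq(1)[of b] eq(2) ab by simp
  qed
  have empty: "\<nu> {} = 0" "\<mu> {} = 0" using \<nu> \<mu> by (simp_all add: signed_measure_def)
  have borel: "sets (borel :: real measure) = sigma_sets UNIV (range lessThan)"
    unfolding borel_eq_lessThan by (simp add: eucl_lessThan)
  have "Int_stable (range (lessThan :: real \<Rightarrow> real set))"
  proof (rule Int_stableI_image)
    fix i j :: real
    have "{..<i} \<inter> {..<j} = {..<min i j}" by auto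
    then show "\<exists>k\<in>UNIV. {..<i} \<inter> {..<j} = {..<k}" by blast
  qed
  moreover have "range lessThan \<subseteq> Pow (UNIV :: real set)" by simp
  moreover have "A \<in> sigma_sets UNIV (range lessThan)" using A borel by simp
  ultimately show ?thesis
  proof (induction rule: sigma_sets_induct_disjoint)
    case (basic A)
    then obtain x where x: "A = {..<x}" by auto
    consider "x < a" | "x \<in> {a..b}" | "b < x" by force
    then show ?case
    proof cases
      case 1
      then have "A \<inter> {a..b} = {}" using x by auto
      then show ?thesis by (simp add: empty)
    next
      case 2
      then have "A \<inter> {a..b} = {a..<x}" using x by auto
      then show ?thesis using eq(1)[OF 2] by simp
    next
      case 3
      then have "A \<inter> {a..b} = {a..b}" using x by auto
      then show ?thesis using I by simp
    qed
  next
    case empty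
    then show ?case using \<open>\<nu> {} = 0\<close> \<open>\<mu> {} = 0\<close> by simp
  next
    case (compl A)
    then have A: "A \<in> sets borel" using borel by simp
    let ?A = "A \<inter> {a..b}" and ?A' = "(UNIV - A) \<inter> {a..b}"
    have "?A \<union> ?A' = {a..b}" "?A \<inter> ?A' = {}" by auto
    then have "\<nu> ?A + \<nu> ?A' = \<mu> ?A + \<mu> ?A'"
      using signed_measure_Un[OF \<nu>, of ?A ?A'] signed_measure_Un[OF \<mu>, of ?A ?A'] A I
      by (simp add: sets)
    then show ?case using compl by simp
  next
    case (union A)
    then have A: "range (\<lambda>i. A i \<inter> {a..b}) \<subseteq> sets ?B" using borel by (auto intro!: sets)
    have disj: "disjoint_family (\<lambda>i. A i \<inter> {a..b})" using union(1) by (auto simp: disjoint_family_on_def)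
    have "(\<lambda>i. \<nu> (A i \<inter> {a..b})) sums \<nu> (\<Union>i. A i \<inter> {a..b})"
      by (rule signed_measure_sums[OF \<nu> A disj])
    moreover have "(\<lambda>i. \<mu> (A i \<inter> {a..b})) sums \<mu> (\<Union>i. A i \<inter> {a..b})"
      by (rule signed_measure_sums[OF \<mu> A disj])
    ultimately show ?case using union(3) by (simp add: sums_unique2)
  qed
qed

text \<open>Every finite partition stays below the integral of |w|, and the Hahn partition into w
  \<ge> 0 and w < 0 attains it.\<close>

lemma total_variation_measure_set_integral:
  fixes w :: "'a \<Rightarrow> real"
  assumes w: "integrable M w" and \<Omega>: "\<Omega> \<in> sets M"
    and \<sigma>: "\<And>A. A \<in> sets (restrict_space M \<Omega>) \<Longrightarrow> \<sigma> A = (LINT x:A|M. w x)"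
  shows "total_variation_measure (restrict_space M \<Omega>) \<sigma> = restrict_space (density M (\<lambda>x. ennreal \<bar>w x\<bar>)) \<Omega>"
proof -
  let ?R = "restrict_space M \<Omega>" and ?T = "restrict_space (density M (\<lambda>x. ennreal \<bar>w x\<bar>)) \<Omega>"
  have \<Omega>': "\<Omega> \<inter> space M = \<Omega>" using sets.sets_into_space[OF \<Omega>] by auto
  have [measurable]: "w \<in> borel_measurable M" using w by auto
  have setsR: "A \<in> sets ?R \<longleftrightarrow> A \<in> sets M \<and> A \<subseteq> \<Omega>" for A
    using \<Omega> by (subst sets_restrict_space_iff) (auto simp: \<Omega>')
  have setsT: "sets ?T = sets ?R" "space ?T = space ?R"
    by (simp_all add: sets_restrict_space space_restrict_space)
  have em: "emeasure ?T A = (\<integral>\<^sup>+x. ennreal \<bar>w x\<bar> * indicator A x \<partial>M)" if "A \<in> sets ?R" for A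
    using that \<Omega> unfolding setsR by (subst emeasure_restrict_space) (auto simp: \<Omega>' emeasure_density)
  have int: "integrable M (\<lambda>x. indicator A x *\<^sub>R w x)" if "A \<in> sets ?R" for A
    using w that unfolding setsR by (intro integrable_mult_indicator) auto
  have le: "ennreal \<bar>\<sigma> A\<bar> \<le> emeasure ?T A" if A: "A \<in> sets ?R" for A
  proof -
    have "\<bar>\<sigma> A\<bar> \<le> (\<integral>x. \<bar>indicator A x *\<^sub>R w x\<bar> \<partial>M)"
      unfolding \<sigma>[OF A] set_lebesgue_integral_def by (rule integral_abs_bound)
    then have "ennreal \<bar>\<sigma> A\<bar> \<le> ennreal (\<integral>x. \<bar>indicator A x *\<^sub>R w x\<bar> \<partial>M)" by (rule ennreal_leI)
    also have "\<dots> = (\<integral>\<^sup>+x. ennreal \<bar>indicator A x *\<^sub>R w x\<bar> \<partial>M)"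
      using int[OF A] by (intro nn_integral_eq_integral[symmetric]) (auto simp del: real_scaleR_def)
    also have "\<dots> = emeasure ?T A"
      unfolding em[OF A] by (intro nn_integral_cong) (auto split: split_indicator)
    finally show ?thesis .
  qed
  have eq: "ennreal \<bar>\<sigma> A\<bar> = emeasure ?T A"
    if A: "A \<in> sets ?R" and s: "s = 1 \<or> s = - 1" "\<And>x. x \<in> A \<Longrightarrow> \<bar>w x\<bar> = s * w x" for A and s :: real
  proof -
    have "(\<integral>x. \<bar>indicator A x *\<^sub>R w x\<bar> \<partial>M) = (\<integral>x. s * (indicator A x *\<^sub>R w x) \<partial>M)"
      using s(2) by (intro Bochner_Integration.integral_cong) (auto split: split_indicator)
    also have "\<dots> = s * \<sigma> A" by (simp add: \<sigma>[OF A] set_lebesgue_integral_def)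
    finally have "(\<integral>x. \<bar>indicator A x *\<^sub>R w x\<bar> \<partial>M) = s * \<sigma> A" .
    moreover have "0 \<le> (\<integral>x. \<bar>indicator A x *\<^sub>R w x\<bar> \<partial>M)" by (rule Bochner_Integration.integral_nonneg) simp
    ultimately have "\<bar>\<sigma> A\<bar> = (\<integral>x. \<bar>indicator A x *\<^sub>R w x\<bar> \<partial>M)" using s(1) by auto
    also have "ennreal \<dots> = (\<integral>\<^sup>+x. ennreal \<bar>indicator A x *\<^sub>R w x\<bar> \<partial>M)"
      using int[OF A] by (intro nn_integral_eq_integral[symmetric]) (auto simp del: real_scaleR_def)
    also have "\<dots> = emeasure ?T A"
      unfolding em[OF A] by (intro nn_integral_cong) (auto split: split_indicator)
    finally show ?thesis .
  qed
  have "(SUP P \<in> {P. finite P \<and> P \<subseteq> sets ?R \<and> disjoint P \<and> \<Union>P = A}. (\<Sum>B\<in>P. ennreal \<bar>\<sigma> B\<bar>)) = emeasure ?T A"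
    if A: "A \<in> sets ?R" for A
  proof (rule antisym)
    show "(SUP P \<in> {P. finite P \<and> P \<subseteq> sets ?R \<and> disjoint P \<and> \<Union>P = A}. (\<Sum>B\<in>P. ennreal \<bar>\<sigma> B\<bar>)) \<le> emeasure ?T A"
    proof (rule SUP_least)
      fix P assume "P \<in> {P. finite P \<and> P \<subseteq> sets ?R \<and> disjoint P \<and> \<Union>P = A}"
      then have P: "finite P" "P \<subseteq> sets ?R" "disjoint P" "\<Union>P = A" by auto
      have "(\<Sum>B\<in>P. ennreal \<bar>\<sigma> B\<bar>) \<le> (\<Sum>B\<in>P. emeasure ?T B)"
        using P by (intro sum_mono le) auto
      also have "\<dots> = emeasure ?T (\<Union>B\<in>P. B)"
        using P setsT by (intro sum_emeasure) (auto simp: disjoint_family_on_def disjoint_def)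
      finally show "(\<Sum>B\<in>P. ennreal \<bar>\<sigma> B\<bar>) \<le> emeasure ?T A" using P(4) by simp
    qed
    let ?P = "A \<inter> {x\<in>space M. 0 \<le> w x}" and ?N = "A \<inter> {x\<in>space M. w x < 0}"
    have PN: "?P \<in> sets ?R" "?N \<in> sets ?R" using A unfolding setsR by auto
    have un: "?P \<union> ?N = A" using A sets.sets_into_space[of A M] unfolding setsR by auto
    have "emeasure ?T A = emeasure ?T ?P + emeasure ?T ?N"
      using PN un setsT by (subst plus_emeasure) auto
    also have "emeasure ?T ?P = ennreal \<bar>\<sigma> ?P\<bar>"
      by (rule eq[OF PN(1), of 1, symmetric]) auto
    also have "emeasure ?T ?N = ennreal \<bar>\<sigma> ?N\<bar>"
      by (rule eq[OF PN(2), of "- 1", symmetric]) auto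
    also have "ennreal \<bar>\<sigma> ?P\<bar> + ennreal \<bar>\<sigma> ?N\<bar> = (\<Sum>B\<in>{?P, ?N}. ennreal \<bar>\<sigma> B\<bar>)"
    \<comment> \<open>If the two sets coincide, the sum has a single term; both sets are then empty
      and contribute 0.\<close>
    proof (cases "?P = ?N")
      case True
      then have "?P = {}" "?N = {}" by auto
      then show ?thesis using \<sigma>[OF PN(1)] by (simp add: set_lebesgue_integral_def)
    qed simp
    also have "\<dots> \<le> (SUP P \<in> {P. finite P \<and> P \<subseteq> sets ?R \<and> disjoint P \<and> \<Union>P = A}. (\<Sum>B\<in>P. ennreal \<bar>\<sigma> B\<bar>))"
      using PN un by (intro SUP_upper) (auto simp: disjoint_def)
    finally show "emeasure ?T A \<le> (SUP P \<in> {P. finite P \<and> P \<subseteq> sets ?R \<and> disjoint P \<and> \<Union>P = A}. (\<Sum>B\<in>P. ennreal \<bar>\<sigma> B\<bar>))" .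
  qed
  then have "total_variation_measure ?R \<sigma> = measure_of (space ?R) (sets ?R) (emeasure ?T)"
    unfolding total_variation_measure_def
    by (intro measure_of_eq sets.space_closed) (simp add: sets.sigma_sets_eq)
  also have "\<dots> = ?T" using measure_of_of_measure[of ?T] by (simp add: setsT)
  finally show ?thesis .
qed

section \<open>Uniqueness of the Lebesgue decomposition\<close>

lemma set_integral_mod_null:
  fixes g :: "real \<Rightarrow> real"
  assumes "g \<in> borel_measurable (lebesgue_on I)" "I \<in> sets lebesgue"
    and "A \<in> sets (lebesgue_on I)" "B \<in> sets (lebesgue_on I)"
    and "AE x in lebesgue_on I. x \<in> A \<longleftrightarrow> x \<in> B"
  shows "(LINT x:A|lebesgue_on I. g x) = (LINT x:B|lebesgue_on I. g x)"
  unfolding set_lebesgue_integral_def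
  using assms by (intro integral_cong_AE) (auto elim!: eventually_mono simp: indicator_def)

text \<open>Off the union of both null sets the singular parts vanish, so g and h have equal
  integrals there; restoring the null set does not change these integrals. Subtraction then
  identifies the singular parts.\<close>

lemma lebesgue_decomposition_unique:
  fixes I :: "real set"
  assumes I: "I \<in> sets borel"
    and 1: "lebesgue_decomposition I \<nu> g \<sigma>" and 2: "lebesgue_decomposition I \<mu> h \<tau>"
    and eq: "\<And>A. A \<in> sets (restrict_space borel I) \<Longrightarrow> \<nu> A = \<mu> A"
  shows "AE x in lebesgue_on I. g x = h x" "\<And>A. A \<in> sets (restrict_space borel I) \<Longrightarrow> \<sigma> A = \<tau> A"
proof -
  have IL: "I \<in> sets lebesgue" using I by simp
  have g: "integrable (lebesgue_on I) g" and h: "integrable (lebesgue_on I) h"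
    using 1 2 by (auto simp: lebesgue_decomposition_def)
  obtain N where N: "N \<in> sets (restrict_space borel I)" "emeasure lborel N = 0"
    "\<And>A. A \<in> sets (restrict_space borel I) \<Longrightarrow> A \<inter> N = {} \<Longrightarrow> \<sigma> A = 0"
    using 1 by (auto simp: lebesgue_decomposition_def)
  obtain N' where N': "N' \<in> sets (restrict_space borel I)" "emeasure lborel N' = 0"
    "\<And>A. A \<in> sets (restrict_space borel I) \<Longrightarrow> A \<inter> N' = {} \<Longrightarrow> \<tau> A = 0"
    using 2 by (auto simp: lebesgue_decomposition_def)
  have \<nu>: "\<nu> A = (LINT x:A|lebesgue_on I. g x) + \<sigma> A" "\<mu> A = (LINT x:A|lebesgue_on I. h x) + \<tau> A"
    if "A \<in> sets (restrict_space borel I)" for A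
    using 1 2 that by (auto simp: lebesgue_decomposition_def)
  have setsB: "A \<in> sets (restrict_space borel I) \<longleftrightarrow> A \<in> sets borel \<and> A \<subseteq> I" for A
    using I by (subst sets_restrict_space_iff) auto
  have setsL: "A \<in> sets (lebesgue_on I) \<longleftrightarrow> A \<in> sets lebesgue \<and> A \<subseteq> I" for A
    using IL by (subst sets_restrict_space_iff) auto
  have BL: "A \<in> sets (lebesgue_on I)" if "A \<in> sets (restrict_space borel I)" for A
    using that unfolding setsB setsL by auto
  have AE_null: "AE x in lebesgue_on I. x \<notin> Z" if "Z \<in> null_sets lborel" for Z
  proof -
    have "AE x in lborel. x \<notin> Z" using that by (rule AE_not_in)
    then show ?thesis using IL by (subst AE_restrict_space_iff) (auto simp: AE_completion_iff elim: eventually_mono)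
  qed
  have eqB: "(LINT x:A|lebesgue_on I. g x) = (LINT x:A|lebesgue_on I. h x)"
    if A: "A \<in> sets (restrict_space borel I)" for A
  proof -
    let ?A = "A - (N \<union> N')"
    have A': "?A \<in> sets (restrict_space borel I)" using A N N' by auto
    have "N \<union> N' \<in> null_sets lborel" using N(1,2) N'(1,2) unfolding setsB by (intro null_sets.Un) auto
    from AE_null[OF this] have ae: "AE x in lebesgue_on I. x \<in> A \<longleftrightarrow> x \<in> ?A" by (rule eventually_mono) auto
    have "(LINT x:?A|lebesgue_on I. g x) = (LINT x:?A|lebesgue_on I. h x)"
    proof -
      have "?A \<inter> N = {}" "?A \<inter> N' = {}" by blast+
      then show ?thesis using \<nu>[OF A'] eq[OF A'] N(3)[OF A'] N'(3)[OF A'] by simp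
    qed
    moreover have "(LINT x:A|lebesgue_on I. g x) = (LINT x:?A|lebesgue_on I. g x)"
      using g by (intro set_integral_mod_null IL BL A A' ae) auto
    moreover have "(LINT x:A|lebesgue_on I. h x) = (LINT x:?A|lebesgue_on I. h x)"
      using h by (intro set_integral_mod_null IL BL A A' ae) auto
    ultimately show ?thesis by simp
  qed
  then show "\<sigma> A = \<tau> A" if "A \<in> sets (restrict_space borel I)" for A
    using \<nu>[OF that] eq[OF that] eqB[OF that] by simp
  show "AE x in lebesgue_on I. g x = h x"
  proof (rule density_unique_real[OF g h])
    fix A assume A: "A \<in> sets (lebesgue_on I)"
    then have "A \<in> sets lebesgue" "A \<subseteq> I" unfolding setsL by auto
    \<comment> \<open>\<open>density_unique_real\<close> tests on Lebesgue sets, which are Borel up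
      to a null set.\<close>
    obtain S Z Z' where S: "A = S \<union> Z" "Z \<subseteq> Z'" "Z' \<in> null_sets lborel" "S \<in> sets lborel"
      by (rule sets_completionE[OF \<open>A \<in> sets lebesgue\<close>])
    have S': "S \<in> sets (restrict_space borel I)" using S \<open>A \<subseteq> I\<close> unfolding setsB by auto
    have ae: "AE x in lebesgue_on I. x \<in> A \<longleftrightarrow> x \<in> S"
      using AE_null[OF S(3)] by (rule eventually_mono) (use S in auto)
    have "(LINT x:A|lebesgue_on I. g x) = (LINT x:S|lebesgue_on I. g x)"
      using g by (intro set_integral_mod_null IL BL A S' ae) auto
    moreover have "(LINT x:A|lebesgue_on I. h x) = (LINT x:S|lebesgue_on I. h x)"
      using h by (intro set_integral_mod_null IL BL A S' ae) auto
    ultimately show "(LINT x:A|lebesgue_on I. g x) = (LINT x:A|lebesgue_on I. h x)"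
      using eqB[OF S'] by simp
  qed
qed

section \<open>The parts of Df in terms of the densities u and v\<close>

context derivative_densities
begin

text \<open>A density with respect to Lebesgue measure, whose own M-density is v. Where v = 0 the
  quotient is 0 by convention.\<close>

definition ac_part :: "real \<Rightarrow> real" where "ac_part x = u x / v x"

text \<open>A density with respect to M: it restricts Df to v = 0, a Lebesgue null subset of
  I.\<close>

definition sing_density :: "real \<Rightarrow> real" where "sing_density x = (if 0 < v x then 0 else u x)"

lemma ac_sing_borel [measurable]: "ac_part \<in> borel_measurable borel" "sing_density \<in> borel_measurable borel"
  unfolding ac_part_def[abs_def] sing_density_def[abs_def] by measurable

lemma v_eq_0: "\<not> 0 < v x \<Longrightarrow> v x = 0"
  using v_nonneg[of x] by linarith

lemma u_split: "u x = ac_part x * v x + sing_density x"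
  by (auto simp: ac_part_def sing_density_def dest: v_eq_0)

lemma sing_density_int [simp]: "integrable M sing_density"
  by (rule Bochner_Integration.integrable_bound[OF u_int]) (auto simp: sing_density_def)

lemma ac_part_v_int [simp]: "integrable M (\<lambda>x. ac_part x * v x)"
  by (rule Bochner_Integration.integrable_bound[OF u_int]) (auto simp: ac_part_def)

lemma nn_integral_lebesgue_on:
  assumes [measurable]: "h \<in> borel_measurable borel"
  shows "(\<integral>\<^sup>+x. h x \<partial>lebesgue_on {a..b}) = (\<integral>\<^sup>+x. ennreal (v x) * h x \<partial>M)"
proof -
  have "(\<integral>\<^sup>+x. h x \<partial>lebesgue_on {a..b}) = (\<integral>\<^sup>+x. h x * indicator {a..b} x \<partial>lborel)"
    by (simp add: nn_integral_restrict_space nn_integral_completion)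
  also have "\<dots> = (\<integral>\<^sup>+x. indicator {a..<b} x * h x \<partial>lborel)"
  proof (rule nn_integral_cong_AE)
    have "AE x in lborel. x \<noteq> b" by (rule AE_lborel_singleton)
    then show "AE x in lborel. h x * indicator {a..b} x = indicator {a..<b} x * h x"
      by eventually_elim (auto split: split_indicator)
  qed
  also have "\<dots> = (\<integral>\<^sup>+x. h x \<partial>density lborel (indicator {a..<b}))"
    by (simp add: nn_integral_density)
  also have "\<dots> = (\<integral>\<^sup>+x. ennreal (v x) * h x \<partial>M)"
    unfolding density_v[symmetric] by (simp add: nn_integral_density)
  finally show ?thesis .
qed

lemma integral_lebesgue_on:
  fixes h :: "real \<Rightarrow> real"
  assumes [measurable]: "h \<in> borel_measurable borel"
  shows "(\<integral>x. h x \<partial>lebesgue_on {a..b}) = (\<integral>x. v x * h x \<partial>M)"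
proof -
  have "(\<integral>x. h x \<partial>lebesgue_on {a..b}) = (\<integral>x. indicator {a..b} x *\<^sub>R h x \<partial>lebesgue)"
    by (rule integral_restrict_space) simp
  also have "\<dots> = (\<integral>x. indicator {a..b} x *\<^sub>R h x \<partial>lborel)"
    by (rule integral_completion) measurable
  also have "\<dots> = (\<integral>x. indicator {a..<b} x *\<^sub>R h x \<partial>lborel)"
  proof (rule integral_cong_AE)
    have "AE x in lborel. x \<noteq> b" by (rule AE_lborel_singleton)
    then show "AE x in lborel. indicator {a..b} x *\<^sub>R h x = indicator {a..<b} x *\<^sub>R h x"
      by eventually_elim (auto split: split_indicator)
  qed simp_all
  also have "\<dots> = (\<integral>x. h x \<partial>density lborel (\<lambda>x. ennreal (indicator {a..<b} x)))"
    by (rule integral_density[symmetric]) auto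
  also have "density lborel (\<lambda>x. ennreal (indicator {a..<b} x)) = density M (\<lambda>x. ennreal (v x))"
    unfolding density_v by (simp add: ennreal_indicator)
  also have "(\<integral>x. h x \<partial>density M (\<lambda>x. ennreal (v x))) = (\<integral>x. v x *\<^sub>R h x \<partial>M)"
    by (rule integral_density) auto
  finally show ?thesis by simp
qed

lemma sets_Icc: "A \<in> sets (restrict_space borel {a..b}) \<longleftrightarrow> A \<in> sets borel \<and> A \<subseteq> {a..b}"
  by (subst sets_restrict_space_iff) auto

lemma emeasure_v_zero: "emeasure lborel ({x\<in>{a..b}. v x = 0}) = 0"
proof -
  have "{x\<in>{a..b}. v x = 0} = {x. v x = 0} \<inter> {a..b}" by auto
  then have "emeasure lborel {x\<in>{a..b}. v x = 0} = (\<integral>\<^sup>+x. indicator ({x. v x = 0} \<inter> {a..b}) x \<partial>lborel)"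
    by (simp add: nn_integral_indicator)
  also have "\<dots> = (\<integral>\<^sup>+x. indicator {x. v x = 0} x * indicator {a..b} x \<partial>lborel)"
    by (simp add: indicator_inter_arith)
  also have "\<dots> = (\<integral>\<^sup>+x. indicator {x. v x = 0} x \<partial>lebesgue_on {a..b})"
    by (simp add: nn_integral_restrict_space nn_integral_completion)
  also have "\<dots> = (\<integral>\<^sup>+x. ennreal (v x) * indicator {x. v x = 0} x \<partial>M)"
    by (rule nn_integral_lebesgue_on) measurable
  also have "\<dots> = (\<integral>\<^sup>+x. 0 \<partial>M)"
    by (rule nn_integral_cong) (auto split: split_indicator)
  finally show ?thesis by simp
qed

text \<open>The integral of u satisfies the defining conditions, so the choice has a witness, and
  \<open>signed_measure_unique_Icc\<close> makes every possible choice agree with it on Borel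
  subsets of I.\<close>

lemma derivative_measure_eq:
  assumes A: "A \<in> sets (restrict_space borel {a..b})"
  shows "derivative_measure a b f A = (LINT x:A|M. u x)"
proof -
  let ?\<mu> = "\<lambda>A. LINT x:A|M. u x"
  let ?P = "\<lambda>\<nu>. signed_measure (restrict_space borel {a..b}) \<nu> \<and>
      (\<forall>x\<in>{a..b}. f x = f a + \<nu> {a..<x}) \<and> \<nu> {b} = 0"
  have sm: "signed_measure (restrict_space borel {a..b}) ?\<mu>"
    by (rule signed_measure_set_integral[OF u_int]) (auto simp: sets_Icc)
  moreover have inc: "f x = f a + ?\<mu> {a..<x}" if "x \<in> {a..b}" for x
    using increment[of a x] that by simp
  moreover have b0: "?\<mu> {b} = 0"
  proof -
    have "AE x in M. indicator {b} x *\<^sub>R u x = 0"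
      using M_null by eventually_elim (auto split: split_indicator)
    then show ?thesis unfolding set_lebesgue_integral_def by (rule integral_eq_zero_AE)
  qed
  ultimately have "?P ?\<mu>" by blast
  then have P: "?P (derivative_measure a b f)"
    unfolding derivative_measure_def by (rule someI[where P = ?P])
  have "derivative_measure a b f (A \<inter> {a..b}) = ?\<mu> (A \<inter> {a..b})"
  proof (rule signed_measure_unique_Icc[OF a_less_b conjunct1[OF P] sm])
    show "derivative_measure a b f {a..<x} = ?\<mu> {a..<x}" if "x \<in> {a..b}" for x
      using P inc[OF that] that by (metis add_left_cancel)
    show "derivative_measure a b f {b} = ?\<mu> {b}" using P b0 by simp
    show "A \<in> sets borel" using A by (simp add: sets_Icc)
  qed
  then show ?thesis using A by (simp add: sets_Icc Int_absorb2)
qed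

lemma lebesgue_decomposition_ac_sing:
  "lebesgue_decomposition {a..b} (derivative_measure a b f) ac_part (\<lambda>A. LINT x:A|M. sing_density x)"
  unfolding lebesgue_decomposition_def
proof (intro conjI bexI[of _ "{x\<in>{a..b}. v x = 0}"] ballI impI)
  show "integrable (lebesgue_on {a..b}) ac_part"
  proof (rule integrableI_bounded)
    show "ac_part \<in> borel_measurable (lebesgue_on {a..b})"
      by (rule measurable_restrict_space1) (rule measurable_completion, simp)
    have "(\<integral>\<^sup>+x. ennreal (norm (ac_part x)) \<partial>lebesgue_on {a..b})
        = (\<integral>\<^sup>+x. ennreal (v x) * ennreal (norm (ac_part x)) \<partial>M)"
      by (rule nn_integral_lebesgue_on) measurable
    also have "\<dots> = (\<integral>\<^sup>+x. ennreal (norm (ac_part x * v x)) \<partial>M)"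
      by (intro nn_integral_cong) (simp add: ennreal_mult[symmetric] abs_mult mult.commute)
    also have "\<dots> < \<infinity>"
      using ac_part_v_int by (simp only: integrable_iff_bounded)
    finally show "(\<integral>\<^sup>+x. ennreal (norm (ac_part x)) \<partial>lebesgue_on {a..b}) < \<infinity>" .
  qed
  show "signed_measure (restrict_space borel {a..b}) (\<lambda>A. LINT x:A|M. sing_density x)"
    by (rule signed_measure_set_integral[OF sing_density_int]) (auto simp: sets_Icc)
  show "emeasure lborel {x\<in>{a..b}. v x = 0} = 0" by (rule emeasure_v_zero)
  show "{x\<in>{a..b}. v x = 0} \<in> sets (restrict_space borel {a..b})" by (auto simp: sets_Icc)
  fix A assume A: "A \<in> sets (restrict_space borel {a..b})"
  then have A' [measurable]: "A \<in> sets borel" "A \<subseteq> {a..b}" by (auto simp: sets_Icc)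
  show "(LINT x:A|M. sing_density x) = 0" if "A \<inter> {x\<in>{a..b}. v x = 0} = {}"
  proof -
    have "sing_density x = 0" if "x \<in> A" for x
    proof -
      have "x \<notin> {x\<in>{a..b}. v x = 0}" using that \<open>A \<inter> _ = {}\<close> by blast
      then have "v x \<noteq> 0" using that A'(2) by auto
      then show ?thesis using v_eq_0[of x] by (auto simp: sing_density_def)
    qed
    then have "indicator A x *\<^sub>R sing_density x = 0" for x by (simp split: split_indicator)
    then show ?thesis unfolding set_lebesgue_integral_def by (simp only:) simp
  qed
  have "(LINT x:A|lebesgue_on {a..b}. ac_part x) = (\<integral>x. v x * (indicator A x *\<^sub>R ac_part x) \<partial>M)"
    unfolding set_lebesgue_integral_def by (rule integral_lebesgue_on) measurable
  also have "\<dots> = (LINT x:A|M. ac_part x * v x)"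
    unfolding set_lebesgue_integral_def by (simp add: ac_simps)
  finally have "(LINT x:A|lebesgue_on {a..b}. ac_part x) + (LINT x:A|M. sing_density x)
      = (LINT x:A|M. ac_part x * v x + sing_density x)"
    using A'(1) by (simp add: set_integral_add)
  then show "derivative_measure a b f A
      = (LINT x:A|lebesgue_on {a..b}. ac_part x) + (LINT x:A|M. sing_density x)"
    unfolding derivative_measure_eq[OF A] by (simp flip: u_split)
qed

lemma ac_density_AE: "AE x in lebesgue_on {a..b}. ac_density a b f x = ac_part x"
proof -
  have "\<exists>g \<sigma>. lebesgue_decomposition {a..b} (derivative_measure a b f) g \<sigma>"
    using lebesgue_decomposition_ac_sing by blast
  from someI_ex[OF this] show ?thesis
    unfolding ac_density_def[symmetric]
    using lebesgue_decomposition_unique(1)[OF _ _ lebesgue_decomposition_ac_sing] by auto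
qed

lemma singular_part_eq:
  assumes "A \<in> sets (restrict_space borel {a..b})"
  shows "singular_part a b f A = (LINT x:A|M. sing_density x)"
proof -
  have "\<exists>\<sigma> g. lebesgue_decomposition {a..b} (derivative_measure a b f) g \<sigma>"
    using lebesgue_decomposition_ac_sing by blast
  from someI_ex[OF this] show ?thesis
    unfolding singular_part_def[symmetric]
    using lebesgue_decomposition_unique(2)[OF _ _ lebesgue_decomposition_ac_sing _ assms] by auto
qed

lemma abs_singular_part_eq:
  "abs_singular_part a b f = restrict_space (density M (\<lambda>x. ennreal \<bar>sing_density x\<bar>)) {a..b}"
proof -
  \<comment> \<open>Total variation depends on the underlying measure only through its space and
    measurable sets, so M may stand in for \<open>borel\<close>.\<close>
  have eq: "sets (restrict_space M {a..b}) = sets (restrict_space borel {a..b})"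
    "space (restrict_space M {a..b}) = space (restrict_space borel {a..b})"
    by (simp_all add: sets_restrict_space space_restrict_space)
  have "abs_singular_part a b f = total_variation_measure (restrict_space M {a..b}) (singular_part a b f)"
    unfolding abs_singular_part_def total_variation_measure_def eq ..
  also have "\<dots> = restrict_space (density M (\<lambda>x. ennreal \<bar>sing_density x\<bar>)) {a..b}"
    by (rule total_variation_measure_set_integral) (auto simp: eq intro: singular_part_eq)
  finally show ?thesis .
qed

end

context phi_densities
begin

text \<open>Where v > 0 the singular density vanishes and the first integrand is \<Psi>; where v = 0
  only the recession term remains.\<close>

lemma total_eq:
  "total = (\<integral>\<^sup>+x. \<phi> x \<bar>ac_density a b f x\<bar> \<partial>lebesgue_on {a..b})
    + (\<integral>\<^sup>+x. recession \<phi> x \<partial>abs_singular_part a b f)"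
proof -
  have phi_meas [measurable]: "(\<lambda>x. indicator {a..b} x * \<phi> x \<bar>ac_part x\<bar>) \<in> borel_measurable borel"
    by (rule phi_borel) auto
  have rec_meas [measurable]: "(\<lambda>x. indicator {a..b} x * recession \<phi> x) \<in> borel_measurable borel"
    by (rule recession_borel) auto
  have "(\<integral>\<^sup>+x. \<phi> x \<bar>ac_density a b f x\<bar> \<partial>lebesgue_on {a..b})
      = (\<integral>\<^sup>+x. indicator {a..b} x * \<phi> x \<bar>ac_part x\<bar> \<partial>lebesgue_on {a..b})"
  \<comment> \<open>The chosen density is determined only almost everywhere; its Borel version
    \<open>ac_part\<close> is what can be transferred to M.\<close>
  proof (rule nn_integral_cong_AE)
    have "AE x in lebesgue_on {a..b}. x \<in> {a..b}"
      by (rule AE_I2) (simp add: space_restrict_space)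
    then show "AE x in lebesgue_on {a..b}. \<phi> x \<bar>ac_density a b f x\<bar> = indicator {a..b} x * \<phi> x \<bar>ac_part x\<bar>"
      using ac_density_AE by eventually_elim simp
  qed
  also have "\<dots> = (\<integral>\<^sup>+x. ennreal (v x) * (indicator {a..b} x * \<phi> x \<bar>ac_part x\<bar>) \<partial>M)"
    by (rule nn_integral_lebesgue_on) measurable
  finally have 1: "(\<integral>\<^sup>+x. \<phi> x \<bar>ac_density a b f x\<bar> \<partial>lebesgue_on {a..b})
      = (\<integral>\<^sup>+x. ennreal (v x) * (indicator {a..b} x * \<phi> x \<bar>ac_part x\<bar>) \<partial>M)" .
  have "(\<integral>\<^sup>+x. recession \<phi> x \<partial>abs_singular_part a b f)
      = (\<integral>\<^sup>+x. indicator {a..b} x * recession \<phi> x \<partial>density M (\<lambda>x. ennreal \<bar>sing_density x\<bar>))"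
    unfolding abs_singular_part_eq by (subst nn_integral_restrict_space) (auto simp: mult.commute)
  also have "\<dots> = (\<integral>\<^sup>+x. ennreal \<bar>sing_density x\<bar> * (indicator {a..b} x * recession \<phi> x) \<partial>M)"
    by (subst nn_integral_density) auto
  finally have "(\<integral>\<^sup>+x. \<phi> x \<bar>ac_density a b f x\<bar> \<partial>lebesgue_on {a..b})
      + (\<integral>\<^sup>+x. recession \<phi> x \<partial>abs_singular_part a b f)
      = (\<integral>\<^sup>+x. ennreal (v x) * (indicator {a..b} x * \<phi> x \<bar>ac_part x\<bar>)
          + ennreal \<bar>sing_density x\<bar> * (indicator {a..b} x * recession \<phi> x) \<partial>M)"
    unfolding 1 by (subst nn_integral_add) auto
  also have "\<dots> = total"
    unfolding total_def
  proof (rule nn_integral_cong_AE)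
    show "AE x in M. ennreal (v x) * (indicator {a..b} x * \<phi> x \<bar>ac_part x\<bar>)
          + ennreal \<bar>sing_density x\<bar> * (indicator {a..b} x * recession \<phi> x) = \<Psi> x * indicator {a..<b} x"
      using M_null
    proof eventually_elim
      case (elim x)
      then have "x \<in> {a..b}" by auto
      with elim show ?case
        using v_eq_0[of x] by (cases "0 < v x") (auto simp: \<Psi>_def ac_part_def sing_density_def abs_divide)
    qed
  qed
  finally show ?thesis ..
qed

end

theorem theorem6p4:
  fixes a b :: real and f :: "real \<Rightarrow> real" and \<phi> :: "real \<Rightarrow> real \<Rightarrow> ennreal"
  assumes "a < b"
    and "f \<in> BV {a..b}"
    and "\<forall>x\<in>{a<..b}. (f \<longlongrightarrow> f x) (at_left x)"
    and "\<phi> \<in> Phi_c {a..b}"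
    and "VA1 {a..b} \<phi>"
    and "Dec {a..b} \<phi>"
  shows "upper_phi_variation \<phi> {a..b} f =
      (\<integral>\<^sup>+ x. \<phi> x \<bar>ac_density a b f x\<bar> \<partial>lebesgue_on {a..b})
    + (\<integral>\<^sup>+ x. recession \<phi> x \<partial>abs_singular_part a b f)"
proof -
  obtain q where q: "1 < q" "\<And>x. x \<in> {a..b} \<Longrightarrow> antimono_on {0<..} (\<lambda>t. \<phi> x t / ennreal (t powr q))"
    using assms(6) by (auto simp: Dec_def)
  obtain M u v where M: "derivative_densities a b f M u v"
    using ex_derivative_densities[OF assms(1,2)] assms(3) by auto
  interpret phi_densities a b \<phi> q f M u v
    by (intro phi_densities.intro dec_phi.intro assms q M)
  show ?thesis using upper_phi_variation_eq_total total_eq by simp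
qed

end
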